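(* Let $G=\mathrm{GL}_n$ or $G=\mathrm{GSp}_{2n}$ over $F$, with maximal split torus $A$ and Borel subgroup $B\supset A$ as described in the context, and let $\tilde K=G(O_L)$. Let $b\in G(L)$ with Newton point $\nu=\bar\nu(b)\in X_*(A)_{\mathbf Q,\mathrm{dom}}$, and let $\mu\in X_*(A)_{\mathrm{dom}}$ with $\nu\le\mu$. Then the $\sigma$-conjugacy class $\{g^{-1}b\sigma(g):g\in G(L)\}$ of $b$ meets $\tilde K\pi^\mu\tilde K$. Equivalently, there exists $h\in G(L)/\tilde K$ with $\mathrm{inv}(h,b\sigma(h))=\mu$.
   Context: $F$ is a finite extension of $\mathbf Q_p$ with uniformizer $\pi$, $L$ is the completion of the maximal unramified extension of $F$, $O_L$ its ring of integers, and $\sigma$ the relative Frobenius automorphism of $L/F$. For $G=\mathrm{GL}_n$, $A$ is the diagonal torus and $B$ the upper triangular Borel subgroup; $X_*(A)=\mathbf Z^n$. For $G=\mathrm{GSp}_{2n}$ (similitudes of a symplectic form on $F^{2n}$ for which the diagonal torus and upper triangular matrices give a maximal torus and Borel subgroup), $A$ is the diagonal torus of $G$ and $X_*(A)=\{\mu\in\mathbf Z^{2n}:\mu_i+\mu_{2n+1-i}\text{ independent of }i\}$. For $\mu\in X_*(A)$, $\pi^\mu\in A(F)$ is the image of $\pi$ under $\mu$. $X_*(A)_{\mathrm{dom}}$ (resp. $X_*(A)_{\mathbf Q,\mathrm{dom}}$) denotes the $B$-dominant elements of $X_*(A)$ (resp. $X_*(A)\otimes\mathbf Q$), i.e. those with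 non-increasing entries. For $\nu,\mu\in X_*(A)\otimes\mathbf Q$, $\nu\le\mu$ means that $\mu-\nu$ is a non-negative linear combination of positive coroots (for $\mathrm{GL}_n$ this is the usual dominance order: partial sums of $\nu$ are $\le$ those of $\mu$, with equal total sums; for $\mathrm{GSp}_{2n}$ it is the dominance order of $\mathrm{GL}_{2n}$). By the Cartan decomposition every $g^{-1}h$ ($g,h\in G(L)$) lies in $\tilde K\pi^\mu\tilde K$ for a unique dominant $\mu$, denoted $\mathrm{inv}(g\tilde K,h\tilde K)$. The Newton point $\bar\nu(b)$ of $b\in G(L)$ (Kottwitz) is, for $\mathrm{GL}_n$, the slope vector in $(\mathbf Q^n)_+$ of the isocrystal $(L^n,b\sigma)$ and, for $\mathrm{GSp}_{2n}$, the slope vector of $(L^{2n},b\sigma)$; slopes are normalized so that $\pi$ has valuation 1. *)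

theory Defs
  imports "Jordan_Normal_Form.Determinant" "HOL-Computational_Algebra.Polynomial"
          "HOL-Computational_Algebra.Primes"
begin

text \<open>The field L is an abstract field of characteristic 0 (a type of class field_char_0)
 with a discrete valuation v (values on nonzero elements; v 0 is irrelevant), a uniformizer pi,
 and the relative Frobenius sigma.  F is the fixed field of sigma.  The conditions below
 characterise (L, v, sigma, pi) up to isomorphism as the completion of the maximal unramified
 extension of a finite extension F of Q_p, with pi a uniformizer of F, q the residue cardinality
 of F, and sigma the relative Frobenius.\<close>

definition close :: "('a::field \<Rightarrow> int) \<Rightarrow> int \<Rightarrow> 'a \<Rightarrow> 'a \<Rightarrow> bool" where
  "close v k x y \<longleftrightarrow> x = y \<or> k \<le> v (x - y)"

definition intg :: "('a::field \<Rightarrow> int) \<Rightarrow> 'a \<Rightarrow> bool" where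
  "intg v x \<longleftrightarrow> x = 0 \<or> 0 \<le> v x"

definition unram_setting ::
  "('a::field_char_0 \<Rightarrow> int) \<Rightarrow> ('a \<Rightarrow> 'a) \<Rightarrow> 'a \<Rightarrow> nat \<Rightarrow> nat \<Rightarrow> bool" where
  "unram_setting v \<sigma> \<pi> p q \<longleftrightarrow>
     prime p \<and> (\<exists>f\<ge>1. q = p ^ f) \<and>
     \<comment> \<open>discrete valuation, normalised by v pi = 1, residue characteristic p\<close>
     (\<forall>x y. x \<noteq> 0 \<longrightarrow> y \<noteq> 0 \<longrightarrow> v (x * y) = v x + v y) \<and>
     (\<forall>x y. x \<noteq> 0 \<longrightarrow> y \<noteq> 0 \<longrightarrow> x + y \<noteq> 0 \<longrightarrow> min (v x) (v y) \<le> v (x + y)) \<and>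
     \<pi> \<noteq> 0 \<and> v \<pi> = 1 \<and> 1 \<le> v (of_nat p) \<and>
     \<comment> \<open>completeness\<close>
     (\<forall>X :: nat \<Rightarrow> 'a. (\<forall>k. \<exists>M. \<forall>m\<ge>M. \<forall>m'\<ge>M. close v k (X m) (X m')) \<longrightarrow>
         (\<exists>l. \<forall>k. \<exists>M. \<forall>m\<ge>M. close v k (X m) l)) \<and>
     \<comment> \<open>residue field algebraically closed\<close>
     (\<forall>P :: 'a poly. lead_coeff P = 1 \<longrightarrow> degree P \<ge> 1 \<longrightarrow> (\<forall>i. intg v (coeff P i)) \<longrightarrow>
         (\<exists>x. intg v x \<and> close v 1 (poly P x) 0)) \<and>
     \<comment> \<open>residue field algebraic over F_p\<close>
     (\<forall>x. intg v x \<longrightarrow> (\<exists>m\<ge>1. close v 1 (x ^ (p ^ m)) x)) \<and>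
     \<comment> \<open>sigma: valuation preserving field automorphism fixing pi, lifting x |-> x^q\<close>
     bij \<sigma> \<and> (\<forall>x y. \<sigma> (x + y) = \<sigma> x + \<sigma> y) \<and> (\<forall>x y. \<sigma> (x * y) = \<sigma> x * \<sigma> y) \<and>
     \<sigma> 1 = 1 \<and> (\<forall>x. x \<noteq> 0 \<longrightarrow> v (\<sigma> x) = v x) \<and> \<sigma> \<pi> = \<pi> \<and>
     (\<forall>x. intg v x \<longrightarrow> close v 1 (\<sigma> x) (x ^ q))"

definition mat_intg :: "('a::field \<Rightarrow> int) \<Rightarrow> 'a mat \<Rightarrow> bool" where
  "mat_intg v M \<longleftrightarrow> (\<forall>i<dim_row M. \<forall>j<dim_col M. intg v (M $$ (i, j)))"

definition GLm :: "nat \<Rightarrow> 'a::field mat \<Rightarrow> bool" where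
  "GLm N M \<longleftrightarrow> M \<in> carrier_mat N N \<and> det M \<noteq> 0"

definition GLO :: "('a::field \<Rightarrow> int) \<Rightarrow> nat \<Rightarrow> 'a mat \<Rightarrow> bool" where
  "GLO v N M \<longleftrightarrow> GLm N M \<and> mat_intg v M \<and> v (det M) = 0"

text \<open>Symplectic form on F^(2n) (0-indexed basis e_0..e_(2n-1)):
 <e_i, e_(2n-1-i)> = 1 for i < n and -1 for i >= n; the diagonal torus and the upper
 triangular matrices are a maximal torus and a Borel subgroup of GSp for this form.\<close>
definition Jform :: "nat \<Rightarrow> 'a::field mat" where
  "Jform n = mat (2*n) (2*n) (\<lambda>(i,j). if j = 2*n - 1 - i then (if i < n then 1 else -1) else 0)"

definition GSpm :: "nat \<Rightarrow> 'a::field mat \<Rightarrow> bool" where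
  "GSpm n M \<longleftrightarrow> GLm (2*n) M \<and>
     (\<exists>c. c \<noteq> 0 \<and> transpose_mat M * Jform n * M = c \<cdot>\<^sub>m Jform n)"

datatype grp = GLgrp nat | GSpgrp nat

fun grp_n :: "grp \<Rightarrow> nat" where
  "grp_n (GLgrp n) = n" | "grp_n (GSpgrp n) = n"

fun rk :: "grp \<Rightarrow> nat" where
  "rk (GLgrp n) = n" | "rk (GSpgrp n) = 2*n"

fun in_G :: "grp \<Rightarrow> 'a::field mat \<Rightarrow> bool" where
  "in_G (GLgrp n) M = GLm n M" | "in_G (GSpgrp n) M = GSpm n M"

definition in_K :: "('a::field \<Rightarrow> int) \<Rightarrow> grp \<Rightarrow> 'a mat \<Rightarrow> bool" where
  "in_K v G M \<longleftrightarrow> in_G G M \<and> mat_intg v M \<and> v (det M) = 0"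

text \<open>cocharacters X_*(A), as integer vectors indexed by 0..rk G - 1\<close>
fun cochar :: "grp \<Rightarrow> (nat \<Rightarrow> int) \<Rightarrow> bool" where
  "cochar (GLgrp n) \<mu> = True"
| "cochar (GSpgrp n) \<mu> = (\<forall>i<2*n. \<mu> i + \<mu> (2*n - 1 - i) = \<mu> 0 + \<mu> (2*n - 1))"

definition dominant :: "nat \<Rightarrow> (nat \<Rightarrow> 'b::linorder) \<Rightarrow> bool" where
  "dominant N \<mu> \<longleftrightarrow> (\<forall>i j. i \<le> j \<longrightarrow> j < N \<longrightarrow> \<mu> j \<le> \<mu> i)"

definition pi_pow :: "'a::field \<Rightarrow> nat \<Rightarrow> (nat \<Rightarrow> int) \<Rightarrow> 'a mat" where
  "pi_pow \<pi> N \<mu> = mat N N (\<lambda>(i,j). if i = j then \<pi> powi \<mu> i else 0)"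

definition dom_le :: "nat \<Rightarrow> (nat \<Rightarrow> rat) \<Rightarrow> (nat \<Rightarrow> int) \<Rightarrow> bool" where
  "dom_le N \<nu> \<mu> \<longleftrightarrow> (\<forall>k\<le>N. (\<Sum>i<k. \<nu> i) \<le> (\<Sum>i<k. of_int (\<mu> i))) \<and>
                      (\<Sum>i<N. \<nu> i) = (\<Sum>i<N. of_int (\<mu> i))"

text \<open>twp sigma d B k = B * sigma(B) * ... * sigma^(k-1)(B), so that (B sigma)^k = twp .. k * sigma^k\<close>
fun twp :: "('a::field \<Rightarrow> 'a) \<Rightarrow> nat \<Rightarrow> 'a mat \<Rightarrow> nat \<Rightarrow> 'a mat" where
  "twp \<sigma> d B 0 = 1\<^sub>m d"
| "twp \<sigma> d B (Suc k) = twp \<sigma> d B k * map_mat (\<sigma> ^^ k) B"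

text \<open>nu is the slope vector (sorted non-increasingly) of the isocrystal (L^N, b sigma):
 after a change of basis g (b' = g^-1 b sigma(g)) the isocrystal is a direct sum of
 isoclinic pieces, namely consecutive diagonal blocks [e t, e (t+1)) of b', the t-th block B_t
 being isoclinic of slope r t / s t, i.e. the standard lattice satisfies
 (B_t sigma)^(s t) Lambda = pi^(r t) Lambda; nu lists each slope with multiplicity
 the dimension of its block.\<close>
definition newton_point ::
  "('a::field \<Rightarrow> int) \<Rightarrow> ('a \<Rightarrow> 'a) \<Rightarrow> 'a \<Rightarrow> nat \<Rightarrow> 'a mat \<Rightarrow> (nat \<Rightarrow> rat) \<Rightarrow> bool" where
  "newton_point v \<sigma> \<pi> N b \<nu> \<longleftrightarrow>
     dominant N \<nu> \<and>
     (\<exists>g b' (k::nat) (e::nat \<Rightarrow> nat) (r::nat \<Rightarrow> int) (s::nat \<Rightarrow> nat).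
        GLm N g \<and> b' \<in> carrier_mat N N \<and> g * b' = b * map_mat \<sigma> g \<and>
        e 0 = 0 \<and> e k = N \<and> (\<forall>t<k. e t < e (Suc t) \<and> 0 < s t) \<and>
        (\<forall>i<N. \<forall>j<N. b' $$ (i, j) \<noteq> 0 \<longrightarrow>
            (\<exists>t<k. e t \<le> i \<and> i < e (Suc t) \<and> e t \<le> j \<and> j < e (Suc t))) \<and>
        (\<forall>t<k. let d = e (Suc t) - e t;
                   B = mat d d (\<lambda>(a, c). b' $$ (e t + a, e t + c))
               in \<exists>U. GLO v d U \<and> twp \<sigma> d B (s t) = (\<pi> powi r t) \<cdot>\<^sub>m U) \<and>
        (\<forall>t<k. \<forall>i. e t \<le> i \<and> i < e (Suc t) \<longrightarrow> \<nu> i = of_int (r t) / of_nat (s t)))"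

end

theory Submission
  imports Defs "HOL-Library.Function_Algebras"
begin

text \<open>
  Write \<open>\<Phi> = b\<sigma>\<close>. With \<open>k2 = 1\<close> the theorem asks for a basis \<open>e\<close> of \<open>L\<^sup>N\<close>, symplectic up to a scalar in the
  second case, such that \<open>\<Phi> e\<^sub>i \<in> \<pi>\<^bsup>\<mu> i\<^esup> \<Lambda>\<close> for the lattice \<open>\<Lambda>\<close> spanned by \<open>e\<close>.

  Lang's theorem over the ring of integers turns the Newton point into a basis \<open>X\<close> with
  \<open>\<Phi>\<^bsup>S\<^esup> X\<^sub>i = \<pi>\<^bsup>S \<nu> i\<^esup> X\<^sub>i\<close>. For GL one takes a cyclic vector \<open>x\<close>, annihilated by a monic twisted polynomial \<open>P\<close>
  whose Newton polygon lies on or above the one given by \<open>\<nu>\<close>; in the basis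
  \<open>e\<^sub>i = \<pi>\<^bsup>-(\<mu> 0 + \<dots> + \<mu> (i-1))\<^esup> \<Phi>\<^bsup>i\<^esup> x\<close> one has \<open>\<Phi> e\<^sub>i = \<pi>\<^bsup>\<mu> i\<^esup> e\<^sub>i\<^sub>+\<^sub>1\<close>, and \<open>\<nu> \<le> \<mu>\<close> says exactly that the last column
  of this companion matrix has the required divisibility.

  For GSp with similitude valuation \<open>c\<close>, the space is an orthogonal sum of the part of slope \<open>c/2\<close> and of
  \<open>V\<^sub>+ \<oplus> V\<^sub>-\<close>, where \<open>V\<^sub>+\<close> has slopes \<open>> c/2\<close> and \<open>V\<^sub>-\<close> is its dual. The former is an orthogonal sum of planes
  \<open>\<langle>z, \<Phi> z\<rangle>\<close> with \<open>\<Phi>\<^sup>2 z = \<pi>\<^bsup>c\<^esup> z\<close>, because \<open>B x (\<Phi> y)\<close> is a nondegenerate skew-hermitian form; such a plane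
  realises every Hodge type \<open>(m, c - m)\<close>. On \<open>V\<^sub>+\<close> one takes a companion basis of a type \<open>a\<close> with
  \<open>c - \<mu> i \<le> a i \<le> \<mu> i\<close>, and a unipotent change of the dual basis of \<open>V\<^sub>-\<close>, whose existence is a linear
  Frobenius equation, raises the type \<open>(a i, c - a i)\<close> to \<open>(\<mu> i, c - \<mu> i)\<close>.
\<close>

section \<open>Twisted linear equations over a complete unramified field\<close>

text \<open>Existence always comes down to a scalar equation
  \<open>\<Sum>j\<le>m. t j * \<sigma>^j a = x\<close>: modulo \<open>\<pi>\<close> it is an
  additive polynomial over an algebraically closed field, and completeness lifts a root. The
  obstacle for GSp is that \<open>\<nu> \<le> \<mu>\<close> guarantees equality of sums only at
  \<open>2n\<close>. The first \<open>K = dim V_+\<close> entries of \<open>\<mu>\<close> may add up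
  to more than the total slope of \<open>V_+\<close>, so in general no lattice that splits along
  \<open>V_+ \<oplus> V_-\<close> has type \<open>\<mu>\<close>; the unipotent correction is what
  glues the two halves. The multiplier of \<open>b\<close> is \<open>\<pi>^c\<close> only up to a
  unit \<open>u\<close>. Scaling the form by \<open>\<omega>\<close> with
  \<open>\<sigma> \<omega> = u \<omega>\<close> absorbs \<open>u\<close>, so that
  \<open>B (\<Phi> x) (\<Phi> y) = \<pi>^c \<sigma> (B x y)\<close> holds exactly. The exponent
  \<open>S\<close> is kept even so that vectors with \<open>\<Phi>^2 z = \<pi>^c z\<close> are
  eigenvectors of \<open>\<Phi>^S\<close>. For GL the matrix of \<open>\<Phi>\<close> must be shown
  invertible over the integers, which is why the companion basis records containments in both
  directions. For GSp one containment suffices, as an integral matrix preserving the form has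
  determinant of square 1.\<close>

locale unram =
  fixes v :: "'a::field_char_0 \<Rightarrow> int" and \<sigma> :: "'a \<Rightarrow> 'a" and \<pi> :: 'a and p q :: nat
  assumes setting: "unram_setting v \<sigma> \<pi> p q"
begin

definition vge :: "int \<Rightarrow> 'a \<Rightarrow> bool" where
  "vge k x \<longleftrightarrow> x = 0 \<or> k \<le> v x"

lemma intg_vge: "intg v x \<longleftrightarrow> vge 0 x"
  by (simp add: intg_def vge_def)

lemma close_vge: "close v k x y \<longleftrightarrow> vge k (x - y)"
  by (auto simp: close_def vge_def)

lemma v_mult: "x \<noteq> 0 \<Longrightarrow> y \<noteq> 0 \<Longrightarrow> v (x * y) = v x + v y"
  using setting unfolding unram_setting_def by blast

lemma v_add_ge: "x \<noteq> 0 \<Longrightarrow> y \<noteq> 0 \<Longrightarrow> x + y \<noteq> 0 \<Longrightarrow> min (v x) (v y) \<le> v (x + y)"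
  using setting unfolding unram_setting_def by blast

lemma pi_nz [simp]: "\<pi> \<noteq> 0" and v_pi [simp]: "v \<pi> = 1"
  using setting unfolding unram_setting_def by blast+

lemma complete:
  fixes X :: "nat \<Rightarrow> 'a"
  assumes "\<And>k. \<exists>M. \<forall>m\<ge>M. \<forall>m'\<ge>M. vge k (X m - X m')"
  shows "\<exists>l. \<forall>k. \<exists>M. \<forall>m\<ge>M. vge k (X m - l)"
proof -
  have "\<forall>X :: nat \<Rightarrow> 'a. (\<forall>k. \<exists>M. \<forall>m\<ge>M. \<forall>m'\<ge>M. close v k (X m) (X m')) \<longrightarrow>
         (\<exists>l. \<forall>k. \<exists>M. \<forall>m\<ge>M. close v k (X m) l)"
    using setting unfolding unram_setting_def by blast
  note * = this[unfolded close_vge, rule_format, of X]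
  show ?thesis by (rule *) (rule assms)
qed

lemma residue_root:
  assumes "lead_coeff P = 1" "degree P \<ge> 1" "\<And>i. vge 0 (coeff P i)"
  shows "\<exists>x. vge 0 x \<and> vge 1 (poly P x)"
proof -
  have "\<forall>P :: 'a poly. lead_coeff P = 1 \<longrightarrow> degree P \<ge> 1 \<longrightarrow> (\<forall>i. intg v (coeff P i)) \<longrightarrow>
         (\<exists>x. intg v x \<and> close v 1 (poly P x) 0)"
    using setting unfolding unram_setting_def by blast
  thus ?thesis using assms by (auto simp: close_vge intg_vge)
qed

lemma bij_sig: "bij \<sigma>"
  and sig_add: "\<sigma> (x + y) = \<sigma> x + \<sigma> y"
  and sig_mult: "\<sigma> (x * y) = \<sigma> x * \<sigma> y"
  and sig_1: "\<sigma> 1 = 1"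
  and sig_pi: "\<sigma> \<pi> = \<pi>"
  using setting unfolding unram_setting_def by blast+

lemma v_sig: "x \<noteq> 0 \<Longrightarrow> v (\<sigma> x) = v x"
  and sig_frob: "vge 0 x \<Longrightarrow> vge 1 (\<sigma> x - x ^ q)"
  using setting unfolding unram_setting_def intg_vge close_vge by blast+

lemma q_ge_2: "q \<ge> 2"
proof -
  obtain f where "prime p" "f \<ge> 1" "q = p ^ f"
    using setting unfolding unram_setting_def by blast
  moreover have "p \<ge> 2" using \<open>prime p\<close> by (rule prime_ge_2_nat)
  moreover have "p ^ 1 \<le> p ^ f" using calculation by (intro power_increasing) auto
  ultimately show ?thesis by simp
qed

lemma v_1 [simp]: "v 1 = 0"
  using v_mult[of 1 1] by simp

lemma v_m1 [simp]: "v (- 1) = 0"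
  using v_mult[of "- 1" "- 1"] by simp

lemma v_uminus [simp]: "v (- x) = v x"
proof (cases "x = 0")
  case False
  thus ?thesis using v_mult[of "-1" x] by simp
qed simp

lemma v_inverse: "x \<noteq> 0 \<Longrightarrow> v (inverse x) = - v x"
  using v_mult[of x "inverse x"] by simp

lemma v_divide: "x \<noteq> 0 \<Longrightarrow> y \<noteq> 0 \<Longrightarrow> v (x / y) = v x - v y"
  by (simp add: divide_inverse v_mult v_inverse)

lemma v_power: "x \<noteq> 0 \<Longrightarrow> v (x ^ n) = int n * v x"
  by (induction n) (auto simp: v_mult algebra_simps)

lemma v_powi: "x \<noteq> 0 \<Longrightarrow> v (x powi k) = k * v x"
  by (auto simp: power_int_def v_power v_inverse power_inverse)

lemma pi_powi_add: "\<pi> powi (a + b) = \<pi> powi a * \<pi> powi b"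
  by (simp add: power_int_add)

lemma pi_powi_mult: "\<pi> powi a * \<pi> powi b = \<pi> powi (a + b)"
  by (simp add: power_int_add)

lemma v_pipow [simp]: "v (\<pi> powi k) = k" by (simp add: v_powi)

lemma vge_0 [simp]: "vge k 0" by (simp add: vge_def)

lemma vge_1 [simp]: "vge 0 1" by (simp add: vge_def)

lemma vge_v: "vge k x \<Longrightarrow> x \<noteq> 0 \<Longrightarrow> k \<le> v x" by (auto simp: vge_def)

lemma vgeI: "(x \<noteq> 0 \<Longrightarrow> k \<le> v x) \<Longrightarrow> vge k x" by (auto simp: vge_def)

lemma vge_mono: "vge k x \<Longrightarrow> l \<le> k \<Longrightarrow> vge l x" by (auto simp: vge_def)

lemma vge_uminus [simp]: "vge k (- x) = vge k x" by (auto simp: vge_def)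

lemma vge_add: "vge k x \<Longrightarrow> vge k y \<Longrightarrow> vge k (x + y)"
  using v_add_ge[of x y] by (cases "x = 0 \<or> y = 0 \<or> x + y = 0") (auto simp: vge_def)

lemma vge_diff: "vge k x \<Longrightarrow> vge k y \<Longrightarrow> vge k (x - y)"
  using vge_add[of k x "- y"] by simp

lemma vge_mult: "vge k x \<Longrightarrow> vge l y \<Longrightarrow> vge (k + l) (x * y)"
  by (cases "x = 0 \<or> y = 0") (auto simp: vge_def v_mult)

lemma vge_mult0: "vge 0 x \<Longrightarrow> vge k y \<Longrightarrow> vge k (x * y)"
  using vge_mult[of 0 x k y] by simp

lemma vge_mult0': "vge k x \<Longrightarrow> vge 0 y \<Longrightarrow> vge k (x * y)"
  using vge_mult[of k x 0 y] by simp

lemma vge_sum: "(\<And>i. i \<in> A \<Longrightarrow> vge k (f i)) \<Longrightarrow> vge k (sum f A)"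
  by (induction A rule: infinite_finite_induct) (auto intro: vge_add)

lemma vge_prod: "(\<And>i. i \<in> A \<Longrightarrow> vge 0 (f i)) \<Longrightarrow> vge 0 (prod f A)"
  by (induction A rule: infinite_finite_induct) (auto intro: vge_mult0)

lemma vge_power: "vge 0 x \<Longrightarrow> vge 0 (x ^ n)"
  by (induction n) (auto intro: vge_mult0)

lemma vge_powi [simp]: "vge k (\<pi> powi l) \<longleftrightarrow> k \<le> l" by (simp add: vge_def)

lemma vge_pow [simp]: "vge k (\<pi> ^ l) \<longleftrightarrow> k \<le> int l" by (simp add: vge_def v_power)

lemma vge_all_0: "(\<And>k. vge k x) \<Longrightarrow> x = 0"
proof (rule ccontr)
  assume "\<And>k. vge k x" "x \<noteq> 0"
  hence "v x + 1 \<le> v x" using vge_v by blast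
  thus False by simp
qed

text \<open>Used to show that a sum is nonzero by exhibiting one strictly dominant term.\<close>

lemma v_add_less: "x \<noteq> 0 \<Longrightarrow> vge (v x + 1) y \<Longrightarrow> x + y \<noteq> 0 \<and> v (x + y) = v x"
proof -
  assume x: "x \<noteq> 0" and y: "vge (v x + 1) y"
  show ?thesis
  proof (cases "y = 0")
    case False
    hence vy: "v x + 1 \<le> v y" using y vge_v by blast
    have nz: "x + y \<noteq> 0"
    proof
      assume "x + y = 0"
      hence "y = - x" by (simp add: eq_neg_iff_add_eq_0 add.commute)
      thus False using vy by simp
    qed
    have "v x \<le> v (x + y)" using v_add_ge[OF x False nz] vy by simp
    moreover have "v (x + y) \<le> v x"
      using v_add_ge[of "x + y" "- y"] nz False x vy by (auto simp: min_def split: if_splits)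
    ultimately show ?thesis using nz by simp
  qed (simp add: x)
qed

lemma vge_unit_div: "vge k x \<Longrightarrow> u \<noteq> 0 \<Longrightarrow> v u = 0 \<Longrightarrow> vge k (x / u)"
  by (cases "x = 0") (auto simp: vge_def v_divide)

lemma vge_pi_scale: "vge k (\<pi> powi l * x) \<longleftrightarrow> vge (k - l) x"
  by (cases "x = 0") (auto simp: vge_def v_mult)

lemma vge_pi_div: "vge k (x / \<pi>) \<longleftrightarrow> vge (k + 1) x"
  by (cases "x = 0") (auto simp: vge_def v_divide)

section \<open>Iterates of Frobenius\<close>

lemma sn_add: "(\<sigma> ^^ j) (x + y) = (\<sigma> ^^ j) x + (\<sigma> ^^ j) y"
  by (induction j) (auto simp: sig_add)

lemma sn_mult: "(\<sigma> ^^ j) (x * y) = (\<sigma> ^^ j) x * (\<sigma> ^^ j) y"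
  by (induction j) (auto simp: sig_mult)

lemma sn_1 [simp]: "(\<sigma> ^^ j) 1 = 1"
  by (induction j) (auto simp: sig_1)

lemma sn_0 [simp]: "(\<sigma> ^^ j) 0 = 0"
  using sn_add[of j 0 0] by simp

lemma sn_uminus: "(\<sigma> ^^ j) (- x) = - (\<sigma> ^^ j) x"
  using sn_add[of j x "- x"] by (simp add: eq_neg_iff_add_eq_0 add.commute)

lemma sn_diff: "(\<sigma> ^^ j) (x - y) = (\<sigma> ^^ j) x - (\<sigma> ^^ j) y"
  using sn_add[of j x "- y"] by (simp add: sn_uminus)

lemma sn_sum: "(\<sigma> ^^ j) (sum f A) = (\<Sum>i\<in>A. (\<sigma> ^^ j) (f i))"
  by (induction A rule: infinite_finite_induct) (auto simp: sn_add)

lemma sn_bij: "bij (\<sigma> ^^ j)"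
  using bij_sig by (rule bij_fn)

lemma sn_eq_0 [simp]: "(\<sigma> ^^ j) x = 0 \<longleftrightarrow> x = 0"
  using sn_bij[of j] sn_0[of j] by (metis bij_is_inj injD)

lemma sn_surj: "\<exists>y. (\<sigma> ^^ j) y = x"
  using sn_bij[of j] by (metis bij_pointE)

lemma v_sn [simp]: "v ((\<sigma> ^^ j) x) = v x"
proof (cases "x = 0")
  case False
  thus ?thesis
  proof (induction j)
    case (Suc j)
    thus ?case using v_sig[of "(\<sigma> ^^ j) x"] by simp
  qed simp
qed simp

lemma vge_sn [simp]: "vge k ((\<sigma> ^^ j) x) \<longleftrightarrow> vge k x"
  by (simp add: vge_def)

lemma sn_power: "(\<sigma> ^^ j) (x ^ n) = ((\<sigma> ^^ j) x) ^ n"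
  by (induction n) (auto simp: sn_mult)

lemma sn_inverse: "(\<sigma> ^^ j) (inverse x) = inverse ((\<sigma> ^^ j) x)"
proof (cases "x = 0")
  case False
  hence "(\<sigma> ^^ j) x * (\<sigma> ^^ j) (inverse x) = 1" by (simp flip: sn_mult)
  thus ?thesis by (metis inverse_unique)
qed simp

lemma sn_divide: "(\<sigma> ^^ j) (x / y) = (\<sigma> ^^ j) x / (\<sigma> ^^ j) y"
  by (simp add: divide_inverse sn_mult sn_inverse)

lemma sn_pi [simp]: "(\<sigma> ^^ j) \<pi> = \<pi>"
  by (induction j) (auto simp: sig_pi)

lemma sn_powi [simp]: "(\<sigma> ^^ j) (\<pi> powi k) = \<pi> powi k"
  by (simp add: power_int_def sn_power sn_inverse)

lemmas sig_simps = sn_0[of 1, simplified] sn_uminus[of 1, simplified] sn_diff[of 1, simplified]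
  sn_sum[of 1, simplified] sn_eq_0[of 1, simplified] v_sn[of 1, simplified]
  vge_sn[of _ 1, simplified] sn_inverse[of 1, simplified] sn_divide[of 1, simplified]
  sn_powi[of 1, simplified] sig_add sig_mult sig_1 sig_pi

lemma sn_frob: "vge 0 x \<Longrightarrow> vge 1 ((\<sigma> ^^ j) x - x ^ (q ^ j))"
proof (induction j)
  case (Suc j)
  let ?y = "(\<sigma> ^^ j) x"
  have "vge 1 (\<sigma> (?y - x ^ (q ^ j)))" using vge_sn[of 1 1 "?y - x ^ (q ^ j)"] Suc by (simp del: vge_sn)
  moreover have "vge 1 (\<sigma> (x ^ (q ^ j)) - (x ^ (q ^ j)) ^ q)"
    by (intro sig_frob vge_power Suc.prems)
  ultimately have "vge 1 (\<sigma> (?y - x ^ (q ^ j)) + (\<sigma> (x ^ (q ^ j)) - (x ^ (q ^ j)) ^ q))"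
    by (rule vge_add)
  thus ?case by (simp add: sig_simps power_mult[symmetric] mult.commute)
qed simp

section \<open>Scalar equations in the powers of \<open>\<sigma>\<close>\<close>

lemma integral_scaling:
  assumes "finite J" "j \<in> J" "t j \<noteq> 0"
  shows "\<exists>k. (\<forall>i\<in>J. vge 0 (\<pi> powi k * t i)) \<and> (\<exists>i\<in>J. t i \<noteq> 0 \<and> v (\<pi> powi k * t i) = 0)"
proof -
  let ?A = "(\<lambda>i. v (t i)) ` {i \<in> J. t i \<noteq> 0}"
  have fin: "finite ?A" "?A \<noteq> {}" using assms by auto
  obtain i where "Min ?A = v (t i)" and "i \<in> {i \<in> J. t i \<noteq> 0}"
    using Min_in[OF fin] by (rule imageE)
  hence i: "i \<in> J" "t i \<noteq> 0" "v (t i) = Min ?A" by auto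
  have "vge 0 (\<pi> powi (- Min ?A) * t l)" if "l \<in> J" for l
  proof (cases "t l = 0")
    case False
    hence "Min ?A \<le> v (t l)" using that fin by (intro Min_le) auto
    thus ?thesis using False by (simp only: vge_pi_scale) (simp add: vge_def)
  qed simp
  moreover have "v (\<pi> powi (- Min ?A) * t i) = 0" using i by (simp add: v_mult)
  ultimately show ?thesis using i by blast
qed

text \<open>The operator of the twisted polynomial with coefficients \<open>t 0, ..., t m\<close>.
  It is additive and, as \<open>\<sigma>\<close> fixes \<open>\<pi>\<close>, commutes with powers of
  \<open>\<pi>\<close>; both facts drive the successive approximation below.\<close>

definition ell :: "(nat \<Rightarrow> 'a) \<Rightarrow> nat \<Rightarrow> 'a \<Rightarrow> 'a" where
  "ell t m a = (\<Sum>j\<le>m. t j * (\<sigma> ^^ j) a)"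

lemma ell_add: "ell t m (a + b) = ell t m a + ell t m b"
  by (simp add: ell_def sn_add sum.distrib algebra_simps)

lemma ell_diff: "ell t m (a - b) = ell t m a - ell t m b"
  by (simp add: ell_def sn_diff sum_subtractf algebra_simps)

lemma ell_pi: "ell t m (\<pi> powi k * b) = \<pi> powi k * ell t m b"
  by (simp add: ell_def sn_mult sum_distrib_left algebra_simps)

lemma vge_ell: "(\<And>j. j \<le> m \<Longrightarrow> vge 0 (t j)) \<Longrightarrow> vge k a \<Longrightarrow> vge k (ell t m a)"
  unfolding ell_def by (intro vge_sum vge_mult0) auto

text \<open>Modulo \<open>\<pi>\<close> each \<open>\<sigma>^j\<close> is the power map with
  exponent \<open>q^j\<close>, and the coefficients beyond \<open>n\<close> vanish, so the operator
  reduces to an additive polynomial.\<close>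

lemma vge_ell_diff:
  assumes "\<And>j. j \<le> m \<Longrightarrow> vge 0 (t j)" "n \<le> m" "\<And>j. n < j \<Longrightarrow> j \<le> m \<Longrightarrow> vge 1 (t j)" "vge 0 a"
  shows "vge 1 (ell t m a - (\<Sum>j\<le>n. t j * a ^ (q ^ j)))"
proof -
  have "ell t m a = (\<Sum>j\<le>n. t j * (\<sigma> ^^ j) a) + (\<Sum>j\<in>{n<..m}. t j * (\<sigma> ^^ j) a)"
    unfolding ell_def using assms(2)
    by (subst sum.union_disjoint[symmetric]) (auto intro: sum.cong)
  hence "ell t m a - (\<Sum>j\<le>n. t j * a ^ (q ^ j)) =
      (\<Sum>j\<le>n. t j * ((\<sigma> ^^ j) a - a ^ (q ^ j))) + (\<Sum>j\<in>{n<..m}. t j * (\<sigma> ^^ j) a)"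
    by (simp add: algebra_simps sum_subtractf)
  also have "vge 1 \<dots>"
  proof (intro vge_add vge_sum)
    show "vge 1 (t j * ((\<sigma> ^^ j) a - a ^ q ^ j))" if "j \<in> {..n}" for j
      using that assms by (intro vge_mult0 sn_frob) auto
    show "vge 1 (t j * (\<sigma> ^^ j) a)" if "j \<in> {n<..m}" for j
      using that assms by (intro vge_mult0') auto
  qed
  finally show ?thesis .
qed

text \<open>Dividing by the last unit coefficient \<open>t n0\<close> makes the reduced equation
  monic of degree \<open>q^n0\<close>, so a residue root exists. The degree is positive even for
  \<open>n0 = 0\<close>, where the equation is linear.\<close>

lemma ell_approx:
  assumes "\<And>j. j \<le> m \<Longrightarrow> vge 0 (t j)" "n \<le> m" "t n \<noteq> 0" "v (t n) = 0" "vge 0 x"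
  shows "\<exists>a. vge 0 a \<and> vge 1 (ell t m a - x)"
proof -
  define n0 where "n0 = Max {j. j \<le> m \<and> t j \<noteq> 0 \<and> v (t j) = 0}"
  have "finite {j. j \<le> m \<and> t j \<noteq> 0 \<and> v (t j) = 0}" by simp
  moreover have "{j. j \<le> m \<and> t j \<noteq> 0 \<and> v (t j) = 0} \<noteq> {}" using assms by auto
  ultimately have n0: "n0 \<le> m" "t n0 \<noteq> 0" "v (t n0) = 0"
    and max: "\<And>j. j \<le> m \<Longrightarrow> t j \<noteq> 0 \<Longrightarrow> v (t j) = 0 \<Longrightarrow> j \<le> n0"
    using Max_in[of "{j. j \<le> m \<and> t j \<noteq> 0 \<and> v (t j) = 0}"] by (auto simp: n0_def)
  have hi: "vge 1 (t j)" if "n0 < j" "j \<le> m" for j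
  proof (rule vgeI)
    assume "t j \<noteq> 0"
    thus "1 \<le> v (t j)" using max[of j] that vge_v[OF assms(1)[of j]] by force
  qed
  define P where "P = (\<Sum>j\<le>n0. monom (t j / t n0) (q ^ j)) - [: x / t n0 :]"
  have poly: "poly P a = ((\<Sum>j\<le>n0. t j * a ^ (q ^ j)) - x) / t n0" for a
    by (simp add: P_def poly_sum poly_monom sum_divide_distrib diff_divide_distrib)
  have split: "P = monom 1 (q ^ n0) + ((\<Sum>j<n0. monom (t j / t n0) (q ^ j)) - [: x / t n0 :])"
    using n0 by (simp add: P_def atMost_Suc_eq_insert_0 lessThan_Suc_atMost[symmetric] algebra_simps)
  have lt: "degree ((\<Sum>j<n0. monom (t j / t n0) (q ^ j)) - [: x / t n0 :]) < q ^ n0"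
  proof (intro degree_diff_less)
    have "0 < q ^ n0" using q_ge_2 by simp
    thus "degree [:x / t n0:] < q ^ n0" by simp
    show "degree (\<Sum>j<n0. monom (t j / t n0) (q ^ j)) < q ^ n0"
    proof (rule degree_sum_less)
      fix j assume "j \<in> {..<n0}"
      hence "q ^ j < q ^ n0" using q_ge_2 by (intro power_strict_increasing) auto
      thus "degree (monom (t j / t n0) (q ^ j)) < q ^ n0"
        using degree_monom_le le_less_trans by blast
    qed (use \<open>0 < q ^ n0\<close> in simp)
  qed
  have deg: "degree P = q ^ n0" unfolding split
    using lt by (subst degree_add_eq_left) (auto simp: degree_monom_eq)
  have "lead_coeff P = 1" unfolding deg unfolding split
    using coeff_eq_0[OF lt] by (simp del: coeff_diff)
  moreover have "degree P \<ge> 1" using deg q_ge_2 by (simp add: Suc_le_eq)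
  moreover have "vge 0 (coeff P i)" for i
  proof -
    have "vge 0 (\<Sum>j\<le>n0. coeff (monom (t j / t n0) (q ^ j)) i)"
      using assms n0 by (intro vge_sum) (auto intro!: vge_unit_div)
    moreover have "vge 0 (coeff [:x / t n0:] i)"
      using assms n0 by (auto simp: coeff_pCons intro!: vge_unit_div split: nat.splits)
    ultimately show ?thesis unfolding P_def coeff_diff coeff_sum by (rule vge_diff)
  qed
  ultimately obtain a where a: "vge 0 a" "vge 1 (poly P a)" using residue_root by blast
  have "vge 1 (t n0 * poly P a)" using a assms n0 by (intro vge_mult0) auto
  hence "vge 1 ((\<Sum>j\<le>n0. t j * a ^ (q ^ j)) - x)" using n0 by (simp add: poly)
  moreover have "vge 1 (ell t m a - (\<Sum>j\<le>n0. t j * a ^ (q ^ j)))"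
    by (rule vge_ell_diff) (use assms(1) n0 hi a in auto)
  ultimately have "vge 1 ((ell t m a - (\<Sum>j\<le>n0. t j * a ^ (q ^ j))) +
      ((\<Sum>j\<le>n0. t j * a ^ (q ^ j)) - x))" by (rule vge_add[rotated])
  thus ?thesis using a by auto
qed

text \<open>An approximate solution leaves an error in \<open>\<pi> O\<close>; divided by
  \<open>\<pi>\<close> it is the next right-hand side. The corrections
  \<open>\<pi>^i A (r i)\<close> form a convergent series.\<close>

lemma ell_solve_integral:
  assumes t: "\<And>j. j \<le> m \<Longrightarrow> vge 0 (t j)" and n: "n \<le> m" "t n \<noteq> 0" "v (t n) = 0" and x: "vge 0 x"
  shows "\<exists>a. vge 0 a \<and> ell t m a = x"
proof -
  have "\<forall>x. \<exists>a. vge 0 x \<longrightarrow> vge 0 a \<and> vge 1 (ell t m a - x)"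
    using ell_approx[of m t n, OF t n] by auto
  then obtain A where A: "\<And>x. vge 0 x \<Longrightarrow> vge 0 (A x) \<and> vge 1 (ell t m (A x) - x)"
    by metis
  define r where "r = rec_nat x (\<lambda>_ y. (y - ell t m (A y)) / \<pi>)"
  have r0: "r 0 = x" and rS: "\<And>i. r (Suc i) = (r i - ell t m (A (r i))) / \<pi>"
    by (auto simp: r_def)
  have rint: "vge 0 (r i)" for i
  proof (induction i)
    case (Suc i)
    have "vge 1 (r i - ell t m (A (r i)))" using A[OF Suc] by (metis minus_diff_eq vge_uminus)
    thus ?case unfolding rS by (simp add: vge_pi_div)
  qed (simp add: r0 x)
  define X where "X n = (\<Sum>i<n. \<pi> powi int i * A (r i))" for n :: nat
  have XS: "X (Suc n) = X n + \<pi> powi int n * A (r n)" for n by (simp add: X_def)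
  have X: "x - ell t m (X n) = \<pi> powi int n * r n" for n
  proof (induction n)
    case 0 thus ?case by (simp add: X_def r0 ell_def)
  next
    case (Suc n)
    have "x - ell t m (X (Suc n)) = \<pi> powi int n * r n - \<pi> powi int n * ell t m (A (r n))"
      unfolding Suc[symmetric] XS ell_add ell_pi by simp
    also have "\<dots> = \<pi> powi int (Suc n) * r (Suc n)" by (simp add: rS power_int_add field_simps)
    finally show ?case .
  qed
  have diff: "vge (int n) (X m' - X n)" if "n \<le> m'" for n m'
  proof -
    have "X m' - X n = (\<Sum>i\<in>{n..<m'}. \<pi> powi int i * A (r i))"
      using that sum_diff_nat_ivl[of 0 n m' "\<lambda>i. \<pi> powi int i * A (r i)"]
      by (simp add: X_def lessThan_atLeast0)
    also have "vge (int n) \<dots>"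
    proof (rule vge_sum)
      fix i assume "i \<in> {n..<m'}"
      hence "vge (int n) (\<pi> powi int i)" by simp
      thus "vge (int n) (\<pi> powi int i * A (r i))"
        using A[OF rint[of i]] by (intro vge_mult0') auto
    qed
    finally show ?thesis .
  qed
  have "\<exists>M. \<forall>m\<ge>M. \<forall>m'\<ge>M. vge k (X m - X m')" for k
  proof (intro exI allI impI)
    fix m m' assume "m \<ge> nat k" "m' \<ge> nat k"
    hence "vge (int (nat k)) ((X m - X (nat k)) - (X m' - X (nat k)))"
      by (intro vge_diff diff)
    thus "vge k (X m - X m')" by (auto elim: vge_mono)
  qed
  then obtain l where l: "\<And>k. \<exists>M. \<forall>m\<ge>M. vge k (X m - l)" using complete[of X] by blast
  have "vge 0 l"
  proof -
    obtain M where "vge 0 (X M - l)" using l[of 0] by blast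
    moreover have "vge 0 (X M - X 0)" using diff[of 0 M] by simp
    ultimately have "vge 0 ((X M - X 0) - (X M - l))" by (rule vge_diff[rotated])
    thus ?thesis by (simp add: X_def)
  qed
  moreover have "ell t m l - x = 0"
  proof (rule vge_all_0)
    fix k
    obtain M where M: "\<And>n. n \<ge> M \<Longrightarrow> vge k (X n - l)" using l[of k] by blast
    define n where "n = max M (nat k)"
    have "vge k (ell t m (X n - l))" by (intro vge_ell t M) (auto simp: n_def)
    moreover have "vge k (x - ell t m (X n))" unfolding X
      using rint[of n] by (intro vge_mult0') (auto simp: n_def simp flip: nat_le_iff)
    ultimately have "vge k (ell t m (X n - l) + (x - ell t m (X n)))" by (rule vge_add)
    hence "vge k (- (ell t m l - x))" by (simp add: ell_diff)
    thus "vge k (ell t m l - x)" by (simp only: vge_uminus)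
  qed
  ultimately show ?thesis by auto
qed

lemma ell_scale: "ell (\<lambda>j. c * t j) m a = c * ell t m a"
  by (simp add: ell_def sum_distrib_left mult.assoc)

lemma ell_surj:
  assumes "n \<le> m" "t n \<noteq> 0"
  shows "\<exists>a. ell t m a = x"
proof -
  obtain k i where k: "\<And>j. j \<le> m \<Longrightarrow> vge 0 (\<pi> powi k * t j)"
    and i: "i \<le> m" "t i \<noteq> 0" "v (\<pi> powi k * t i) = 0"
    using integral_scaling[of "{..m}" n t] assms by auto
  obtain l where l: "vge 0 (\<pi> powi l * (\<pi> powi k * x))"
  proof (cases "x = 0")
    case False
    hence "vge 0 (\<pi> powi (- k - v x) * (\<pi> powi k * x))" by (simp add: vge_def v_mult)
    thus ?thesis using that by blast
  qed (use that in simp)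
  obtain a where "ell (\<lambda>j. \<pi> powi k * t j) m a = \<pi> powi l * (\<pi> powi k * x)"
    using ell_solve_integral[of m "\<lambda>j. \<pi> powi k * t j" i] k i l by auto
  hence "\<pi> powi k * ell t m a = \<pi> powi k * (\<pi> powi l * x)" by (simp add: ell_scale mult.left_commute)
  hence "ell t m a = \<pi> powi l * x" by simp
  hence "\<pi> powi (- l) * ell t m a = x" by (simp add: mult.assoc[symmetric] pi_powi_mult)
  thus ?thesis using ell_pi by metis
qed

text \<open>Two unit coefficients give the reduced additive polynomial a nonzero root: once the
  lowest power is divided out, a non-constant polynomial with unit constant term remains. Its root
  is a unit, and the inhomogeneous equation lifts it to an exact zero.\<close>

lemma ell_kernel:
  assumes t: "\<And>j. j \<le> m \<Longrightarrow> vge 0 (t j)"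
    and n: "n < n'" "n' \<le> m" "t n \<noteq> 0" "v (t n) = 0" "t n' \<noteq> 0" "v (t n') = 0"
  shows "\<exists>a. a \<noteq> 0 \<and> v a = 0 \<and> ell t m a = 0"
proof -
  let ?U = "{j. j \<le> m \<and> t j \<noteq> 0 \<and> v (t j) = 0}"
  define n1 n0 where "n1 = Max ?U" and "n0 = Min ?U"
  have fin: "finite ?U" "?U \<noteq> {}" using n by auto
  have n1: "n1 \<le> m" "t n1 \<noteq> 0" "v (t n1) = 0" using Max_in[OF fin] by (auto simp: n1_def)
  have n0: "n0 \<le> m" "t n0 \<noteq> 0" "v (t n0) = 0" using Min_in[OF fin] by (auto simp: n0_def)
  have out: "vge 1 (t j)" if "j < n0 \<or> n1 < j" "j \<le> m" for j
  proof (rule vgeI)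
    assume "t j \<noteq> 0"
    moreover have "j \<notin> ?U"
    proof
      assume "j \<in> ?U"
      hence "n0 \<le> j" "j \<le> n1"
        unfolding n0_def n1_def by (rule Min_le[OF fin(1)], rule Max_ge[OF fin(1)])
      thus False using that by auto
    qed
    moreover have "0 \<le> v (t j)" using vge_v[OF t] that calculation by blast
    ultimately show "1 \<le> v (t j)" using that(2) by simp
  qed
  have "n0 \<le> n" "n' \<le> n1" using n Min_le[OF fin(1), of n] Max_ge[OF fin(1), of n']
    by (auto simp: n0_def n1_def)
  hence lt: "n0 < n1" using n by simp
  \<comment> \<open>The exponents left after division by \<open>a^(q^n0)\<close>; as
    \<open>d n0 = 0\<close>, the unit \<open>t n0\<close> becomes the constant term.\<close>
  define d where "d j = q ^ j - q ^ n0" for j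
  have dmono: "d j < d n1" if "j < n1" "n0 \<le> j" for j
    unfolding d_def using that q_ge_2
    by (intro diff_less_mono power_strict_increasing power_increasing) auto
  have d0: "d n0 = 0" by (simp add: d_def)
  define P where "P = (\<Sum>j\<in>{n0..n1}. monom (t j / t n1) (d j))"
  have split: "P = monom 1 (d n1) + (\<Sum>j\<in>{n0..<n1}. monom (t j / t n1) (d j))"
    using n1 lt by (simp add: P_def atLeastLessThanSuc_atLeastAtMost[symmetric])
  have ltd: "degree (\<Sum>j\<in>{n0..<n1}. monom (t j / t n1) (d j)) < d n1"
  proof (rule degree_sum_less)
    show "degree (monom (t j / t n1) (d j)) < d n1" if "j \<in> {n0..<n1}" for j
      using le_less_trans[OF degree_monom_le dmono[of j]] that by auto
    show "0 < d n1" using dmono[of n0] lt d0 by simp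
  qed
  have deg: "degree P = d n1" unfolding split
    using ltd by (subst degree_add_eq_left) (auto simp: degree_monom_eq)
  have "lead_coeff P = 1" unfolding deg unfolding split using ltd by (simp add: coeff_eq_0)
  moreover have "degree P \<ge> 1" using deg dmono[of n0] lt d0 by simp
  moreover have "vge 0 (coeff P i)" for i
    unfolding P_def coeff_sum using n1 t by (intro vge_sum) (auto intro!: vge_unit_div)
  ultimately obtain a where a: "vge 0 a" "vge 1 (poly P a)" using residue_root by blast
  have polyP: "t n1 * poly P a = (\<Sum>j\<in>{n0..n1}. t j * a ^ d j)"
    using n1 by (simp add: P_def poly_sum poly_monom sum_distrib_left)
  have vP: "vge 1 (\<Sum>j\<in>{n0..n1}. t j * a ^ d j)"
    unfolding polyP[symmetric] using a t n1 by (intro vge_mult0) auto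
  \<comment> \<open>For \<open>a\<close> in \<open>\<pi> O\<close> every term except the constant
    \<open>t n0\<close> would be divisible by \<open>\<pi>\<close>, although the sum is.\<close>
  have a_unit: "a \<noteq> 0 \<and> v a = 0"
  proof (rule ccontr)
    assume "\<not> ?thesis"
    hence a1: "vge 1 a" using a by (auto simp: vge_def)
    have "(\<Sum>j\<in>{n0..n1}. t j * a ^ d j) = t n0 + (\<Sum>j\<in>{n0<..n1}. t j * a ^ d j)"
      using lt by (simp add: sum.head d0)
    moreover have "vge 1 (\<Sum>j\<in>{n0<..n1}. t j * a ^ d j)"
    proof (rule vge_sum)
      fix j assume j: "j \<in> {n0<..n1}"
      hence "d j > 0" unfolding d_def using q_ge_2 by (simp add: power_strict_increasing)
      then obtain e where "d j = Suc e" by (cases "d j") auto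
      thus "vge 1 (t j * a ^ d j)" using j n1
        by (simp del: mult_1) (intro vge_mult0 vge_mult0' vge_power a1 a t; simp)
    qed
    ultimately have "vge 1 (t n0)"
      using vge_diff[OF vP, of "\<Sum>j\<in>{n0<..n1}. t j * a ^ d j"] by simp
    thus False using n0 vge_v by fastforce
  qed
  have "(\<Sum>j\<le>n1. t j * a ^ (q ^ j)) =
      (\<Sum>j<n0. t j * a ^ (q ^ j)) + a ^ (q ^ n0) * (\<Sum>j\<in>{n0..n1}. t j * a ^ d j)"
  proof -
    have "{..n1} = {..<n0} \<union> {n0..n1}" using lt by auto
    hence "(\<Sum>j\<le>n1. t j * a ^ (q ^ j)) =
      (\<Sum>j<n0. t j * a ^ (q ^ j)) + (\<Sum>j\<in>{n0..n1}. t j * a ^ (q ^ j))"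
      by (simp add: sum.union_disjoint ivl_disj_int)
    also have "(\<Sum>j\<in>{n0..n1}. t j * a ^ (q ^ j)) = (\<Sum>j\<in>{n0..n1}. a ^ (q ^ n0) * (t j * a ^ d j))"
    proof (rule sum.cong)
      fix j assume "j \<in> {n0..n1}"
      hence "q ^ n0 \<le> q ^ j" using q_ge_2 by (intro power_increasing) auto
      thus "t j * a ^ (q ^ j) = a ^ (q ^ n0) * (t j * a ^ d j)"
        by (simp add: d_def power_add[symmetric])
    qed simp
    finally show ?thesis by (simp add: sum_distrib_left)
  qed
  also have "vge 1 \<dots>"
  proof (intro vge_add vge_sum)
    show "vge 1 (t j * a ^ q ^ j)" if "j \<in> {..<n0}" for j
      using that out[of j] lt n1 a by (intro vge_mult0' vge_power) auto
    show "vge 1 (a ^ q ^ n0 * (\<Sum>j = n0..n1. t j * a ^ d j))"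
      using a vP by (intro vge_mult0 vge_power)
  qed
  finally have v1: "vge 1 (\<Sum>j\<le>n1. t j * a ^ (q ^ j))" .
  have "vge 1 (ell t m a - (\<Sum>j\<le>n1. t j * a ^ (q ^ j)))"
    by (rule vge_ell_diff) (use t n1 out a in auto)
  from vge_add[OF this v1] have "vge 1 (ell t m a)" by simp
  \<comment> \<open>So far \<open>a\<close> is a zero only modulo \<open>\<pi>\<close>;
    \<open>b\<close> is chosen so that \<open>\<pi> b\<close> cancels the remaining value, and
    \<open>\<pi> b\<close> is too small to change the valuation of \<open>a\<close>.\<close>
  hence "vge 0 (- (ell t m a / \<pi>))" by (simp add: vge_pi_div)
  then obtain b where b: "vge 0 b" "ell t m b = - (ell t m a / \<pi>)"
    using ell_solve_integral[of m t n1 "- (ell t m a / \<pi>)", OF t n1] by blast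
  have "ell t m (a + \<pi> powi 1 * b) = 0" unfolding ell_add ell_pi b by simp
  moreover have "vge (v a + 1) (\<pi> powi 1 * b)" using b a_unit by (simp only: vge_pi_scale) simp
  hence "a + \<pi> powi 1 * b \<noteq> 0 \<and> v (a + \<pi> powi 1 * b) = 0" using v_add_less a_unit by metis
  ultimately show ?thesis by blast
qed

end

section \<open>Lang's theorem\<close>

lemma linear_dependence:
  fixes M :: "'i \<Rightarrow> 'j \<Rightarrow> 'a::field"
  assumes "finite I" "finite J" "card I < card J"
  shows "\<exists>c. (\<exists>j\<in>J. c j \<noteq> 0) \<and> (\<forall>i\<in>I. (\<Sum>j\<in>J. c j * M i j) = 0)"
  using assms
proof (induction I arbitrary: J M rule: finite_induct)
  case empty
  then obtain j where "j \<in> J" by fastforce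
  thus ?case by (intro exI[of _ "\<lambda>_. 1"]) auto
next
  case (insert i I)
  show ?case
  proof (cases "\<forall>j\<in>J. M i j = 0")
    case True
    obtain c where "\<exists>j\<in>J. c j \<noteq> 0" "\<forall>i\<in>I. (\<Sum>j\<in>J. c j * M i j) = 0"
      using insert.IH[of J M] insert.hyps insert.prems by auto
    thus ?thesis using True by (intro exI[of _ c]) auto
  next
    case False
    then obtain j0 where j0: "j0 \<in> J" "M i j0 \<noteq> 0" by blast
    let ?J = "J - {j0}"
    obtain c where c: "\<exists>j\<in>?J. c j \<noteq> 0"
      "\<And>k. k \<in> I \<Longrightarrow> (\<Sum>j\<in>?J. c j * (M k j - M k j0 * M i j / M i j0)) = 0"
    proof -
      have "card I < card ?J" using insert.hyps insert.prems j0 by simp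
      hence "\<exists>c. (\<exists>j\<in>?J. c j \<noteq> 0) \<and>
          (\<forall>k\<in>I. (\<Sum>j\<in>?J. c j * (M k j - M k j0 * M i j / M i j0)) = 0)"
        using insert.IH[of ?J "\<lambda>k j. M k j - M k j0 * M i j / M i j0"] insert.prems by simp
      thus ?thesis by (elim exE conjE) (rule that, assumption, erule bspec, assumption)
    qed
    \<comment> \<open>Coefficient of the pivot column, read off from equation \<open>i\<close>; the
      induction hypothesis was applied to the other columns after clearing their entries in row
      \<open>i\<close>.\<close>
    define a where "a = - (\<Sum>j\<in>?J. c j * M i j) / M i j0"
    have sum: "(\<Sum>j\<in>J. (c(j0 := a)) j * M k j) = a * M k j0 + (\<Sum>j\<in>?J. c j * M k j)" for k
      using j0 insert.prems by (simp add: sum.remove)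
    have "(\<Sum>j\<in>J. (c(j0 := a)) j * M k j) = 0" if "k \<in> insert i I" for k
    proof (cases "k = i")
      case True
      thus ?thesis using j0 unfolding sum by (simp add: a_def)
    next
      case False
      hence "k \<in> I" using that by simp
      have "a * M k j0 = - (\<Sum>j\<in>?J. c j * (M k j0 * M i j / M i j0))"
        by (simp add: a_def sum_distrib_left sum_distrib_right sum_divide_distrib field_simps sum_negf)
      thus ?thesis using c(2)[OF \<open>k \<in> I\<close>] unfolding sum
        by (simp add: right_diff_distrib sum_subtractf)
    qed
    moreover have "\<exists>j\<in>J. (c(j0 := a)) j \<noteq> 0" using c(1) by auto
    ultimately show ?thesis by (intro exI[of _ "c(j0 := a)"] conjI ballI)
  qed
qed

text \<open>The right-hand side is adjoined as a further unknown, indexed by \<open>None\<close>,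
  which gives more unknowns than equations. A nontrivial solution has nonzero \<open>None\<close>
  coefficient because the kernel is trivial.\<close>

lemma square_system_solvable:
  fixes M :: "'i \<Rightarrow> 'j \<Rightarrow> 'a::field"
  assumes "finite I" "finite J" "card I = card J"
    and ker: "\<And>c. (\<And>i. i \<in> I \<Longrightarrow> (\<Sum>j\<in>J. c j * M i j) = 0) \<Longrightarrow> (\<forall>j\<in>J. c j = 0)"
  shows "\<exists>c. \<forall>i\<in>I. (\<Sum>j\<in>J. c j * M i j) = y i"
proof -
  let ?J = "insert None (Some ` J)"
  let ?M = "\<lambda>i j. case j of None \<Rightarrow> y i | Some j \<Rightarrow> M i j"
  have "card I < card ?J" using assms by (simp add: card_insert_if card_image)
  then obtain c where c: "\<exists>j\<in>?J. c j \<noteq> 0" "\<forall>i\<in>I. (\<Sum>j\<in>?J. c j * ?M i j) = 0"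
    using linear_dependence[of I ?J ?M] assms by auto
  have eq: "c None * y i + (\<Sum>j\<in>J. c (Some j) * M i j) = 0" if "i \<in> I" for i
    using c(2) that assms by (simp add: sum.reindex)
  have nz: "c None \<noteq> 0"
  proof
    assume "c None = 0"
    hence "\<forall>j\<in>J. c (Some j) = 0" using eq ker[of "\<lambda>j. c (Some j)"] by auto
    thus False using c(1) \<open>c None = 0\<close> by auto
  qed
  define S where "S i = (\<Sum>j\<in>J. c (Some j) * M i j)" for i
  have "(\<Sum>j\<in>J. (- c (Some j) / c None) * M i j) = y i" if "i \<in> I" for i
  proof -
    have "(\<Sum>j\<in>J. (- c (Some j) / c None) * M i j) = - S i / c None"
      unfolding S_def sum_negf[symmetric] sum_divide_distrib by (rule sum.cong) simp_all
    moreover have "S i = - (c None * y i)"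
      using eq[OF that] unfolding S_def[symmetric] by (simp only: add_eq_0_iff)
    ultimately show ?thesis using nz by simp
  qed
  thus ?thesis by (intro exI[of _ "\<lambda>j. - c (Some j) / c None"] ballI)
qed

text \<open>Translates between a polynomial in \<open>\<sigma>^s\<close> and its expansion in powers
  of \<open>\<sigma>\<close> with zeros in between; with \<open>f\<close> constant it counts
  multiples.\<close>

lemma sum_multiples:
  fixes f :: "nat \<Rightarrow> 'a::comm_monoid_add"
  assumes "s \<ge> 1"
  shows "(\<Sum>l\<le>s * m. if s dvd l then f (l div s) else 0) = (\<Sum>k\<le>m. f k)"
proof -
  have "(\<Sum>l\<le>s * m. if s dvd l then f (l div s) else 0) = (\<Sum>l\<in>{l \<in> {..s * m}. s dvd l}. f (l div s))"
    by (rule sum.inter_filter[symmetric]) simp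
  also have "\<dots> = (\<Sum>k\<le>m. f k)"
    using assms by (intro sum.reindex_bij_witness[of _ "\<lambda>k. s * k" "\<lambda>l. l div s"]) auto
  finally show ?thesis .
qed

section \<open>Fixed vectors of the operators \<open>U \<sigma>^s\<close>\<close>

context unram
begin

definition lop :: "nat set \<Rightarrow> (nat \<Rightarrow> nat \<Rightarrow> 'a) \<Rightarrow> nat \<Rightarrow> (nat \<Rightarrow> 'a) \<Rightarrow> nat \<Rightarrow> 'a" where
  "lop I U s x i = (if i \<in> I then \<Sum>j\<in>I. U i j * (\<sigma> ^^ s) (x j) else 0)"

lemma lop_sum: "lop I U s (\<lambda>i. \<Sum>k\<in>K. c k * f k i) i = (\<Sum>k\<in>K. (\<sigma> ^^ s) (c k) * lop I U s (f k) i)"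
  unfolding lop_def
  by (auto simp: sn_sum sn_mult sum_distrib_left sum.swap[of _ K] algebra_simps)

lemma lop_add: "lop I U s (\<lambda>i. x i + y i) i = lop I U s x i + lop I U s y i"
  by (simp add: lop_def sn_add algebra_simps sum.distrib)

lemma lop_diff: "lop I U s (\<lambda>i. x i - y i) i = lop I U s x i - lop I U s y i"
  by (simp add: lop_def sn_diff algebra_simps sum_subtractf)

lemma lop_scale: "lop I U s (\<lambda>i. c * x i) i = (\<sigma> ^^ s) c * lop I U s x i"
  by (auto simp: lop_def sn_mult sum_distrib_left algebra_simps)

lemma vge_lop: "(\<And>i j. i \<in> I \<Longrightarrow> j \<in> I \<Longrightarrow> vge 0 (U i j)) \<Longrightarrow> (\<And>i. i \<in> I \<Longrightarrow> vge k (x i)) \<Longrightarrow> vge k (lop I U s x i)"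
  by (auto simp: lop_def intro!: vge_sum vge_mult0)

text \<open>With \<open>P = \<Sum> c\<^sub>j T\<^sup>j\<close> a minimal relation for a primitive vector \<open>y 0\<close>, one solves \<open>(T - 1) B = b P\<close> for a
  twisted polynomial \<open>B\<close>; then \<open>B (y 0)\<close> is fixed by \<open>T\<close>.\<close>

lemma lang_fixed:
  assumes I: "finite I" "I \<noteq> {}" and s: "s \<ge> 1"
    and U: "\<And>i j. i \<in> I \<Longrightarrow> j \<in> I \<Longrightarrow> vge 0 (U i j)"
    and prim: "\<And>x. (\<And>i. i \<in> I \<Longrightarrow> vge 0 (x i)) \<Longrightarrow> (\<And>i. i \<in> I \<Longrightarrow> vge 1 (lop I U s x i)) \<Longrightarrow>
       (\<forall>i\<in>I. vge 1 (x i))"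
  shows "\<exists>z. (\<forall>i. lop I U s z i = z i) \<and> (\<exists>i\<in>I. z i \<noteq> 0)"
proof -
  obtain i0 where i0: "i0 \<in> I" using I by blast
  let ?T = "lop I U s"
  \<comment> \<open>The orbit of a standard basis vector. Hypothesis \<open>prim\<close> says that
    the operator is injective modulo \<open>\<pi>\<close>, so no \<open>y j\<close> becomes
    divisible by \<open>\<pi>\<close>.\<close>
  define y where "y j = (?T ^^ j) (\<lambda>i. if i = i0 then 1 else 0)" for j
  have yS: "y (Suc j) = ?T (y j)" for j by (simp add: y_def)
  have y0: "y 0 i = (if i = i0 then 1 else 0)" for i by (simp add: y_def)
  have yout: "y j i = 0" if "i \<notin> I" for i j
    using that i0 by (cases j) (auto simp: y0 yS lop_def)
  have yint: "vge 0 (y j i)" for j i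
    by (induction j arbitrary: i) (auto simp: y0 yS intro!: vge_lop U)
  have yprim: "\<not> (\<forall>i\<in>I. vge 1 (y j i))" for j
  proof (induction j)
    case 0
    have "\<not> vge 1 (y 0 i0)" by (simp add: y0 vge_def)
    thus ?case using i0 by blast
  next
    case (Suc j)
    thus ?case using prim[of "y j"] yint by (auto simp: yS)
  qed
  define R where "R m c \<longleftrightarrow> (\<exists>j\<le>m. c j \<noteq> 0) \<and> (\<forall>i\<in>I. (\<Sum>j\<le>m. c j * y j i) = 0)"
    for m and c :: "nat \<Rightarrow> 'a"
  have ex: "\<exists>m c. R m c"
    using linear_dependence[of I "{..card I}" "\<lambda>i j. y j i"] I unfolding R_def by (metis atMost_iff card_atMost finite_atMost lessI)
  \<comment> \<open>Minimality enters at the very end: if the fixed vector were zero,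
    \<open>B\<close> would be a relation of smaller degree.\<close>
  define m where "m = (LEAST m. \<exists>c. R m c)"
  obtain c0 where c0: "R m c0" using LeastI_ex[OF ex] unfolding m_def by blast
  have least: "\<not> R m' c" if "m' < m" for m' c
    using not_less_Least[of m' "\<lambda>m. \<exists>c. R m c"] that unfolding m_def by blast
  obtain j0 where "j0 \<le> m" "c0 j0 \<noteq> 0" using c0 unfolding R_def by blast
  then obtain k n where k: "\<And>j. j \<le> m \<Longrightarrow> vge 0 (\<pi> powi k * c0 j)"
    and n: "n \<le> m" "c0 n \<noteq> 0" "v (\<pi> powi k * c0 n) = 0"
    using integral_scaling[of "{..m}" j0 c0] by auto
  define c where "c j = \<pi> powi k * c0 j" for j
  have cint: "vge 0 (c j)" if "j \<le> m" for j using k that by (simp add: c_def)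
  have cn: "c n \<noteq> 0" "v (c n) = 0" using n by (auto simp: c_def)
  have rel: "(\<Sum>j\<le>m. c j * y j i) = 0" for i
  proof (cases "i \<in> I")
    case True
    have "(\<Sum>j\<le>m. c j * y j i) = \<pi> powi k * (\<Sum>j\<le>m. c0 j * y j i)"
      by (simp add: c_def sum_distrib_left mult.assoc)
    thus ?thesis using c0 True by (simp add: R_def)
  qed (simp add: yout)
  \<comment> \<open>With \<open>c n\<close> as the only unit coefficient the relation would make
    \<open>y n\<close> divisible by \<open>\<pi>\<close>. The second unit is what
    \<open>ell_kernel\<close> requires.\<close>
  have "\<exists>n'. n' \<le> m \<and> n' \<noteq> n \<and> c n' \<noteq> 0 \<and> v (c n') = 0"
  proof (rule ccontr)
    assume neg: "\<not> ?thesis"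
    have c1: "vge 1 (c j)" if "j \<le> m" "j \<noteq> n" for j
    proof (rule vgeI)
      assume nz: "c j \<noteq> 0"
      hence "v (c j) \<noteq> 0" using neg that by blast
      thus "1 \<le> v (c j)" using vge_v[OF cint nz] that by simp
    qed
    have "vge 1 (y n i)" if "i \<in> I" for i
    proof -
      have "c n * y n i = - (\<Sum>j\<in>{..m} - {n}. c j * y j i)"
        using rel[of i] n by (simp add: sum.remove[of _ n] eq_neg_iff_add_eq_0)
      moreover have "vge 1 (\<Sum>j\<in>{..m} - {n}. c j * y j i)"
        using c1 yint by (intro vge_sum vge_mult0') auto
      ultimately have "vge 1 (c n * y n i)" by simp
      hence "vge 1 (c n * y n i / c n)" using cn by (intro vge_unit_div)
      thus ?thesis using cn by simp
    qed
    thus False using yprim by blast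
  qed
  then obtain n' where n': "n' \<le> m" "n' \<noteq> n" "c n' \<noteq> 0" "v (c n') = 0" by blast
  \<comment> \<open>The operator sending \<open>b\<close> to \<open>- B m\<close>. Taking
    \<open>b\<close> in its kernel makes the recursion for \<open>B\<close> stop below degree
    \<open>m\<close>.\<close>
  define t where "t l = (if s dvd l then (\<sigma> ^^ l) (c (m - l div s)) else 0)" for l
  have tint: "vge 0 (t l)" if "l \<le> s * m" for l
    using cint[of "m - l div s"] by (simp add: t_def)
  have tu: "s * (m - j) \<le> s * m" "t (s * (m - j)) \<noteq> 0" "v (t (s * (m - j))) = 0"
    if "j \<le> m" "c j \<noteq> 0" "v (c j) = 0" for j
    using that s by (auto simp: t_def)
  have "s * (m - n) \<noteq> s * (m - n')" using n n' s by auto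
  then obtain b where b: "b \<noteq> 0" "ell t (s * m) b = 0"
    using ell_kernel[of "s * m" t "s * (m - n)" "s * (m - n')", OF tint]
      ell_kernel[of "s * m" t "s * (m - n')" "s * (m - n)", OF tint]
      tu[OF n(1) cn] tu[OF n'(1,3,4)] by (metis linorder_neqE_nat)
  \<comment> \<open>Comparison of coefficients in \<open>(T - 1) B = b P\<close>, solved upwards
    from degree 0.\<close>
  define B where "B = rec_nat (- (b * c 0)) (\<lambda>i x. (\<sigma> ^^ s) x - b * c (Suc i))"
  have B0: "B 0 = - (b * c 0)" and BS: "\<And>i. B (Suc i) = (\<sigma> ^^ s) (B i) - b * c (Suc i)"
    by (auto simp: B_def)
  have Bcl: "B i = - (\<Sum>j\<le>i. (\<sigma> ^^ (s * (i - j))) (b * c j))" for i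
  proof (induction i)
    case (Suc i)
    have "(\<sigma> ^^ s) (B i) = - (\<Sum>j\<le>i. (\<sigma> ^^ (s * (Suc i - j))) (b * c j))"
      unfolding Suc sn_uminus sn_sum
      by (intro arg_cong[of _ _ uminus] sum.cong)
        (auto simp: Suc_diff_le funpow_add)
    thus ?case by (simp add: BS)
  qed (simp add: B0)
  have Bm: "B m = 0"
  proof -
    have "ell t (s * m) b = (\<Sum>l\<le>s * m. if s dvd l then (\<sigma> ^^ (s * (l div s))) (b * c (m - l div s)) else 0)"
      unfolding ell_def t_def by (intro sum.cong) (auto simp: sn_mult mult.commute)
    also have "\<dots> = (\<Sum>k\<le>m. (\<sigma> ^^ (s * k)) (b * c (m - k)))" by (rule sum_multiples[OF s])
    also have "\<dots> = (\<Sum>j\<le>m. (\<sigma> ^^ (s * (m - j))) (b * c j))"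
      by (rule sum.reindex_bij_witness[of _ "\<lambda>j. m - j" "\<lambda>j. m - j"]) auto
    finally show ?thesis using b Bcl[of m] by simp
  qed
  define z where "z i = (\<Sum>j<m. B j * y j i)" for i
  have "?T z i = z i" for i
  proof -
    have "?T z i = (\<Sum>j<m. (\<sigma> ^^ s) (B j) * y (Suc j) i)"
      unfolding z_def[abs_def] by (simp add: lop_sum yS)
    also have "\<dots> = (\<Sum>j<m. (B (Suc j) + b * c (Suc j)) * y (Suc j) i)" by (simp add: BS)
    also have "\<dots> = (\<Sum>j\<le>m. (B j + b * c j) * y j i) - (B 0 + b * c 0) * y 0 i"
      unfolding lessThan_Suc_atMost[symmetric] sum.lessThan_Suc_shift by simp
    also have "\<dots> = (\<Sum>j\<le>m. B j * y j i) + b * (\<Sum>j\<le>m. c j * y j i)"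
      by (simp add: B0 algebra_simps sum.distrib sum_distrib_left)
    also have "\<dots> = z i" unfolding rel z_def using Bm by (simp add: lessThan_Suc_atMost[symmetric])
    finally show ?thesis .
  qed
  moreover have "\<exists>i\<in>I. z i \<noteq> 0"
  proof (rule ccontr)
    assume neg: "\<not> ?thesis"
    have "B j = 0" if "j \<le> m" for j
    proof (cases "j = m")
      case False
      hence j: "j \<le> m - 1" "m - 1 < m" using that by auto
      have "(\<Sum>j\<le>m - 1. B j * y j i) = 0" if "i \<in> I" for i
      proof -
        have "{..m - 1} = {..<m}" using j by auto
        thus ?thesis using neg that by (auto simp: z_def)
      qed
      thus ?thesis using least[OF j(2), of B] j unfolding R_def by blast
    qed (simp add: Bm)
    hence Bz: "\<And>j. j \<le> m \<Longrightarrow> B j = 0" by blast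
    have "b * c j = 0" if "j \<le> m" for j
    proof (cases j)
      case 0
      thus ?thesis using Bz[of 0] B0 by simp
    next
      case (Suc i)
      thus ?thesis using Bz[of j] Bz[of i] BS[of i] that by simp
    qed
    thus False using b cn n by auto
  qed
  ultimately show ?thesis by blast
qed

text \<open>Induction on the dimension: a primitive fixed vector \<open>z\<close> is split off, the
  operator induced on the quotient by \<open>z\<close> inherits the hypotheses, and a fixed vector
  of the quotient lifts to a fixed vector after adding \<open>y z\<close>, where
  \<open>y - \<sigma>^s y\<close> is prescribed.\<close>

lemma lang:
  assumes "finite I" and s: "s \<ge> 1"
    and U: "\<And>i j. i \<in> I \<Longrightarrow> j \<in> I \<Longrightarrow> vge 0 (U i j)"
    and prim: "\<And>x. (\<And>i. i \<in> I \<Longrightarrow> vge 0 (x i)) \<Longrightarrow> (\<And>i. i \<in> I \<Longrightarrow> vge 1 (lop I U s x i)) \<Longrightarrow>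
       (\<forall>i\<in>I. vge 1 (x i))"
  shows "\<exists>w. (\<forall>k\<in>I. \<forall>i\<in>I. lop I U s (w k) i = w k i) \<and>
    (\<forall>a. (\<forall>i\<in>I. (\<Sum>k\<in>I. a k * w k i) = 0) \<longrightarrow> (\<forall>k\<in>I. a k = 0))"
  using assms(1) U prim
proof (induction "card I" arbitrary: I U)
  case 0
  thus ?case by auto
next
  case (Suc N)
  note U = Suc.prems(2) and prim = Suc.prems(3)
  have fin: "finite I" "I \<noteq> {}" using Suc by auto
  obtain z0 i1 where z0: "\<And>i. lop I U s z0 i = z0 i" "i1 \<in> I" "z0 i1 \<noteq> 0"
    using lang_fixed[of I s U, OF fin s U prim] by blast
  obtain k i0 where k: "\<And>i. i \<in> I \<Longrightarrow> vge 0 (\<pi> powi k * z0 i)"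
    and i0: "i0 \<in> I" "z0 i0 \<noteq> 0" "v (\<pi> powi k * z0 i0) = 0"
    using integral_scaling[of I i1 z0] fin z0 by blast
  define z where "z i = \<pi> powi k * z0 i" for i
  have zint: "vge 0 (z i)" if "i \<in> I" for i using k that by (simp add: z_def)
  have z1: "z i0 \<noteq> 0" "v (z i0) = 0" using i0 by (auto simp: z_def)
  have Tz: "lop I U s z i = z i" for i unfolding z_def[abs_def] lop_scale by (simp add: z0)
  let ?I = "I - {i0}"
  have finI: "finite ?I" using fin by simp
  \<comment> \<open>The quotient by \<open>z\<close> has coordinates \<open>I - {i0}\<close>,
    obtained by subtracting the multiple of \<open>z\<close> that kills coordinate
    \<open>i0\<close>. Entries stay integral because \<open>z i0\<close> is a unit.\<close>
  define U' where "U' i j = U i j - z i / z i0 * U i0 j" for i j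
  let ?e = "\<lambda>x i. if i \<in> ?I then x i else 0"
  have T': "lop ?I U' s x i = lop I U s (?e x) i - lop I U s (?e x) i0 / z i0 * z i"
    if "i \<in> ?I" for x :: "nat \<Rightarrow> 'a" and i
  proof -
    have e: "lop I U s (?e x) l = (\<Sum>j\<in>?I. U l j * (\<sigma> ^^ s) (x j))" if "l \<in> I" for l
      using that fin i0 by (simp add: lop_def sum.remove[of I i0])
    have "i \<in> I" using that by simp
    thus ?thesis unfolding e[OF \<open>i \<in> I\<close>] e[OF i0(1)] using that
      by (simp add: lop_def[of ?I] U'_def sum_distrib_left sum_distrib_right sum_subtractf[symmetric]
        sum_divide_distrib algebra_simps)
  qed
  have cardI: "N = card ?I" using Suc.hyps(2) fin i0 by simp
  have U'int: "vge 0 (U' i j)" if "i \<in> ?I" "j \<in> ?I" for i j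
    unfolding U'_def using that i0 z1 zint
    by (intro vge_diff vge_mult0 vge_unit_div U) auto
  have prim': "\<forall>i\<in>?I. vge 1 (x i)"
    if x: "\<And>i. i \<in> ?I \<Longrightarrow> vge 0 (x i)" "\<And>i. i \<in> ?I \<Longrightarrow> vge 1 (lop ?I U' s x i)" for x
  proof -
    \<comment> \<open>The lift of \<open>x\<close> is adjusted so that its image vanishes at
      \<open>i0\<close>: as \<open>z\<close> is fixed, subtracting \<open>c' z\<close> from the
      vector subtracts \<open>c z\<close> from the image.\<close>
    define c where "c = lop I U s (?e x) i0 / z i0"
    obtain c' where c': "(\<sigma> ^^ s) c' = c" using sn_surj by blast
    have "vge 0 (lop I U s (?e x) i0)" by (rule vge_lop) (use U x in auto)
    hence "vge 0 c" unfolding c_def using z1 by (intro vge_unit_div)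
    hence cint: "vge 0 c'" using c' by (metis vge_sn)
    have "\<forall>i\<in>I. vge 1 (?e x i - c' * z i)"
    proof (rule prim)
      show "vge 0 (?e x i - c' * z i)" if "i \<in> I" for i
        using that x cint zint by (intro vge_diff vge_mult0) auto
      have eq: "lop I U s (\<lambda>i. ?e x i - c' * z i) i = lop I U s (?e x) i - c * z i" for i
        unfolding lop_diff lop_scale Tz c' ..
      show "vge 1 (lop I U s (\<lambda>i. ?e x i - c' * z i) i)" if "i \<in> I" for i
      proof (cases "i = i0")
        case True
        thus ?thesis unfolding eq using z1 by (simp add: c_def)
      next
        case False
        hence "i \<in> ?I" using that by simp
        thus ?thesis using x(2)[of i] T'[of i x] unfolding eq by (simp add: c_def)
      qed
    qed
    note * = this
    have "vge 1 (c' * z i0)" using *[rule_format, OF i0(1)] by simp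
    hence "vge 1 (c' * z i0 / z i0)" using z1 by (intro vge_unit_div)
    hence c1: "vge 1 c'" using z1 by simp
    show ?thesis
    proof
      fix i assume i: "i \<in> ?I"
      hence "vge 1 (x i - c' * z i)" using * by auto
      moreover have "vge 1 (c' * z i)" using c1 zint i by (intro vge_mult0') auto
      ultimately have "vge 1 ((x i - c' * z i) + c' * z i)" by (rule vge_add)
      thus "vge 1 (x i)" by simp
    qed
  qed
  have "\<exists>w. (\<forall>k\<in>?I. \<forall>i\<in>?I. lop ?I U' s (w k) i = w k i) \<and>
      (\<forall>a. (\<forall>i\<in>?I. (\<Sum>k\<in>?I. a k * w k i) = 0) \<longrightarrow> (\<forall>k\<in>?I. a k = 0))"
    by (rule Suc.hyps(1)[of ?I U', OF cardI finI U'int prim'])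
  then obtain w' where w1: "\<forall>k\<in>?I. \<forall>i\<in>?I. lop ?I U' s (w' k) i = w' k i"
    and w2: "\<forall>a. (\<forall>i\<in>?I. (\<Sum>k\<in>?I. a k * w' k i) = 0) \<longrightarrow> (\<forall>k\<in>?I. a k = 0)"
    by (elim exE conjE) (rule that)
  have w': "lop ?I U' s (w' k) i = w' k i" if "k \<in> ?I" "i \<in> ?I" for k i
    using w1 that by blast
  have ind: "\<forall>k\<in>?I. a k = 0" if "\<And>i. i \<in> ?I \<Longrightarrow> (\<Sum>k\<in>?I. a k * w' k i) = 0" for a
    by (rule mp[OF spec[OF w2, of a]]) (intro ballI that)
  define c where "c k = lop I U s (?e (w' k)) i0 / z i0" for k
  have "\<exists>y. y - (\<sigma> ^^ s) y = c k" for k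
  proof -
    obtain y where y: "ell (\<lambda>j. if j = 0 then 1 else if j = s then -1 else 0) s y = c k"
      using ell_surj[of 0 s "\<lambda>j. if j = 0 then 1 else if j = s then -1 else 0"] by auto
    have "{..s} = insert 0 (insert s ({..s} - {0, s}))" by auto
    hence "ell (\<lambda>j. if j = 0 then 1 else if j = s then -1 else 0) s y =
      (\<Sum>j\<in>insert 0 (insert s ({..s} - {0, s})). (if j = 0 then 1 else if j = s then -1 else 0) * (\<sigma> ^^ j) y)"
      unfolding ell_def by (rule sum.cong) simp
    also have "\<dots> = y - (\<sigma> ^^ s) y" using s by simp
    finally show ?thesis using y by metis
  qed
  then obtain y where y: "\<And>k. y k - (\<sigma> ^^ s) (y k) = c k" by metis
  define w where "w k = (if k = i0 then z else (\<lambda>i. ?e (w' k) i + y k * z i))" for k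
  have "lop I U s (w k) i = w k i" if "k \<in> I" "i \<in> I" for k i
  proof (cases "k = i0")
    case True
    thus ?thesis by (simp add: w_def Tz)
  next
    case False
    hence k: "k \<in> ?I" using that by simp
    have T: "lop I U s (?e (w' k)) i = ?e (w' k) i + c k * z i"
    proof (cases "i = i0")
      case True
      thus ?thesis using z1 by (simp add: c_def)
    next
      case False
      hence i: "i \<in> ?I" using that by simp
      show ?thesis using w'[OF k i] T'[OF i, of "w' k"] i by (simp add: c_def algebra_simps)
    qed
    have "lop I U s (w k) i = lop I U s (?e (w' k)) i + (\<sigma> ^^ s) (y k) * z i"
      using False by (simp only: w_def if_False lop_add lop_scale Tz)
    also have "\<dots> = ?e (w' k) i + (c k + (\<sigma> ^^ s) (y k)) * z i"
      unfolding T by (simp add: algebra_simps)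
    also have "c k + (\<sigma> ^^ s) (y k) = y k" using y[of k] by (simp add: algebra_simps)
    finally show ?thesis using False by (simp add: w_def)
  qed
  moreover have "\<forall>k\<in>I. a k = 0" if a: "\<And>i. i \<in> I \<Longrightarrow> (\<Sum>k\<in>I. a k * w k i) = 0" for a
  proof -
    define A where "A = a i0 + (\<Sum>k\<in>?I. a k * y k)"
    have sum: "(\<Sum>k\<in>I. a k * w k i) = (\<Sum>k\<in>?I. a k * ?e (w' k) i) + A * z i" for i
    proof -
      have "(\<Sum>k\<in>I. a k * w k i) = a i0 * z i + (\<Sum>k\<in>?I. a k * (?e (w' k) i + y k * z i))"
        unfolding sum.remove[OF fin(1) i0(1)] by (simp add: w_def)
      thus ?thesis by (simp add: A_def distrib_left distrib_right sum.distrib sum_distrib_right mult.assoc)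
    qed
    have "A * z i0 = 0" using a[OF i0(1)] unfolding sum by simp
    hence A: "A = 0" using z1 by simp
    have "\<forall>k\<in>?I. a k = 0"
    proof (rule ind)
      fix i assume "i \<in> ?I"
      thus "(\<Sum>k\<in>?I. a k * w' k i) = 0" using a[of i] A unfolding sum by simp
    qed
    moreover from this have "a i0 = 0" using A by (simp add: A_def)
    ultimately show ?thesis by blast
  qed
  ultimately show ?case by (intro exI[of _ w]) auto
qed

end

section \<open>Semilinear endomorphisms and twisted polynomials\<close>

locale semilinear = unram v \<sigma> \<pi> p q + vector_space scale
  for v :: "'a::field_char_0 \<Rightarrow> int" and \<sigma> \<pi> p q
    and scale :: "'a \<Rightarrow> 'b::ab_group_add \<Rightarrow> 'b" (infixr "*s" 75) +
  fixes \<Phi> :: "'b \<Rightarrow> 'b"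
  assumes Phi_add: "\<Phi> (x + y) = \<Phi> x + \<Phi> y"
    and Phi_scale: "\<Phi> (c *s x) = \<sigma> c *s \<Phi> x"
begin

lemma Phin_add: "(\<Phi> ^^ j) (x + y) = (\<Phi> ^^ j) x + (\<Phi> ^^ j) y"
  by (induction j) (auto simp: Phi_add)

lemma Phin_scale: "(\<Phi> ^^ j) (c *s x) = (\<sigma> ^^ j) c *s (\<Phi> ^^ j) x"
  by (induction j) (auto simp: Phi_scale)

lemma Phin_0 [simp]: "(\<Phi> ^^ j) 0 = 0"
  using Phin_scale[of j 0 0] by simp

lemma Phin_sum: "(\<Phi> ^^ j) (sum f A) = (\<Sum>i\<in>A. (\<Phi> ^^ j) (f i))"
  by (induction A rule: infinite_finite_induct) (auto simp: Phin_add)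

lemmas Phi_0 [simp] = Phin_0[of 1, simplified]
lemmas Phi_sum = Phin_sum[of 1, simplified]

lemma Phin_minus: "(\<Phi> ^^ j) (- x) = - (\<Phi> ^^ j) x"
  using Phin_scale[of j "-1" x] by (simp add: sn_uminus)

lemma Phin_diff: "(\<Phi> ^^ j) (x - y) = (\<Phi> ^^ j) x - (\<Phi> ^^ j) y"
  using Phin_add[of j x "- y"] by (simp add: Phin_minus)

lemmas Phi_diff = Phin_diff[of 1, simplified]

lemma eigen_power:
  assumes "(\<Phi> ^^ s) x = \<pi> powi r *s x"
  shows "(\<Phi> ^^ (s * l)) x = \<pi> powi (r * int l) *s x"
proof (induction l)
  case (Suc l)
  have "(\<Phi> ^^ (s * Suc l)) x = (\<Phi> ^^ s) ((\<Phi> ^^ (s * l)) x)" by (simp add: funpow_add)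
  also have "\<dots> = \<pi> powi (r * int l) *s (\<pi> powi r *s x)" unfolding Suc Phin_scale assms by simp
  also have "\<dots> = \<pi> powi (r * int (Suc l)) *s x"
    by (simp add: pi_powi_mult distrib_left add.commute)
  finally show ?case .
qed simp

lemma eigen_Phin:
  assumes "(\<Phi> ^^ s) x = \<pi> powi r *s x"
  shows "(\<Phi> ^^ s) ((\<Phi> ^^ t) x) = \<pi> powi r *s (\<Phi> ^^ t) x"
proof -
  have "(\<Phi> ^^ s) ((\<Phi> ^^ t) x) = (\<Phi> ^^ t) ((\<Phi> ^^ s) x)"
    by (metis add.commute comp_apply funpow_add)
  thus ?thesis by (simp add: assms Phin_scale)
qed

section \<open>Spans, integral spans and independence of finite families\<close>

definition lin :: "(nat \<Rightarrow> 'b) \<Rightarrow> nat \<Rightarrow> 'b set" where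
  "lin E n = range (\<lambda>c. \<Sum>i<n. c i *s E i)"

definition olin :: "(nat \<Rightarrow> 'b) \<Rightarrow> nat \<Rightarrow> 'b set" where
  "olin E n = {\<Sum>i<n. c i *s E i | c. \<forall>i<n. vge 0 (c i)}"

definition indep :: "(nat \<Rightarrow> 'b) \<Rightarrow> nat \<Rightarrow> bool" where
  "indep E n \<longleftrightarrow> (\<forall>c. (\<Sum>i<n. c i *s E i) = 0 \<longrightarrow> (\<forall>i<n. c i = 0))"

lemma linI: "x = (\<Sum>i<n. c i *s E i) \<Longrightarrow> x \<in> lin E n"
  by (auto simp: lin_def)

lemma linE: "x \<in> lin E n \<Longrightarrow> (\<And>c. x = (\<Sum>i<n. c i *s E i) \<Longrightarrow> thesis) \<Longrightarrow> thesis"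
  by (auto simp: lin_def)

lemma subspace_lin: "subspace (lin E n)"
proof (rule subspaceI)
  show "0 \<in> lin E n" by (rule linI[where c = "\<lambda>_. 0"]) simp
  show "x + y \<in> lin E n" if xy: "x \<in> lin E n" "y \<in> lin E n" for x y
  proof -
    obtain c d where "x = (\<Sum>i<n. c i *s E i)" "y = (\<Sum>i<n. d i *s E i)"
      using xy by (auto simp: lin_def)
    thus ?thesis by (intro linI[where c = "\<lambda>i. c i + d i"]) (simp add: scale_left_distrib sum.distrib)
  qed
  show "a *s x \<in> lin E n" if x: "x \<in> lin E n" for a x
  proof -
    obtain c where "x = (\<Sum>i<n. c i *s E i)" using x by (auto simp: lin_def)
    thus ?thesis by (intro linI[where c = "\<lambda>i. a * c i"]) (simp add: scale_sum_right)
  qed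
qed

lemma lin_base: "i < n \<Longrightarrow> E i \<in> lin E n"
  by (rule linI[where c = "\<lambda>j. if j = i then 1 else 0"]) (simp add: if_distrib[of "\<lambda>c. c *s _"] cong: if_cong)

lemma olin_base: "i < n \<Longrightarrow> E i \<in> olin E n"
  unfolding olin_def
  by (rule CollectI, rule exI[of _ "\<lambda>j. if j = i then 1 else 0"])
    (auto simp: if_distrib[of "\<lambda>c. c *s _"] cong: if_cong)

lemma lin_subset: "subspace W \<Longrightarrow> (\<And>i. i < n \<Longrightarrow> E i \<in> W) \<Longrightarrow> lin E n \<subseteq> W"
  by (auto simp: lin_def intro!: subspace_sum subspace_scale)

lemma lin_mono: "m \<le> n \<Longrightarrow> lin E m \<subseteq> lin E n"
  by (intro lin_subset subspace_lin lin_base) auto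

lemma Phi_lin:
  assumes "subspace W" "\<And>i. i < n \<Longrightarrow> \<Phi> (E i) \<in> W" "x \<in> lin E n"
  shows "\<Phi> x \<in> W"
  using assms by (auto simp: lin_def Phi_sum Phi_scale intro!: subspace_sum subspace_scale)

lemma Phin_stable: "(\<And>x. x \<in> W \<Longrightarrow> \<Phi> x \<in> W) \<Longrightarrow> x \<in> W \<Longrightarrow> (\<Phi> ^^ j) x \<in> W"
  by (induction j) auto

lemma indep_eq_0: "indep E n \<Longrightarrow> (\<Sum>i<n. c i *s E i) = 0 \<Longrightarrow> i < n \<Longrightarrow> c i = 0"
  by (auto simp: indep_def)

lemma indep_mono: "indep E n \<Longrightarrow> m \<le> n \<Longrightarrow> indep E m"
  unfolding indep_def
proof (intro allI impI)
  fix c i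
  assume n: "\<forall>c. (\<Sum>i<n. c i *s E i) = 0 \<longrightarrow> (\<forall>i<n. c i = 0)" and m: "m \<le> n"
    and c: "(\<Sum>i<m. c i *s E i) = 0" and i: "i < m"
  have "(\<Sum>i<n. (if i < m then c i else 0) *s E i) = (\<Sum>i<m. (if i < m then c i else 0) *s E i)"
    by (rule sum.mono_neutral_right) (use m in auto)
  also have "\<dots> = 0" using c by simp
  finally have "\<forall>i<n. (if i < m then c i else 0) = 0" using spec[OF n] by (rule mp[rotated])
  hence "(if i < m then c i else 0) = 0" using i m by (meson less_le_trans)
  thus "c i = 0" using i by simp
qed

lemma lin_coords:
  assumes "\<And>i. i \<in> I \<Longrightarrow> F i \<in> lin E n"
  shows "\<exists>M. \<forall>i\<in>I. F i = (\<Sum>l<n. M l i *s E l)"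
proof -
  have "\<forall>i. \<exists>c. i \<in> I \<longrightarrow> F i = (\<Sum>l<n. c l *s E l)" using assms by (auto simp: lin_def)
  then obtain c where "\<forall>i. i \<in> I \<longrightarrow> F i = (\<Sum>l<n. c i l *s E l)" by metis
  thus ?thesis by (intro exI[of _ "\<lambda>l i. c i l"]) auto
qed

lemma sum_coords:
  assumes "\<forall>i\<in>I. F i = (\<Sum>l<n. M l i *s E l)"
  shows "(\<Sum>i\<in>I. c i *s F i) = (\<Sum>l<n. (\<Sum>i\<in>I. c i * M l i) *s E l)"
  using assms by (simp add: scale_sum_right scale_sum_left sum.swap[of _ _ I])

lemma indep_card_le:
  assumes "indep F m" "\<And>i. i < m \<Longrightarrow> F i \<in> lin E n"
  shows "m \<le> n"
proof (rule ccontr)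
  assume "\<not> m \<le> n"
  obtain M where M: "\<forall>i\<in>{..<m}. F i = (\<Sum>l<n. M l i *s E l)"
    using lin_coords[of "{..<m}" F E n] assms by auto
  obtain c where c: "\<exists>j\<in>{..<m}. c j \<noteq> 0" "\<forall>i\<in>{..<n}. (\<Sum>j\<in>{..<m}. c j * M i j) = 0"
    using linear_dependence[of "{..<n}" "{..<m}" M] \<open>\<not> m \<le> n\<close> by auto
  have "(\<Sum>i<m. c i *s F i) = 0" unfolding sum_coords[OF M] using c(2) by simp
  thus False using assms(1) c(1) unfolding indep_def by blast
qed

text \<open>The coordinate matrix of \<open>F\<close> in \<open>E\<close> is square with trivial
  kernel, so the coefficients of a relation among the \<open>E i\<close> also arise from a
  combination of the \<open>F i\<close>, which must be trivial.\<close>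

lemma spanning_indep:
  assumes "indep F n" "\<And>i. i < n \<Longrightarrow> F i \<in> lin E n"
  shows "indep E n"
  unfolding indep_def
proof (intro allI impI)
  fix a l
  assume a: "(\<Sum>i<n. a i *s E i) = 0" and l: "l < n"
  obtain M where M: "\<forall>i\<in>{..<n}. F i = (\<Sum>l<n. M l i *s E l)"
    using lin_coords[of "{..<n}" F E n] assms by auto
  have "\<exists>c. \<forall>i\<in>{..<n}. (\<Sum>j\<in>{..<n}. c j * M i j) = a i"
  proof (rule square_system_solvable)
    fix c assume "\<And>i. i \<in> {..<n} \<Longrightarrow> (\<Sum>j<n. c j * M i j) = 0"
    hence "(\<Sum>i<n. c i *s F i) = 0" unfolding sum_coords[OF M] by simp
    thus "\<forall>j\<in>{..<n}. c j = 0" using assms(1) unfolding indep_def by blast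
  qed auto
  then obtain c where c: "\<And>i. i < n \<Longrightarrow> (\<Sum>j<n. c j * M i j) = a i" by auto
  have "(\<Sum>i<n. c i *s F i) = (\<Sum>l<n. a l *s E l)" unfolding sum_coords[OF M] using c by simp
  hence "\<forall>i<n. c i = 0" using assms(1) a unfolding indep_def by simp
  thus "a l = 0" using c[OF l] by simp
qed

section \<open>Twisted polynomials and their Newton polygons\<close>

definition act :: "(nat \<Rightarrow> 'a) \<Rightarrow> nat \<Rightarrow> 'b \<Rightarrow> 'b" where
  "act f n x = (\<Sum>i<n. f i *s (\<Phi> ^^ i) x)"

text \<open>Coefficients of the product in the twisted polynomial ring, where \<open>\<Phi> a = \<sigma>(a) \<Phi>\<close>.\<close>

definition skew_mult :: "(nat \<Rightarrow> 'a) \<Rightarrow> (nat \<Rightarrow> 'a) \<Rightarrow> nat \<Rightarrow> 'a" where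
  "skew_mult f g m = (\<Sum>i\<le>m. f i * (\<sigma> ^^ i) (g (m - i)))"

lemma act_extend: "(\<And>i. n \<le> i \<Longrightarrow> f i = 0) \<Longrightarrow> n \<le> m \<Longrightarrow> act f m x = act f n x"
  unfolding act_def by (rule sum.mono_neutral_right) auto

lemma act_add: "act f n (x + y) = act f n x + act f n y"
  by (simp add: act_def Phin_add scale_right_distrib sum.distrib)

lemma act_mem: "subspace W \<Longrightarrow> (\<And>x. x \<in> W \<Longrightarrow> \<Phi> x \<in> W) \<Longrightarrow> x \<in> W \<Longrightarrow> act f n x \<in> W"
  unfolding act_def by (intro subspace_sum subspace_scale Phin_stable)

lemma act_skew_mult:
  assumes f: "\<And>i. n \<le> i \<Longrightarrow> f i = 0" and g: "\<And>i. m \<le> i \<Longrightarrow> g i = 0"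
  shows "act (skew_mult f g) (n + m) x = act f n (act g m x)"
proof -
  let ?h = "\<lambda>i j. (f i * (\<sigma> ^^ i) (g j)) *s (\<Phi> ^^ (i + j)) x"
  have "act f n (act g m x) = (\<Sum>i<n. \<Sum>j<m. ?h i j)"
    by (simp add: act_def Phin_sum Phin_scale scale_sum_right funpow_add)
  also have "\<dots> = (\<Sum>(i, j)\<in>{..<n} \<times> {..<m}. ?h i j)" by (rule sum.cartesian_product)
  also have "\<dots> = (\<Sum>(k, i)\<in>Sigma {..<n + m} (\<lambda>k. {..k}). ?h i (k - i))"
  proof (rule sum.reindex_bij_witness_not_neutral[where S' = "{}" and
      T' = "{(k, i) \<in> Sigma {..<n + m} (\<lambda>k. {..k}). \<not> (i < n \<and> k - i < m)}"
      and i = "\<lambda>(k, i). (i, k - i)" and j = "\<lambda>(i, j). (i + j, i)"])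
    show "finite {(k, i) \<in> Sigma {..<n + m} (\<lambda>k. {..k}). \<not> (i < n \<and> k - i < m)}"
      by (rule finite_subset[of _ "Sigma {..<n + m} (\<lambda>k. {..k})"]) auto
  qed (auto simp: f g not_less)
  also have "\<dots> = (\<Sum>k<n + m. \<Sum>i\<le>k. ?h i (k - i))" by (rule sum.Sigma[symmetric]) auto
  also have "\<dots> = act (skew_mult f g) (n + m) x"
    by (simp add: act_def skew_mult_def scale_sum_left)
  finally show ?thesis by simp
qed

text \<open>Right division by a monic \<open>g\<close>: the leading coefficient is removed with
  \<open>f n \<Phi>^l g\<close>. Bounds are exclusive: \<open>f\<close> has degree below
  \<open>n\<close>, the remainder \<open>Q\<close> degree below \<open>k\<close>. The last conjunct
  identifies the top coefficient of the quotient, which fixes its weight in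
  \<open>minimal_relation\<close>.\<close>

lemma skew_division:
  assumes g: "g k = 1" "\<And>i. k < i \<Longrightarrow> g i = 0"
  shows "(\<And>i. n \<le> i \<Longrightarrow> f i = 0) \<Longrightarrow>
    \<exists>R Q. (\<forall>i. n \<le> i + k \<longrightarrow> R i = 0) \<and> (\<forall>i. k \<le> i \<longrightarrow> Q i = 0) \<and>
      (\<forall>j. f j = skew_mult R g j + Q j) \<and> (\<forall>i. n = Suc (i + k) \<longrightarrow> R i = f (i + k))"
proof (induction n arbitrary: f)
  case 0
  thus ?case by (intro exI[of _ "\<lambda>_. 0"]) (auto simp: skew_mult_def)
next
  case (Suc n)
  show ?case
  proof (cases "n < k")
    case True
    thus ?thesis using Suc.prems
      by (intro exI[of _ "\<lambda>_. 0"] exI[of _ f]) (auto simp: skew_mult_def)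
  next
    case False
    define l where "l = n - k"
    have n: "n = l + k" using False by (simp add: l_def)
    define f' where "f' j = f j - (if l \<le> j then f n * (\<sigma> ^^ l) (g (j - l)) else 0)" for j
    have "f' i = 0" if "n \<le> i" for i
      using that Suc.prems g by (cases "i = n") (auto simp: f'_def n)
    then obtain R Q where RQ: "\<forall>i. n \<le> i + k \<longrightarrow> R i = 0" "\<forall>i. k \<le> i \<longrightarrow> Q i = 0"
        "\<forall>j. f' j = skew_mult R g j + Q j"
      using Suc.IH[of f'] by blast
    define R' where "R' i = (if i = l then f n else R i)" for i
    have "skew_mult R' g j = skew_mult R g j + (if l \<le> j then f n * (\<sigma> ^^ l) (g (j - l)) else 0)" for j
    proof -
      have Rl: "R l = 0" using RQ(1) n by simp
      have "skew_mult R' g j = (\<Sum>i\<le>j. R i * (\<sigma> ^^ i) (g (j - i)) +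
          (if i = l then f n * (\<sigma> ^^ l) (g (j - l)) else 0))"
        unfolding skew_mult_def R'_def by (rule sum.cong) (auto simp: Rl)
      thus ?thesis by (simp add: sum.distrib skew_mult_def)
    qed
    hence "f j = skew_mult R' g j + Q j" for j
      using spec[OF RQ(3), of j] by (simp add: f'_def algebra_simps)
    moreover have "R' i = 0" if "Suc n \<le> i + k" for i
      using that RQ(1) n by (auto simp: R'_def)
    moreover have "R' i = f (i + k)" if "Suc n = Suc (i + k)" for i
      using that n by (simp add: R'_def)
    ultimately show ?thesis using RQ(2) by blast
  qed
qed

text \<open>Taking the first index of least weight makes the inequality strict on one side, which
  singles out one dominant term in a product.\<close>

lemma least_weight_index:
  fixes wt :: "nat \<Rightarrow> int"
  assumes "finite A" "A \<noteq> {}"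
  shows "\<exists>i\<in>A. (\<forall>j\<in>A. wt i \<le> wt j) \<and> (\<forall>j\<in>A. j < i \<longrightarrow> wt i < wt j)"
proof -
  let ?w = "Min (wt ` A)"
  let ?P = "\<lambda>i. i \<in> A \<and> wt i = ?w"
  have "?w \<in> wt ` A" using assms by (intro Min_in) auto
  hence ex: "\<exists>i. ?P i" by auto
  have P: "?P (LEAST i. ?P i)" using LeastI_ex[OF ex] .
  have le: "?w \<le> wt j" if "j \<in> A" for j using assms that by simp
  have "?w < wt j" if "j \<in> A" "j < (LEAST i. ?P i)" for j
    using le[OF that(1)] not_less_Least[OF that(2)] that(1) by force
  thus ?thesis using P le by (intro bexI[of _ "LEAST i. ?P i"]) auto
qed

text \<open>Multiplicativity of the weighted Gauss valuation. With first minimal indices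
  \<open>i\<close> and \<open>j\<close>, every other term of coefficient \<open>i + j\<close> has an
  index below \<open>i\<close> in \<open>f\<close> or below \<open>j\<close> in \<open>g\<close>,
  hence strictly larger weight; \<open>\<sigma>\<close> does not change valuations.\<close>

lemma gauss_norm:
  assumes f: "\<And>i. n \<le> i \<Longrightarrow> f i = 0" "\<exists>i. f i \<noteq> 0" and g: "\<And>i. m \<le> i \<Longrightarrow> g i = 0" "\<exists>i. g i \<noteq> 0"
  shows "\<exists>i j. f i \<noteq> 0 \<and> g j \<noteq> 0 \<and> (\<forall>l. f l \<noteq> 0 \<longrightarrow> S * v (f i) + int i * r \<le> S * v (f l) + int l * r) \<and>
      (\<forall>l. g l \<noteq> 0 \<longrightarrow> S * v (g j) + int j * r \<le> S * v (g l) + int l * r) \<and>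
      (S > 0 \<longrightarrow> skew_mult f g (i + j) \<noteq> 0 \<and> v (skew_mult f g (i + j)) = v (f i) + v (g j))"
proof -
  have "{i. f i \<noteq> 0} \<subseteq> {..<n}" "{i. g i \<noteq> 0} \<subseteq> {..<m}" using f(1) g(1) by (auto simp flip: not_less)
  hence fin: "finite {i. f i \<noteq> 0}" "finite {i. g i \<noteq> 0}" by (auto intro: finite_subset)
  obtain i where i: "f i \<noteq> 0" "\<And>l. f l \<noteq> 0 \<Longrightarrow> S * v (f i) + int i * r \<le> S * v (f l) + int l * r"
      "\<And>l. f l \<noteq> 0 \<Longrightarrow> l < i \<Longrightarrow> S * v (f i) + int i * r < S * v (f l) + int l * r"
    using least_weight_index[of "{i. f i \<noteq> 0}" "\<lambda>l. S * v (f l) + int l * r"] fin f by auto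
  obtain j where j: "g j \<noteq> 0" "\<And>l. g l \<noteq> 0 \<Longrightarrow> S * v (g j) + int j * r \<le> S * v (g l) + int l * r"
      "\<And>l. g l \<noteq> 0 \<Longrightarrow> l < j \<Longrightarrow> S * v (g j) + int j * r < S * v (g l) + int l * r"
    using least_weight_index[of "{i. g i \<noteq> 0}" "\<lambda>l. S * v (g l) + int l * r"] fin g by auto
  let ?t = "\<lambda>l. f l * (\<sigma> ^^ l) (g (i + j - l))"
  have nz: "?t i \<noteq> 0" and vt: "v (?t i) = v (f i) + v (g j)" using i j by (auto simp: v_mult)
  have "skew_mult f g (i + j) \<noteq> 0 \<and> v (skew_mult f g (i + j)) = v (f i) + v (g j)" if S: "S > 0"
  proof -
    have "skew_mult f g (i + j) = ?t i + (\<Sum>l\<in>{..i + j} - {i}. ?t l)"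
      unfolding skew_mult_def by (rule sum.remove) auto
    moreover have "vge (v (?t i) + 1) (\<Sum>l\<in>{..i + j} - {i}. ?t l)"
    proof (rule vge_sum, rule vgeI)
      fix l assume l: "l \<in> {..i + j} - {i}" and t: "?t l \<noteq> 0"
      let ?l = "i + j - l"
      have fl: "f l \<noteq> 0" and gl: "g ?l \<noteq> 0" using t by auto
      have "S * v (f i) + int i * r + (S * v (g j) + int j * r) <
          S * v (f l) + int l * r + (S * v (g ?l) + int ?l * r)"
      proof (cases "l < i")
        case True
        show ?thesis using i(3)[OF fl True] j(2)[OF gl] by linarith
      next
        case False
        hence "?l < j" using l by auto
        show ?thesis using i(2)[OF fl] j(3)[OF gl \<open>?l < j\<close>] by linarith
      qed
      moreover have "int l * r + int ?l * r = int i * r + int j * r"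
        using l by (simp add: distrib_right[symmetric] of_nat_diff)
      ultimately have "S * (v (f i) + v (g j)) < S * (v (f l) + v (g ?l))"
        by (simp add: distrib_left)
      hence "v (f i) + v (g j) < v (f l) + v (g ?l)" using S by simp
      thus "v (?t i) + 1 \<le> v (?t l)" using vt fl gl by (simp add: v_mult)
    qed
    ultimately show ?thesis using v_add_less[OF nz] vt by metis
  qed
  thus ?thesis using i j by blast
qed

text \<open>The minimal polynomial \<open>Q\<close> of \<open>e\<close> modulo \<open>W\<close> divides \<open>\<Phi>\<^bsup>S\<^esup> - \<pi>\<^bsup>r\<^esup>\<close> on the right, so Gauss' lemma for the weighted
  valuation forces \<open>Q\<close> to be pure of slope \<open>r/S\<close>.\<close>

lemma minimal_relation:
  assumes S: "S \<ge> 1" and e: "(\<Phi> ^^ S) e = \<pi> powi r *s e"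
    and W: "subspace W" "\<And>x. x \<in> W \<Longrightarrow> \<Phi> x \<in> W" and eW: "e \<notin> W"
  shows "\<exists>k Q. k \<ge> 1 \<and> Q k = 1 \<and> (\<forall>i>k. Q i = 0) \<and> act Q (Suc k) e \<in> W \<and>
    (\<forall>c. act c k e \<in> W \<longrightarrow> (\<forall>t<k. c t = 0)) \<and>
    (\<forall>t. Q t \<noteq> 0 \<longrightarrow> (int k - int t) * r \<le> int S * v (Q t)) \<and>
    Q 0 \<noteq> 0 \<and> int S * v (Q 0) = int k * r"
proof -
  define A where "A k \<longleftrightarrow> (\<exists>Q. Q k = 1 \<and> (\<forall>i>k. Q i = 0) \<and> act Q (Suc k) e \<in> W)" for k
  \<comment> \<open>The twisted polynomial \<open>\<Phi>^S - \<pi>^r\<close>, which annihilates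
    \<open>e\<close>; both its nonzero coefficients have weight \<open>S r\<close>.\<close>
  define F where "F i = (if i = 0 then - (\<pi> powi r) else if i = S then 1 else 0)" for i
  have F0: "act F (Suc S) e = 0"
  proof -
    have "act F (Suc S) e = F 0 *s e + (\<Sum>i\<in>{..<Suc S} - {0}. F i *s (\<Phi> ^^ i) e)"
      unfolding act_def by (subst sum.remove[of _ 0]) auto
    also have "(\<Sum>i\<in>{..<Suc S} - {0}. F i *s (\<Phi> ^^ i) e) = (\<Phi> ^^ S) e"
      using S by (subst sum.remove[of _ S]) (auto simp: F_def intro!: sum.neutral)
    also have "F 0 = - (\<pi> powi r)" by (simp add: F_def)
    finally show ?thesis by (simp add: e)
  qed
  have AS: "A S" unfolding A_def using S F0 subspace_0[OF W(1)]
    by (intro exI[of _ F]) (auto simp: F_def)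
  define k where "k = (LEAST k. A k)"
  have Ak: "A k" unfolding k_def using AS by (rule LeastI)
  have kS: "k \<le> S" unfolding k_def using AS by (rule Least_le)
  have least: "\<not> A k'" if "k' < k" for k' using that unfolding k_def by (rule not_less_Least)
  obtain Q where Q: "Q k = 1" "\<And>i. i > k \<Longrightarrow> Q i = 0" "act Q (Suc k) e \<in> W"
    using Ak unfolding A_def by blast
  have k1: "k \<ge> 1"
  proof (rule ccontr)
    assume "\<not> k \<ge> 1"
    hence "k = 0" by simp
    thus False using Q eW by (simp add: act_def)
  qed
  have min: "\<forall>t<k. c t = 0" if c: "act c k e \<in> W" for c
  proof (rule ccontr)
    assume neg: "\<not> ?thesis"
    let ?T = "{t. t < k \<and> c t \<noteq> 0}"
    have T: "finite ?T" "?T \<noteq> {}" using neg by auto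
    define t where "t = Max ?T"
    have t: "t < k" "c t \<noteq> 0" using Max_in[OF T] unfolding t_def by auto
    have big: "c i = 0" if "t < i" "i < k" for i
    proof (rule ccontr)
      assume "c i \<noteq> 0"
      hence "i \<le> t" unfolding t_def using that by (intro Max_ge[OF T(1)]) auto
      thus False using that by simp
    qed
    define Q' where "Q' i = (if i \<le> t then c i / c t else 0)" for i
    have "act Q' (Suc t) e = inverse (c t) *s act c k e"
    proof -
      have eq: "act c k e = (\<Sum>i<Suc t. c i *s (\<Phi> ^^ i) e)"
        unfolding act_def by (rule sum.mono_neutral_right) (use t big in auto)
      show ?thesis unfolding eq scale_sum_right act_def[of Q']
        by (rule sum.cong) (auto simp: Q'_def divide_inverse mult.commute)
    qed
    hence "act Q' (Suc t) e \<in> W" using c W by (simp add: subspace_scale)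
    hence "A t" unfolding A_def using t by (intro exI[of _ Q']) (auto simp: Q'_def)
    thus False using least t by blast
  qed
  have "\<And>i. Suc S \<le> i \<Longrightarrow> F i = 0" using S by (auto simp: F_def)
  then obtain R M where R: "\<And>i. Suc S \<le> i + k \<Longrightarrow> R i = 0" and M: "\<And>i. k \<le> i \<Longrightarrow> M i = 0"
    and RM: "\<And>j. F j = skew_mult R Q j + M j" and Rtop: "\<And>i. Suc S = Suc (i + k) \<Longrightarrow> R i = F (i + k)"
    using skew_division[of Q k "Suc S" F, OF Q(1,2)] by blast
  \<comment> \<open>The remainder has degree below \<open>k\<close> and maps \<open>e\<close> into
    \<open>W\<close>, so minimality kills it and \<open>F = R Q\<close> exactly.\<close>
  have M0: "M j = 0" for j
  proof -
    let ?N = "Suc S + Suc k"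
    have Rbig: "R i = 0" if "Suc S \<le> i" for i using that by (intro R) simp
    have Qbig: "Q i = 0" if "Suc k \<le> i" for i using that by (intro Q) simp
    have "act F ?N e = act F (Suc S) e" by (rule act_extend) (use S in \<open>auto simp: F_def\<close>)
    hence "0 = act (skew_mult R Q) ?N e + act M ?N e"
      using F0 by (simp add: act_def RM scale_left_distrib sum.distrib)
    moreover have "act (skew_mult R Q) ?N e \<in> W"
      using act_skew_mult[of "Suc S" R "Suc k" Q e, OF Rbig Qbig] act_mem[OF W Q(3)] by simp
    ultimately have "act M ?N e \<in> W" using subspace_neg[OF W(1)] by (metis add_eq_0_iff minus_unique)
    moreover have "act M ?N e = act M k e" by (rule act_extend) (use M kS in auto)
    ultimately have "\<forall>t<k. M t = 0" using min by simp
    thus ?thesis using M by (cases "j < k") auto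
  qed
  have FRQ: "F j = skew_mult R Q j" for j using RM M0 by simp
  have R1: "R (S - k) = 1" using Rtop[of "S - k"] kS k1 S by (simp add: F_def)
  have "\<exists>i. R i \<noteq> 0" "\<exists>i. Q i \<noteq> 0" using R1 Q(1) by (metis zero_neq_one)+
  then obtain i j where ij: "R i \<noteq> 0" "Q j \<noteq> 0"
      "\<And>l. R l \<noteq> 0 \<Longrightarrow> int S * v (R i) + int i * r \<le> int S * v (R l) + int l * r"
      "\<And>l. Q l \<noteq> 0 \<Longrightarrow> int S * v (Q j) + int j * r \<le> int S * v (Q l) + int l * r"
      "F (i + j) \<noteq> 0" "v (F (i + j)) = v (R i) + v (Q j)"
    using gauss_norm[of "Suc S" R "Suc k" Q "int S" r] R Q S unfolding FRQ by auto
  \<comment> \<open>The least weights of \<open>R\<close> and \<open>Q\<close> add up to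
    \<open>S r\<close>, while the leading coefficients, both 1, bound them by
    \<open>(S - k) r\<close> and \<open>k r\<close>. Both bounds are therefore attained, which is
    purity of \<open>Q\<close>.\<close>
  have "int S * v (F (i + j)) + int (i + j) * r = int S * r"
    using ij(5) unfolding F_def by (auto split: if_splits)
  hence tot: "(int S * v (R i) + int i * r) + (int S * v (Q j) + int j * r) = int S * r"
    unfolding ij(6) by (simp add: algebra_simps)
  have leR: "int S * v (R i) + int i * r \<le> int (S - k) * r" using ij(3)[of "S - k"] R1 by simp
  have leQ: "int S * v (Q j) + int j * r \<le> int k * r" using ij(4)[of k] Q(1) by simp
  have SK: "int (S - k) * r + int k * r = int S * r"
    using kS by (simp add: distrib_right[symmetric] of_nat_diff)
  have eqR: "int S * v (R i) + int i * r = int (S - k) * r"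
    and eqQ: "int S * v (Q j) + int j * r = int k * r" using tot leR leQ SK by linarith+
  have b: "(int k - int t) * r \<le> int S * v (Q t)" if "Q t \<noteq> 0" for t
    using ij(4)[OF that] eqQ by (simp add: algebra_simps)
  have F0': "- (\<pi> powi r) = R 0 * Q 0" using FRQ[of 0] by (simp add: F_def skew_mult_def)
  hence nz: "R 0 \<noteq> 0" "Q 0 \<noteq> 0" by auto
  have "v (- (\<pi> powi r)) = v (R 0) + v (Q 0)" unfolding F0' using nz by (simp add: v_mult)
  hence "int S * v (R 0) + int S * v (Q 0) = int S * r" by (simp add: distrib_left[symmetric])
  moreover have "int (S - k) * r \<le> int S * v (R 0)" using ij(3)[OF nz(1)] eqR by simp
  moreover have "int k * r \<le> int S * v (Q 0)" using b[OF nz(2)] by simp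
  ultimately have "int S * v (Q 0) = int k * r" using SK by linarith
  thus ?thesis using k1 Q min b nz(2) by blast
qed

text \<open>Counting coefficients, \<open>Q\<close> has a right multiple that is a polynomial in \<open>\<Phi>\<^bsup>S\<^esup>\<close>; the latter acts on each eigenline
  by a scalar equation, which is solvable.\<close>

lemma act_surj:
  assumes S: "S \<ge> 1" and Q: "Q k = 1" "\<And>i. i > k \<Longrightarrow> Q i = 0"
    and E: "\<And>a. a < m \<Longrightarrow> (\<Phi> ^^ S) (E a) = \<pi> powi \<rho> a *s E a"
    and st: "\<And>x. x \<in> lin E m \<Longrightarrow> \<Phi> x \<in> lin E m" and y: "y \<in> lin E m"
  shows "\<exists>w \<in> lin E m. act Q (Suc k) w = y"
proof -
  \<comment> \<open>The degree of the cofactor: its \<open>D + 1\<close> coefficients face one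
    equation for each exponent up to \<open>S k\<close> that is not a multiple of \<open>S\<close>,
    and there are \<open>S k - k = D\<close> of these.\<close>
  define D where "D = (S - 1) * k"
  have Dk: "D + k = S * k" using S by (cases S) (auto simp: D_def)
  \<comment> \<open>The preimage of \<open>Q j\<close> under \<open>\<sigma>^n\<close>: coefficients
    are moved to the right of \<open>\<Phi>^n\<close>, which makes the conditions on the product
    linear in \<open>c\<close>.\<close>
  define qi where "qi n j = inv_into UNIV (\<sigma> ^^ n) (Q j)" for n j
  have qi: "(\<sigma> ^^ n) (qi n j) = Q j" for n j
    unfolding qi_def by (rule surj_f_inv_f) (rule bij_is_surj[OF sn_bij])
  have qi0: "qi n j = 0" if "j > k" for n j using qi[of n j] Q(2)[OF that] by simp
  have qik: "qi n k \<noteq> 0" for n using qi[of n k] Q(1) by auto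
  let ?I = "{n \<in> {..S * k}. \<not> S dvd n}"
  have "card ?I < card {..D}"
  proof -
    have "card {n \<in> {..S * k}. S dvd n} = k + 1"
      using sum_multiples[where m = k and f = "\<lambda>_. 1::nat", OF S] by (simp add: sum.inter_filter[symmetric])
    moreover have "card {..S * k} = card ?I + card {n \<in> {..S * k}. S dvd n}"
    proof -
      have "{..S * k} = ?I \<union> {n \<in> {..S * k}. S dvd n}" by auto
      hence "card {..S * k} = card (?I \<union> {n \<in> {..S * k}. S dvd n})" by (rule arg_cong)
      thus ?thesis by (subst (asm) card_Un_disjoint) auto
    qed
    ultimately show ?thesis using Dk by simp
  qed
  then obtain c where c: "\<exists>j\<in>{..D}. c j \<noteq> 0"
    "\<forall>n\<in>?I. (\<Sum>i\<in>{..D}. c i * (if i \<le> n then qi n (n - i) else 0)) = 0"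
    using linear_dependence[of ?I "{..D}" "\<lambda>n i. if i \<le> n then qi n (n - i) else 0"] by auto
  define \<tau> where "\<tau> n = (\<Sum>i\<le>D. c i * (if i \<le> n then qi n (n - i) else 0))" for n
  have tau0: "\<tau> n = 0" if "n \<le> S * k" "\<not> S dvd n" for n using c(2) that by (simp add: \<tau>_def)
  \<comment> \<open>The last nonzero \<open>c i\<close> meets the leading coefficient of
    \<open>Q\<close>, so the product is nonzero in exponent \<open>i + k\<close>.\<close>
  obtain n where n: "n \<le> S * k" "\<tau> n \<noteq> 0"
  proof -
    let ?A = "{i. i \<le> D \<and> c i \<noteq> 0}"
    have A: "finite ?A" "?A \<noteq> {}" using c(1) by auto
    define i where "i = Max ?A"
    have i: "i \<le> D" "c i \<noteq> 0" using Max_in[OF A] unfolding i_def by auto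
    have big: "c l = 0" if "i < l" "l \<le> D" for l
    proof (rule ccontr)
      assume "c l \<noteq> 0"
      hence "l \<le> i" unfolding i_def using that by (intro Max_ge[OF A(1)]) auto
      thus False using that by simp
    qed
    have "\<tau> (i + k) = c i * qi (i + k) k + (\<Sum>l\<in>{..D} - {i}. c l * (if l \<le> i + k then qi (i + k) (i + k - l) else 0))"
      unfolding \<tau>_def using i by (subst sum.remove[of _ i]) auto
    also have "(\<Sum>l\<in>{..D} - {i}. c l * (if l \<le> i + k then qi (i + k) (i + k - l) else 0)) = 0"
    proof (rule sum.neutral, rule ballI)
      fix l assume l: "l \<in> {..D} - {i}"
      show "c l * (if l \<le> i + k then qi (i + k) (i + k - l) else 0) = 0"
        using l big[of l] qi0[of "i + k - l"] by (cases "l < i") auto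
    qed
    finally have "\<tau> (i + k) \<noteq> 0" using i qik by simp
    moreover have "i + k \<le> S * k" using i Dk by simp
    ultimately show ?thesis using that by blast
  qed
  have key: "act Q (Suc k) (\<Sum>i\<le>D. (\<Phi> ^^ i) (c i *s u)) = (\<Sum>n\<le>S * k. (\<Phi> ^^ n) (\<tau> n *s u))" for u
  proof -
    let ?h = "\<lambda>i n. Q (n - i) *s (\<Phi> ^^ n) (c i *s u)"
    have inner: "(\<Sum>j\<le>k. Q j *s (\<Phi> ^^ (j + i)) (c i *s u)) = (\<Sum>n\<le>S * k. if i \<le> n then ?h i n else 0)"
      if "i \<le> D" for i
    proof -
      have "(\<Sum>n\<le>S * k. if i \<le> n then ?h i n else 0) = (\<Sum>n\<in>{n \<in> {..S * k}. i \<le> n}. ?h i n)"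
        by (rule sum.inter_filter[symmetric]) simp
      also have "\<dots> = (\<Sum>n\<in>{i..i + k}. ?h i n)"
        by (rule sum.mono_neutral_right) (use that Dk Q in auto)
      also have "\<dots> = (\<Sum>j\<le>k. ?h i (j + i))"
        by (rule sum.reindex_bij_witness[of _ "\<lambda>j. j + i" "\<lambda>n. n - i"]) auto
      finally show ?thesis by simp
    qed
    have "act Q (Suc k) (\<Sum>i\<le>D. (\<Phi> ^^ i) (c i *s u)) = (\<Sum>j\<le>k. \<Sum>i\<le>D. Q j *s (\<Phi> ^^ (j + i)) (c i *s u))"
      by (simp add: act_def Phin_sum scale_sum_right funpow_add lessThan_Suc_atMost)
    also have "\<dots> = (\<Sum>i\<le>D. \<Sum>j\<le>k. Q j *s (\<Phi> ^^ (j + i)) (c i *s u))" by (rule sum.swap)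
    also have "\<dots> = (\<Sum>i\<le>D. \<Sum>n\<le>S * k. if i \<le> n then ?h i n else 0)"
      by (rule sum.cong) (auto simp: inner)
    also have "\<dots> = (\<Sum>n\<le>S * k. \<Sum>i\<le>D. if i \<le> n then ?h i n else 0)" by (rule sum.swap)
    also have "\<dots> = (\<Sum>n\<le>S * k. (\<Phi> ^^ n) (\<tau> n *s u))"
    proof (rule sum.cong)
      fix n
      have "(\<Phi> ^^ n) (\<tau> n *s u) = (\<Sum>i\<le>D. (\<sigma> ^^ n) (c i * (if i \<le> n then qi n (n - i) else 0)) *s (\<Phi> ^^ n) u)"
        unfolding Phin_scale[of n "\<tau> n" u] unfolding \<tau>_def sn_sum scale_sum_left ..
      also have "\<dots> = (\<Sum>i\<le>D. if i \<le> n then ?h i n else 0)"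
        by (rule sum.cong) (auto simp: Phin_scale sn_mult qi mult.commute)
      finally show "(\<Sum>i\<le>D. if i \<le> n then ?h i n else 0) = (\<Phi> ^^ n) (\<tau> n *s u)" by simp
    qed simp
    finally show ?thesis .
  qed
  define t where "t a l = (if S dvd l then (\<sigma> ^^ l) (\<tau> l) * \<pi> powi (\<rho> a * int (l div S)) else 0)" for a l
  have eig: "(\<Phi> ^^ n) (\<tau> n *s (\<alpha> *s E a)) = (t a n * (\<sigma> ^^ n) \<alpha>) *s E a"
    if "a < m" "n \<le> S * k" for a n \<alpha>
  proof (cases "S dvd n")
    case True
    then obtain l where l: "n = S * l" by auto
    have "(\<Phi> ^^ n) (E a) = \<pi> powi (\<rho> a * int l) *s E a"
      unfolding l by (rule eigen_power) (rule E[OF that(1)])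
    thus ?thesis using S True l by (simp add: Phin_scale t_def sn_mult mult_ac)
  next
    case False
    thus ?thesis using tau0[OF that(2)] by (simp add: t_def)
  qed
  have tnz: "\<exists>n\<le>S * k. t a n \<noteq> 0" for a
    using n tau0[of n] by (intro exI[of _ n]) (auto simp: t_def)
  obtain z where z: "y = (\<Sum>a<m. z a *s E a)" using y by (rule linE)
  have "\<exists>\<alpha>. ell (t a) (S * k) \<alpha> = z a" for a using tnz[of a] ell_surj[of _ "S * k" "t a" "z a"] by blast
  then obtain \<alpha> where \<alpha>: "\<And>a. ell (t a) (S * k) (\<alpha> a) = z a" by metis
  define u where "u = (\<Sum>a<m. \<alpha> a *s E a)"
  have uE: "u \<in> lin E m" by (rule linI) (rule u_def)
  let ?w = "\<Sum>i\<le>D. (\<Phi> ^^ i) (c i *s u)"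
  have "?w \<in> lin E m"
    by (intro subspace_sum subspace_lin Phin_stable st subspace_scale uE)
  moreover have "act Q (Suc k) ?w = y"
  proof -
    have "act Q (Suc k) ?w = (\<Sum>n\<le>S * k. \<Sum>a<m. (\<Phi> ^^ n) (\<tau> n *s (\<alpha> a *s E a)))"
      unfolding key unfolding u_def scale_sum_right Phin_sum ..
    also have "\<dots> = (\<Sum>n\<le>S * k. \<Sum>a<m. (t a n * (\<sigma> ^^ n) (\<alpha> a)) *s E a)"
      by (intro sum.cong) (auto simp: eig simp del: scale_scale)
    also have "\<dots> = (\<Sum>a<m. \<Sum>n\<le>S * k. (t a n * (\<sigma> ^^ n) (\<alpha> a)) *s E a)" by (rule sum.swap)
    also have "\<dots> = (\<Sum>a<m. ell (t a) (S * k) (\<alpha> a) *s E a)" by (simp add: ell_def scale_sum_left)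
    finally show ?thesis by (simp add: \<alpha> z)
  qed
  ultimately show ?thesis by blast
qed

end

section \<open>Cyclic vectors and companion bases\<close>

lemma div_less:
  fixes a b s :: int
  assumes "a < s * b" "0 < s"
  shows "a div s < b"
proof (rule ccontr)
  assume "\<not> a div s < b"
  hence "s * b \<le> s * (a div s)" using assms by (intro mult_left_mono) auto
  moreover have "s * (a div s) \<le> a" using assms by (simp add: mult.commute minus_mod_eq_mult_div[symmetric])
  ultimately show False using assms(1) by linarith
qed

lemma sum_lessThan_add:
  fixes f :: "nat \<Rightarrow> 'a::comm_monoid_add"
  shows "(\<Sum>i<n + k. f i) = (\<Sum>i<n. f i) + (\<Sum>t<k. f (n + t))"
  by (induction k) (auto simp: add.assoc)

lemma downward_closed_eq_lessThan:
  assumes "A \<subseteq> {..<N}" "\<And>i j. i \<le> j \<Longrightarrow> j \<in> A \<Longrightarrow> i \<in> A"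
  shows "A = {..<card A}"
proof (cases "A = {}")
  case False
  have fin: "finite A" using assms(1) finite_subset by blast
  have "A = {..Max A}" using fin assms(2)[OF _ Max_in[OF fin False]] by auto
  thus ?thesis by (metis card_atMost lessThan_Suc_atMost)
qed simp

context semilinear
begin

text \<open>Coordinates satisfy \<open>\<sigma>^S (c l) \<pi>^(r l) = \<pi>^\<rho> c l\<close>, and
  \<open>\<sigma>\<close> preserves valuations: an eigenvector only involves basis vectors of its
  own exponent.\<close>

lemma eigen_coords:
  assumes "indep X N" "\<And>i. i < N \<Longrightarrow> (\<Phi> ^^ S) (X i) = \<pi> powi r i *s X i"
    and "(\<Phi> ^^ S) (\<Sum>l<N. c l *s X l) = \<pi> powi \<rho> *s (\<Sum>l<N. c l *s X l)" "l < N" "c l \<noteq> 0"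
  shows "r l = \<rho>"
proof -
  have "(\<Sum>l<N. ((\<sigma> ^^ S) (c l) * \<pi> powi r l - \<pi> powi \<rho> * c l) *s X l) = 0"
  proof -
    have "(\<Phi> ^^ S) (\<Sum>l<N. c l *s X l) = (\<Sum>l<N. ((\<sigma> ^^ S) (c l) * \<pi> powi r l) *s X l)"
      by (simp add: Phin_sum Phin_scale assms(2))
    thus ?thesis using assms(3) by (simp add: scale_left_diff_distrib sum_subtractf scale_sum_right)
  qed
  hence "(\<sigma> ^^ S) (c l) * \<pi> powi r l - \<pi> powi \<rho> * c l = 0"
    by (rule indep_eq_0[OF assms(1)]) (rule assms(4))
  hence "v ((\<sigma> ^^ S) (c l) * \<pi> powi r l) = v (\<pi> powi \<rho> * c l)" by simp
  thus ?thesis using assms(5) by (simp add: v_mult)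
qed

text \<open>\<open>\<Phi> (X i)\<close> is again an eigenvector with exponent \<open>r i\<close>, so
  an initial segment made of full slope classes is stable.\<close>

lemma slope_filtration_stable:
  assumes X: "indep X N" "\<And>i. i < N \<Longrightarrow> (\<Phi> ^^ S) (X i) = \<pi> powi r i *s X i"
    and st: "\<And>i. i < N \<Longrightarrow> \<Phi> (X i) \<in> lin X N"
    and m: "m \<le> N" "\<And>i j. i < m \<Longrightarrow> j < N \<Longrightarrow> r j = r i \<Longrightarrow> j < m" and x: "x \<in> lin X m"
  shows "\<Phi> x \<in> lin X m"
proof (rule Phi_lin[OF subspace_lin _ x])
  fix i assume i: "i < m"
  hence iN: "i < N" using m by simp
  obtain c where c: "\<Phi> (X i) = (\<Sum>l<N. c l *s X l)" using st[OF iN] by (rule linE)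
  have "(\<Phi> ^^ S) (\<Phi> (X i)) = \<pi> powi r i *s \<Phi> (X i)"
    using eigen_Phin[OF X(2)[OF iN], of 1] by simp
  hence "r l = r i" if "l < N" "c l \<noteq> 0" for l
    using eigen_coords[OF X, of c "r i" l] that unfolding c by blast
  hence z: "c l = 0" if "l < N" "m \<le> l" for l using m(2)[OF i, of l] that by (meson not_le)
  have "\<Phi> (X i) = (\<Sum>l<m. c l *s X l)"
    unfolding c by (rule sum.mono_neutral_right) (use m(1) z in auto)
  thus "\<Phi> (X i) \<in> lin X m" by (rule linI)
qed

definition cyclic :: "'b \<Rightarrow> nat \<Rightarrow> (nat \<Rightarrow> 'a) \<Rightarrow> bool" where
  "cyclic x n P \<longleftrightarrow> indep (\<lambda>l. (\<Phi> ^^ l) x) n \<and> P n = 1 \<and> (\<forall>i>n. P i = 0) \<and> act P (Suc n) x = 0"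

lemma cyclic_stable:
  assumes "P n = 1" "act P (Suc n) x = 0" and y: "y \<in> lin (\<lambda>l. (\<Phi> ^^ l) x) n"
  shows "\<Phi> y \<in> lin (\<lambda>l. (\<Phi> ^^ l) x) n"
proof (rule Phi_lin[OF subspace_lin _ y])
  fix i assume i: "i < n"
  show "\<Phi> ((\<Phi> ^^ i) x) \<in> lin (\<lambda>l. (\<Phi> ^^ l) x) n"
  proof (cases "Suc i = n")
    case True
    have "act P n x + (\<Phi> ^^ n) x = 0" using assms by (simp add: act_def)
    hence "(\<Phi> ^^ n) x = - act P n x" by (simp add: add_eq_0_iff)
    also have "\<dots> \<in> lin (\<lambda>l. (\<Phi> ^^ l) x) n"
      by (intro subspace_neg subspace_lin) (auto simp: act_def intro: linI)
    finally show ?thesis using True by auto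
  next
    case False
    thus ?thesis using lin_base[of "Suc i" n "\<lambda>l. (\<Phi> ^^ l) x"] i by simp
  qed
qed

lemma cyclic_mem:
  assumes "P n = 1" "act P (Suc n) x = 0"
  shows "x \<in> lin (\<lambda>l. (\<Phi> ^^ l) x) n"
proof (cases n)
  case 0
  hence "x = 0" using assms by (simp add: act_def)
  thus ?thesis using subspace_0[OF subspace_lin] by simp
next
  case (Suc k)
  thus ?thesis using lin_base[of 0 n "\<lambda>l. (\<Phi> ^^ l) x"] by simp
qed

text \<open>Eigenvectors are adjoined one at a time, in order of non-increasing slope. If
  \<open>X i\<close> lies outside the space \<open>W\<close> generated by \<open>x\<close> and has
  minimal relation \<open>Q\<close> modulo \<open>W\<close>, then a vector
  \<open>x' = X i + w\<close> with \<open>w\<close> in \<open>W\<close> and \<open>Q x' = x\<close>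
  generates both \<open>W\<close> and \<open>X i\<close>. It is annihilated by \<open>P Q\<close>,
  whose polygon is bounded by the concatenation of those of \<open>P\<close> and
  \<open>Q\<close>.\<close>

lemma cyclic_vector:
  fixes r :: "nat \<Rightarrow> int"
  defines "R \<equiv> \<lambda>l. \<Sum>i<l. r i"
  assumes S: "S \<ge> 1" and X: "indep X N" "\<And>i. i < N \<Longrightarrow> (\<Phi> ^^ S) (X i) = \<pi> powi r i *s X i"
    and st: "\<And>i. i < N \<Longrightarrow> \<Phi> (X i) \<in> lin X N"
    and srt: "\<And>i j. i \<le> j \<Longrightarrow> j < N \<Longrightarrow> r j \<le> r i"
  shows "\<exists>x P. x \<in> lin X N \<and> cyclic x N P \<and> (\<forall>i<N. X i \<in> lin (\<lambda>l. (\<Phi> ^^ l) x) N) \<and>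
    (\<forall>l. P l \<noteq> 0 \<longrightarrow> R N \<le> int S * v (P l) + R l) \<and> P 0 \<noteq> 0 \<and> int S * v (P 0) = R N"
proof -
  \<comment> \<open>The number of exponents that are at least \<open>\<rho>\<close>; by sortedness
    they belong to the first \<open>cnt \<rho>\<close> eigenvectors.\<close>
  define cnt where "cnt \<rho> = card {j. j < N \<and> \<rho> \<le> r j}" for \<rho>
  have cnt: "j < cnt \<rho> \<longleftrightarrow> j < N \<and> \<rho> \<le> r j" for j \<rho>
  proof -
    have "{j. j < N \<and> \<rho> \<le> r j} = {..<cnt \<rho>}" unfolding cnt_def
      by (rule downward_closed_eq_lessThan[of _ N]) (use srt in \<open>auto intro: order_trans\<close>)
    thus ?thesis by blast
  qed
  have cntN: "cnt \<rho> \<le> N" for \<rho> using cnt[of N \<rho>] by (meson less_irrefl not_le)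
  have cst: "\<Phi> x \<in> lin X (cnt \<rho>)" if "x \<in> lin X (cnt \<rho>)" for x \<rho>
    by (rule slope_filtration_stable[OF X st cntN _ that]) (auto simp: cnt)
  \<comment> \<open>Besides the cyclic vector the induction carries two facts: \<open>x\<close>
    stays in the part with exponents at least \<open>\<rho>\<close>, for every lower bound
    \<open>\<rho>\<close> of those met so far, and the cyclic space is spanned by eigenvectors
    \<open>E\<close>, as \<open>act_surj\<close> demands.\<close>
  have "i \<le> N \<Longrightarrow> \<exists>n x P E m \<rho>s. n \<le> N \<and> cyclic x n P \<and> (\<forall>j<i. X j \<in> lin (\<lambda>l. (\<Phi> ^^ l) x) n) \<and>
    (\<forall>l. P l \<noteq> 0 \<longrightarrow> R n \<le> int S * v (P l) + R l) \<and> P 0 \<noteq> 0 \<and> int S * v (P 0) = R n \<and>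
    (\<forall>\<rho>. (\<forall>j<i. \<rho> \<le> r j) \<longrightarrow> x \<in> lin X (cnt \<rho>)) \<and>
    lin (\<lambda>l. (\<Phi> ^^ l) x) n = lin E m \<and> (\<forall>a<m. (\<Phi> ^^ S) (E a) = \<pi> powi \<rho>s a *s E a)" for i
  proof (induction i)
    case 0
    show ?case
      by (rule exI[of _ 0], rule exI[of _ 0], rule exI[of _ "\<lambda>i. if i = 0 then 1 else 0"],
          rule exI[of _ "\<lambda>_. 0"], rule exI[of _ 0])
        (auto simp: cyclic_def indep_def act_def R_def lin_def subspace_0[OF subspace_lin, unfolded lin_def])
  next
    case (Suc i)
    hence "i \<le> N" by simp
    from Suc.IH[OF this] obtain n x P E m \<rho>s where n: "n \<le> N" and cyc: "cyclic x n P"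
      and Xj': "\<forall>j<i. X j \<in> lin (\<lambda>l. (\<Phi> ^^ l) x) n"
      and Pb': "\<forall>l. P l \<noteq> 0 \<longrightarrow> R n \<le> int S * v (P l) + R l" and P0: "P 0 \<noteq> 0" "int S * v (P 0) = R n"
      and xc': "\<forall>\<rho>. (\<forall>j<i. \<rho> \<le> r j) \<longrightarrow> x \<in> lin X (cnt \<rho>)"
      and WE: "lin (\<lambda>l. (\<Phi> ^^ l) x) n = lin E m"
      and E': "\<forall>a<m. (\<Phi> ^^ S) (E a) = \<pi> powi \<rho>s a *s E a" by (elim exE conjE) (rule that)
    have Xj: "X j \<in> lin (\<lambda>l. (\<Phi> ^^ l) x) n" if "j < i" for j using Xj' that by blast
    have Pb: "R n \<le> int S * v (P l) + R l" if "P l \<noteq> 0" for l using Pb' that by blast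
    have xc: "x \<in> lin X (cnt \<rho>)" if "\<And>j. j < i \<Longrightarrow> \<rho> \<le> r j" for \<rho> using xc' that by blast
    have E: "(\<Phi> ^^ S) (E a) = \<pi> powi \<rho>s a *s E a" if "a < m" for a using E' that by blast
    let ?Z = "\<lambda>l. (\<Phi> ^^ l) x"
    let ?W = "lin ?Z n"
    have iN: "i < N" using Suc.prems by simp
    have P: "indep ?Z n" "P n = 1" "\<And>i. i > n \<Longrightarrow> P i = 0" "act P (Suc n) x = 0"
      using cyc by (auto simp: cyclic_def)
    show ?case
    proof (cases "X i \<in> ?W")
      case True
      have "\<forall>j<Suc i. X j \<in> ?W" using Xj True less_Suc_eq by auto
      moreover have "\<forall>\<rho>. (\<forall>j<Suc i. \<rho> \<le> r j) \<longrightarrow> x \<in> lin X (cnt \<rho>)" using xc by simp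
      ultimately show ?thesis using n cyc Pb P0 WE E
        by (intro exI[of _ n] exI[of _ x] exI[of _ P] exI[of _ E] exI[of _ m] exI[of _ \<rho>s]) auto
    next
      case False
      have Wst: "\<Phi> y \<in> ?W" if "y \<in> ?W" for y by (rule cyclic_stable[OF P(2,4) that])
      obtain k Q where k: "k \<ge> 1" and Q: "Q k = 1" "\<And>i. i > k \<Longrightarrow> Q i = 0" "act Q (Suc k) (X i) \<in> ?W"
        and Qmin: "\<And>c. act c k (X i) \<in> ?W \<Longrightarrow> (\<forall>t<k. c t = 0)"
        and Qb: "\<And>t. Q t \<noteq> 0 \<Longrightarrow> (int k - int t) * r i \<le> int S * v (Q t)"
        and Q0: "Q 0 \<noteq> 0" "int S * v (Q 0) = int k * r i"
        using minimal_relation[OF S X(2)[OF iN] subspace_lin Wst False] by (auto 4 0)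
      have xW: "x \<in> ?W" by (rule cyclic_mem[OF P(2,4)])
      obtain w where w: "w \<in> ?W" "act Q (Suc k) w = x - act Q (Suc k) (X i)"
        using act_surj[of S Q k m E \<rho>s "x - act Q (Suc k) (X i)", OF S Q(1,2) E]
          Wst subspace_diff[OF subspace_lin xW Q(3)] unfolding WE by blast
      define x' where "x' = X i + w"
      have Qx': "act Q (Suc k) x' = x" unfolding x'_def act_add w(2) by simp
      let ?P = "skew_mult P Q"
      let ?Z' = "\<lambda>l. (\<Phi> ^^ l) x'"
      let ?W' = "lin ?Z' (n + k)"
      have Plarge: "?P l = 0" if "n + k < l" for l
        unfolding skew_mult_def
      proof (rule sum.neutral, rule ballI)
        fix a
        show "P a * (\<sigma> ^^ a) (Q (l - a)) = 0"
          using P(3)[of a] Q(2)[of "l - a"] that by (cases "a \<le> n") auto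
      qed
      have Ptop: "?P (n + k) = 1"
      proof -
        have "?P (n + k) = P n * (\<sigma> ^^ n) (Q (n + k - n)) +
            (\<Sum>a\<in>{..n + k} - {n}. P a * (\<sigma> ^^ a) (Q (n + k - a)))"
          unfolding skew_mult_def by (rule sum.remove) auto
        also have "(\<Sum>a\<in>{..n + k} - {n}. P a * (\<sigma> ^^ a) (Q (n + k - a))) = 0"
        proof (rule sum.neutral, rule ballI)
          fix a assume "a \<in> {..n + k} - {n}"
          thus "P a * (\<sigma> ^^ a) (Q (n + k - a)) = 0"
            using P(3)[of a] Q(2)[of "n + k - a"] by (cases "a < n") auto
        qed
        finally show ?thesis using P Q by simp
      qed
      have Pact: "act ?P (Suc (n + k)) x' = 0"
      proof -
        have "act ?P (Suc n + Suc k) x' = act P (Suc n) (act Q (Suc k) x')"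
          by (rule act_skew_mult) (use P Q in auto)
        moreover have "act ?P (Suc n + Suc k) x' = act ?P (Suc (n + k)) x'"
          by (rule act_extend) (use Plarge in auto)
        ultimately show ?thesis using Qx' P by simp
      qed
      have W'st: "\<Phi> y \<in> ?W'" if "y \<in> ?W'" for y by (rule cyclic_stable[OF Ptop Pact that])
      have x'W': "x' \<in> ?W'" by (rule cyclic_mem[OF Ptop Pact])
      have "x \<in> ?W'" using act_mem[OF subspace_lin W'st x'W', of Q "Suc k"] unfolding Qx' .
      hence WW': "?W \<subseteq> ?W'" by (intro lin_subset subspace_lin Phin_stable W'st)
      have XiW': "X i \<in> ?W'" using subspace_diff[OF subspace_lin x'W' subsetD[OF WW' w(1)]] by (simp add: x'_def)
      \<comment> \<open>A basis of \<open>W\<close> continued by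
        \<open>X i, \<Phi> (X i), ...\<close>, independent by minimality of \<open>Q\<close>. It
        lies in the span of the \<open>n + k\<close> vectors \<open>?Z'\<close>, which are then
        independent too.\<close>
      define G where "G l = (if l < n then ?Z l else (\<Phi> ^^ (l - n)) (X i))" for l
      have Gsum: "(\<Sum>l<n + k. c l *s G l) = (\<Sum>l<n. c l *s ?Z l) + act (\<lambda>t. c (n + t)) k (X i)" for c
        unfolding act_def G_def by (simp add: sum_lessThan_add)
      have "indep G (n + k)" unfolding indep_def
      proof (intro allI impI)
        fix c l assume c: "(\<Sum>l<n + k. c l *s G l) = 0" and l: "l < n + k"
        have "act (\<lambda>t. c (n + t)) k (X i) = - (\<Sum>l<n. c l *s ?Z l)"
          using c unfolding Gsum by (simp only: add_eq_0_iff)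
        moreover have "- (\<Sum>l<n. c l *s ?Z l) \<in> ?W"
          by (intro subspace_neg subspace_lin) (auto intro: linI)
        ultimately have ck: "\<forall>t<k. c (n + t) = 0" using Qmin by metis
        hence "act (\<lambda>t. c (n + t)) k (X i) = 0" by (simp add: act_def)
        hence "(\<Sum>l<n. c l *s ?Z l) = 0" using c unfolding Gsum by simp
        hence "\<forall>l<n. c l = 0" using P(1) unfolding indep_def by blast
        thus "c l = 0" using ck l by (metis add_diff_inverse_nat nat_add_left_cancel_less)
      qed
      hence ind: "indep ?Z' (n + k)"
      proof (rule spanning_indep)
        fix l assume "l < n + k"
        show "G l \<in> ?W'"
        proof (cases "l < n")
          case True
          thus ?thesis using subsetD[OF WW' lin_base[OF True, of ?Z]] by (simp add: G_def)
        next
          case False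
          thus ?thesis using Phin_stable[OF W'st XiW', of "l - n"] by (simp add: G_def)
        qed
      qed
      have cyc': "cyclic x' (n + k) ?P" using ind Ptop Plarge Pact by (simp add: cyclic_def)
      have xc': "x' \<in> lin X (cnt \<rho>)" if \<rho>: "\<And>j. j < Suc i \<Longrightarrow> \<rho> \<le> r j" for \<rho>
      proof -
        have "x \<in> lin X (cnt \<rho>)" by (rule xc) (use \<rho> in simp)
        hence "?W \<subseteq> lin X (cnt \<rho>)" by (intro lin_subset subspace_lin Phin_stable cst)
        moreover have "X i \<in> lin X (cnt \<rho>)" by (rule lin_base) (use \<rho> iN in \<open>simp add: cnt\<close>)
        ultimately show ?thesis unfolding x'_def using w(1) by (intro subspace_add subspace_lin) auto
      qed
      \<comment> \<open>Dimension counts from both sides place the positions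
        \<open>n, ..., n + k - 1\<close> in the block of exponent exactly \<open>r i\<close>, so the
        polygon of \<open>Q\<close> continues \<open>R\<close> correctly.\<close>
      have le: "n + k \<le> cnt (r i)"
      proof (rule indep_card_le[OF ind])
        have "x' \<in> lin X (cnt (r i))" by (rule xc') (use srt iN in auto)
        thus "(\<Phi> ^^ l) x' \<in> lin X (cnt (r i))" for l by (intro Phin_stable cst)
      qed
      have ge: "cnt (r i + 1) \<le> n"
      proof (rule indep_card_le)
        show "indep X (cnt (r i + 1))" by (rule indep_mono[OF X(1) cntN])
        fix j assume "j < cnt (r i + 1)"
        hence j: "j < N" "r i < r j" by (auto simp: cnt)
        hence "j < i" using srt[of i j] by (meson not_le leD)
        thus "X j \<in> ?W" by (rule Xj)
      qed
      have req: "r l = r i" if "n \<le> l" "l < n + k" for l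
      proof -
        have "l < cnt (r i)" "\<not> l < cnt (r i + 1)" using that le ge by auto
        thus ?thesis by (auto simp: cnt)
      qed
      have rge: "r i \<le> r l" if "l < n + k" for l
      proof -
        have "l < cnt (r i)" using that le by simp
        thus ?thesis by (simp add: cnt)
      qed
      have Radd: "R l + int t * r i \<le> R (l + t)" if "l + t \<le> n + k" for l t
        using that
      proof (induction t)
        case (Suc t)
        have "r i \<le> r (l + t)" by (rule rge) (use Suc.prems in simp)
        thus ?case using Suc by (simp add: R_def distrib_right)
      qed (simp add: R_def)
      have "R (n + t) = R n + int t * r i" if "t \<le> k" for t
        using that
      proof (induction t)
        case (Suc t)
        thus ?case using req[of "n + t"] by (simp add: R_def distrib_right)
      qed (simp add: R_def)
      hence Rnk: "R (n + k) = R n + int k * r i" by simp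
      have Pb': "R (n + k) \<le> int S * v (?P l) + R l" if nz: "?P l \<noteq> 0" for l
      proof -
        have lnk: "l \<le> n + k" using nz Plarge by (meson not_le)
        \<comment> \<open>The ceiling of \<open>(R (n + k) - R l) / S\<close>: a bound on
          \<open>S v\<close> becomes an integral bound on \<open>v\<close>, which passes to the sum
          over \<open>a\<close>.\<close>
        let ?d = "(R (n + k) - R l + int S - 1) div int S"
        have d: "vge ?d (?P l)" unfolding skew_mult_def
        proof (rule vge_sum, rule vgeI)
          fix a assume a: "a \<in> {..l}" and nz: "P a * (\<sigma> ^^ a) (Q (l - a)) \<noteq> 0"
          hence nz': "P a \<noteq> 0" "Q (l - a) \<noteq> 0" by auto
          have "R (n + k) - R l \<le> int S * v (P a) + int S * v (Q (l - a))"
            using Pb[OF nz'(1)] Qb[OF nz'(2)] Radd[of a "l - a"] lnk a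
            unfolding Rnk by (simp add: algebra_simps)
          hence "R (n + k) - R l \<le> int S * v (P a * (\<sigma> ^^ a) (Q (l - a)))"
            using nz' by (simp add: v_mult distrib_left)
          hence "R (n + k) - R l + int S - 1 < int S * (v (P a * (\<sigma> ^^ a) (Q (l - a))) + 1)"
            by (simp add: distrib_left)
          hence "?d < v (P a * (\<sigma> ^^ a) (Q (l - a))) + 1"
            using S by (intro div_less) (auto simp: mult.commute)
          thus "?d \<le> v (P a * (\<sigma> ^^ a) (Q (l - a)))" by simp
        qed
        have "?d \<le> v (?P l)" using d nz vge_v by blast
        hence "int S * ?d \<le> int S * v (?P l)" by (simp add: mult_left_mono)
        moreover have "R (n + k) - R l \<le> int S * ?d"
        proof -
          have "R (n + k) - R l + int S - 1 = int S * ?d + (R (n + k) - R l + int S - 1) mod int S" by simp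
          moreover have "(R (n + k) - R l + int S - 1) mod int S < int S" using S by simp
          ultimately show ?thesis by linarith
        qed
        ultimately show ?thesis by linarith
      qed
      have P0': "?P 0 = P 0 * Q 0" by (simp add: skew_mult_def)
      have P0n: "?P 0 \<noteq> 0" "int S * v (?P 0) = R (n + k)"
        using P0 Q0 by (auto simp: P0' v_mult distrib_left Rnk)
      define E' where "E' a = (if a < m then E a else (\<Phi> ^^ (a - m)) (X i))" for a
      define \<rho>' where "\<rho>' a = (if a < m then \<rho>s a else r i)" for a
      have E'eig: "(\<Phi> ^^ S) (E' a) = \<pi> powi \<rho>' a *s E' a" for a
        using E[of a] eigen_Phin[OF X(2)[OF iN], of "a - m"] by (simp add: E'_def \<rho>'_def)
      have E'W: "lin E' (m + k) = ?W'"
      proof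
        show "lin E' (m + k) \<subseteq> ?W'"
        proof (intro lin_subset subspace_lin)
          fix a assume "a < m + k"
          show "E' a \<in> ?W'"
          proof (cases "a < m")
            case True
            hence "E a \<in> ?W" unfolding WE by (rule lin_base)
            thus ?thesis using WW' True by (auto simp: E'_def)
          next
            case False
            thus ?thesis using Phin_stable[OF W'st XiW', of "a - m"] by (simp add: E'_def)
          qed
        qed
        have WE': "?W \<subseteq> lin E' (m + k)" unfolding WE
        proof (intro lin_subset subspace_lin)
          fix a assume "a < m"
          thus "E a \<in> lin E' (m + k)" using lin_base[of a "m + k" E'] by (simp add: E'_def)
        qed
        have XE: "(\<Phi> ^^ t) (X i) \<in> lin E' (m + k)" if "t < k" for t
          using lin_base[of "m + t" "m + k" E'] that by (simp add: E'_def)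
        have XkE: "(\<Phi> ^^ k) (X i) \<in> lin E' (m + k)"
        proof -
          have "act Q (Suc k) (X i) = act Q k (X i) + (\<Phi> ^^ k) (X i)" using Q by (simp add: act_def)
          hence "(\<Phi> ^^ k) (X i) = act Q (Suc k) (X i) - act Q k (X i)" by simp
          moreover have "act Q k (X i) \<in> lin E' (m + k)"
            unfolding act_def by (intro subspace_sum subspace_lin subspace_scale XE) auto
          ultimately show ?thesis using subsetD[OF WE' Q(3)] subspace_diff[OF subspace_lin] by metis
        qed
        have stE: "\<Phi> y \<in> lin E' (m + k)" if "y \<in> lin E' (m + k)" for y
        proof (rule Phi_lin[OF subspace_lin _ that])
          fix a assume a: "a < m + k"
          show "\<Phi> (E' a) \<in> lin E' (m + k)"
          proof (cases "a < m")
            case True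
            hence "E a \<in> ?W" unfolding WE by (rule lin_base)
            thus ?thesis using Wst WE' True by (auto simp: E'_def)
          next
            case False
            hence "\<Phi> (E' a) = (\<Phi> ^^ Suc (a - m)) (X i)" by (simp add: E'_def)
            thus ?thesis using XE[of "Suc (a - m)"] XkE a False by (cases "Suc (a - m) = k") auto
          qed
        qed
        have "x' \<in> lin E' (m + k)" unfolding x'_def
          using XE[of 0] k WE' w(1) by (intro subspace_add subspace_lin) auto
        thus "?W' \<subseteq> lin E' (m + k)" by (intro lin_subset subspace_lin Phin_stable stE)
      qed
      have "\<forall>j<Suc i. X j \<in> ?W'" using Xj WW' XiW' less_Suc_eq by auto
      moreover have "n + k \<le> N" using le cntN order_trans by blast
      ultimately show ?thesis using cyc' Pb' P0n xc' E'W E'eig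
        by (intro exI[of _ "n + k"] exI[of _ x'] exI[of _ ?P] exI[of _ E'] exI[of _ "m + k"] exI[of _ \<rho>']) auto
    qed
  qed
  from this[of N] obtain n x P where n: "n \<le> N" and cyc: "cyclic x n P"
    and XN: "\<forall>j<N. X j \<in> lin (\<lambda>l. (\<Phi> ^^ l) x) n"
    and b: "\<forall>l. P l \<noteq> 0 \<longrightarrow> R n \<le> int S * v (P l) + R l" "P 0 \<noteq> 0" "int S * v (P 0) = R n"
    and xc: "\<forall>\<rho>. (\<forall>j<N. \<rho> \<le> r j) \<longrightarrow> x \<in> lin X (cnt \<rho>)" by (auto 4 0)
  have "N \<le> n" by (rule indep_card_le[OF X(1)]) (use XN in auto)
  hence "n = N" using n by simp
  moreover have "x \<in> lin X N"
  proof -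
    \<comment> \<open>Any common lower bound of the exponents would do; inserting 0 covers
      \<open>N = 0\<close>.\<close>
    define \<rho> where "\<rho> = Min (insert 0 (r ` {..<N}))"
    have "\<forall>j<N. \<rho> \<le> r j" unfolding \<rho>_def by (auto intro!: Min_le)
    hence "x \<in> lin X (cnt \<rho>)" using xc by blast
    thus ?thesis using lin_mono[OF cntN] by blast
  qed
  ultimately show ?thesis using cyc XN b by blast
qed


text \<open>With \<open>e i = \<pi>^(- A i) \<Phi>^i x\<close>, the family
  \<open>\<pi>^(- a i) \<Phi> (e i)\<close> is the shift \<open>e (i + 1)\<close>. The relation
  \<open>P x = 0\<close> becomes \<open>\<Sum>l\<le>N. \<kappa> l e l = 0\<close>;
  \<open>R l \<le> S A l\<close> makes the \<open>\<kappa> l\<close> integral and equality at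
  \<open>N\<close> makes \<open>\<kappa> 0\<close> a unit, so the relation is solved integrally both
  for \<open>e N\<close> and for \<open>e 0\<close>.\<close>

lemma companion_basis:
  fixes r a :: "nat \<Rightarrow> int"
  defines "R \<equiv> \<lambda>l. \<Sum>i<l. r i" and "A \<equiv> \<lambda>l. \<Sum>i<l. a i"
  assumes S: "S \<ge> 1" and cyc: "cyclic x N P"
    and b: "\<And>l. P l \<noteq> 0 \<Longrightarrow> R N \<le> int S * v (P l) + R l" "P 0 \<noteq> 0" "int S * v (P 0) = R N"
    and A: "\<And>l. l \<le> N \<Longrightarrow> R l \<le> int S * A l" "int S * A N = R N"
  shows "\<exists>e. indep e N \<and> (\<forall>i<N. e i \<in> lin (\<lambda>l. (\<Phi> ^^ l) x) N) \<and>
    lin (\<lambda>l. (\<Phi> ^^ l) x) N \<subseteq> lin e N \<and>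
    (\<forall>i<N. \<pi> powi (- a i) *s \<Phi> (e i) \<in> olin e N) \<and>
    (\<forall>i<N. e i \<in> olin (\<lambda>i. \<pi> powi (- a i) *s \<Phi> (e i)) N)"
proof -
  let ?Z = "\<lambda>l. (\<Phi> ^^ l) x"
  define e where "e i = \<pi> powi (- A i) *s (\<Phi> ^^ i) x" for i
  have P: "indep ?Z N" "P N = 1" "act P (Suc N) x = 0" using cyc by (auto simp: cyclic_def)
  have Ze: "?Z i = \<pi> powi A i *s e i" for i by (simp add: e_def pi_powi_mult)
  have g: "\<pi> powi (- a i) *s \<Phi> (e i) = e (Suc i)" for i
    by (simp add: e_def Phi_scale sig_simps pi_powi_mult A_def algebra_simps)
  define \<kappa> where "\<kappa> l = P l * \<pi> powi (A l - A N)" for l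
  have rel: "(\<Sum>l\<le>N. \<kappa> l *s e l) = 0"
  proof -
    have "(\<Sum>l\<le>N. \<kappa> l *s e l) = \<pi> powi (- A N) *s act P (Suc N) x"
      unfolding act_def lessThan_Suc_atMost scale_sum_right
      by (rule sum.cong) (simp_all add: \<kappa>_def e_def mult.assoc pi_powi_mult mult.commute[of "P _"])
    thus ?thesis using P by simp
  qed
  have kint: "vge 0 (\<kappa> l)" if "l \<le> N" for l
  proof (rule vgeI)
    assume "\<kappa> l \<noteq> 0"
    hence nz: "P l \<noteq> 0" by (auto simp: \<kappa>_def)
    have "int S * v (\<kappa> l) = int S * v (P l) + int S * A l - int S * A N"
      using nz by (simp add: \<kappa>_def v_mult algebra_simps)
    hence "0 \<le> int S * v (\<kappa> l)" using b(1)[OF nz] A(1)[OF that] A(2) by linarith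
    thus "0 \<le> v (\<kappa> l)" using S by (simp add: zero_le_mult_iff)
  qed
  have k0: "\<kappa> 0 \<noteq> 0" "v (\<kappa> 0) = 0"
  proof -
    show "\<kappa> 0 \<noteq> 0" using b by (simp add: \<kappa>_def)
    have "int S * v (P 0) = int S * A N" using b A by simp
    hence "v (P 0) = A N" using S by simp
    thus "v (\<kappa> 0) = 0" using b by (simp add: \<kappa>_def v_mult A_def)
  qed
  have kN: "\<kappa> N = 1" using P by (simp add: \<kappa>_def)
  have eN: "e N = (\<Sum>l<N. (- \<kappa> l) *s e l)"
    using rel kN by (simp add: lessThan_Suc_atMost[symmetric] add_eq_0_iff sum_negf)
  have e0: "e 0 = (\<Sum>i<N. (- \<kappa> (Suc i) / \<kappa> 0) *s e (Suc i))"
  proof -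
    have "\<kappa> 0 *s e 0 + (\<Sum>i<N. \<kappa> (Suc i) *s e (Suc i)) = 0"
      using rel by (simp add: lessThan_Suc_atMost[symmetric] sum.lessThan_Suc_shift del: sum.lessThan_Suc)
    hence "\<kappa> 0 *s e 0 = - (\<Sum>i<N. \<kappa> (Suc i) *s e (Suc i))" by (simp add: eq_neg_iff_add_eq_0)
    hence "inverse (\<kappa> 0) *s \<kappa> 0 *s e 0 = inverse (\<kappa> 0) *s (- (\<Sum>i<N. \<kappa> (Suc i) *s e (Suc i)))" by simp
    thus ?thesis using k0 by (simp add: scale_sum_right sum_negf[symmetric] divide_inverse mult.commute)
  qed
  have o1: "\<pi> powi (- a i) *s \<Phi> (e i) \<in> olin e N" if "i < N" for i
  proof (cases "Suc i = N")
    case True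
    have "e N \<in> olin e N" unfolding olin_def
      by (rule CollectI, rule exI[of _ "\<lambda>l. - \<kappa> l"]) (use eN kint in auto)
    thus ?thesis unfolding g using True by simp
  next
    case False
    thus ?thesis unfolding g using that by (intro olin_base) simp
  qed
  have o2: "e i \<in> olin (\<lambda>i. \<pi> powi (- a i) *s \<Phi> (e i)) N" if "i < N" for i
    unfolding g
  proof (cases i)
    case 0
    show "e i \<in> olin (\<lambda>i. e (Suc i)) N" unfolding olin_def
      by (rule CollectI, rule exI[of _ "\<lambda>l. - \<kappa> (Suc l) / \<kappa> 0"])
        (use 0 e0 kint k0 in \<open>auto intro!: vge_unit_div\<close>)
  next
    case (Suc j)
    thus "e i \<in> olin (\<lambda>i. e (Suc i)) N" using olin_base[of j N "\<lambda>i. e (Suc i)"] that by simp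
  qed
  have eZ: "e i \<in> lin ?Z N" if "i < N" for i
    unfolding e_def by (intro subspace_scale subspace_lin lin_base that)
  have Zl: "?Z i \<in> lin e N" if "i < N" for i
    unfolding Ze by (intro subspace_scale subspace_lin lin_base that)
  have "indep e N" by (rule spanning_indep[OF P(1) Zl])
  moreover have "lin ?Z N \<subseteq> lin e N" by (intro lin_subset subspace_lin Zl)
  ultimately show ?thesis using o1 o2 eZ by blast
qed

end

section \<open>The hyperbolic part of a polarized isocrystal\<close>

text \<open>The amount \<open>E\<close> is distributed from the last index backwards, each
  \<open>u i\<close> being filled before the next one is touched; at most index \<open>j\<close> is
  filled partly.\<close>

lemma tail_lowering:
  fixes u :: "nat \<Rightarrow> int"
  assumes "\<And>i. i < K \<Longrightarrow> 0 \<le> u i" "0 \<le> E" "E \<le> (\<Sum>i<K. u i)"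
  shows "\<exists>\<delta> j. (\<forall>i<K. 0 \<le> \<delta> i \<and> \<delta> i \<le> u i) \<and> (\<Sum>i<K. \<delta> i) = E \<and>
    (\<forall>i<j. \<delta> i = 0) \<and> (\<forall>i. j < i \<longrightarrow> i < K \<longrightarrow> \<delta> i = u i)"
  using assms
proof (induction K arbitrary: E)
  case 0
  thus ?case by (intro exI[of _ "\<lambda>_. 0"] exI[of _ 0]) auto
next
  case (Suc K)
  show ?case
  proof (cases "E \<le> u K")
    case True
    thus ?thesis using Suc.prems
      by (intro exI[of _ "\<lambda>i. if i = K then E else 0"] exI[of _ K]) auto
  next
    case False
    obtain \<delta> j where d: "\<forall>i<K. 0 \<le> \<delta> i \<and> \<delta> i \<le> u i" "(\<Sum>i<K. \<delta> i) = E - u K"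
      "\<forall>i<j. \<delta> i = 0" "\<forall>i. j < i \<longrightarrow> i < K \<longrightarrow> \<delta> i = u i"
      using Suc.IH[of "E - u K"] Suc.prems False by auto
    have j: "\<forall>i<min j K. (\<delta>(K := u K)) i = 0" using d(3) by auto
    moreover have "\<forall>i. min j K < i \<longrightarrow> i < Suc K \<longrightarrow> (\<delta>(K := u K)) i = u i" using d(4) by auto
    moreover have "(\<Sum>i<Suc K. (\<delta>(K := u K)) i) = E" using d(2) by simp
    moreover have "\<forall>i<Suc K. 0 \<le> (\<delta>(K := u K)) i \<and> (\<delta>(K := u K)) i \<le> u i"
      using d(1) Suc.prems(1)[of K] by auto
    ultimately show ?thesis by blast
  qed
qed

context semilinear
begin

text \<open>An \<open>O\<close>-submodule of any rank. Quantifying over all of them lets the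
  integrality condition for one part of the space be stated before the other basis vectors are
  known.\<close>

definition olattice :: "'b set \<Rightarrow> bool" where
  "olattice M \<longleftrightarrow> 0 \<in> M \<and> (\<forall>x\<in>M. \<forall>y\<in>M. x + y \<in> M) \<and> (\<forall>a. \<forall>x\<in>M. vge 0 a \<longrightarrow> a *s x \<in> M)"

lemma olattice_add: "olattice M \<Longrightarrow> x \<in> M \<Longrightarrow> y \<in> M \<Longrightarrow> x + y \<in> M"
  and olattice_scale: "olattice M \<Longrightarrow> vge 0 a \<Longrightarrow> x \<in> M \<Longrightarrow> a *s x \<in> M"
  and olattice_0: "olattice M \<Longrightarrow> 0 \<in> M"
  by (auto simp: olattice_def)

lemma olattice_sum: "olattice M \<Longrightarrow> (\<And>i. i \<in> A \<Longrightarrow> f i \<in> M) \<Longrightarrow> sum f A \<in> M"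
  by (induction A rule: infinite_finite_induct) (auto intro: olattice_0 olattice_add)

lemma olattice_neg: "olattice M \<Longrightarrow> x \<in> M \<Longrightarrow> - x \<in> M"
  using olattice_scale[of M "-1" x] by simp

lemma olattice_olin: "olattice (olin E n)"
  unfolding olattice_def
proof (intro conjI ballI allI impI)
  show "0 \<in> olin E n" unfolding olin_def by (rule CollectI, rule exI[of _ "\<lambda>_. 0"]) simp
  fix x assume "x \<in> olin E n"
  then obtain c where c: "x = (\<Sum>i<n. c i *s E i)" "\<forall>i<n. vge 0 (c i)" by (auto simp: olin_def)
  show "a *s x \<in> olin E n" if "vge 0 a" for a unfolding olin_def
    by (rule CollectI, rule exI[of _ "\<lambda>i. a * c i"])
      (use c that in \<open>auto simp: scale_sum_right intro: vge_mult0\<close>)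
  fix y assume "y \<in> olin E n"
  then obtain d where d: "y = (\<Sum>i<n. d i *s E i)" "\<forall>i<n. vge 0 (d i)" by (auto simp: olin_def)
  show "x + y \<in> olin E n" unfolding olin_def
    by (rule CollectI, rule exI[of _ "\<lambda>i. c i + d i"])
      (use c d in \<open>auto simp: scale_left_distrib sum.distrib intro: vge_add\<close>)
qed

lemma olin_least: "olattice M \<Longrightarrow> (\<And>i. i < n \<Longrightarrow> E i \<in> M) \<Longrightarrow> olin E n \<subseteq> M"
  by (auto simp: olin_def intro!: olattice_sum olattice_scale)

end

locale polarized = semilinear v \<sigma> \<pi> p q scale \<Phi>
  for v :: "'a::field_char_0 \<Rightarrow> int" and \<sigma> \<pi> p q
    and scale :: "'a \<Rightarrow> 'b::ab_group_add \<Rightarrow> 'b" (infixr "*s" 75) and \<Phi> +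
  fixes B :: "'b \<Rightarrow> 'b \<Rightarrow> 'a" and c :: int and X :: "nat \<Rightarrow> 'b" and n S :: nat and r :: "nat \<Rightarrow> int"
  assumes B_add: "B (x + y) z = B x z + B y z"
    and B_scale: "B (a *s x) z = a * B x z"
    and B_anti: "B x y = - B y x"
    and B_Phi: "B (\<Phi> x) (\<Phi> y) = \<pi> powi c * \<sigma> (B x y)"
    and S_pos: "S \<ge> 1"
    and X_indep: "indep X (2 * n)"
    and X_eig: "i < 2 * n \<Longrightarrow> (\<Phi> ^^ S) (X i) = \<pi> powi r i *s X i"
    and X_st: "i < 2 * n \<Longrightarrow> \<Phi> (X i) \<in> lin X (2 * n)"
    and r_sorted: "i \<le> j \<Longrightarrow> j < 2 * n \<Longrightarrow> r j \<le> r i"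
    and nondeg: "x \<in> lin X (2 * n) \<Longrightarrow> (\<And>i. i < 2 * n \<Longrightarrow> B x (X i) = 0) \<Longrightarrow> x = 0"
begin

lemma B_add_right: "B z (x + y) = B z x + B z y"
  using B_add[of x y z] B_anti[of z] by simp

lemma B_scale_right: "B z (a *s x) = a * B z x"
  using B_scale[of a x z] B_anti[of z] by simp

lemma B_0 [simp]: "B 0 z = 0" "B z 0 = 0"
  using B_scale[of 0 0 z] B_scale_right[of z 0 0] by auto

lemma B_self [simp]: "B x x = 0"
  using B_anti[of x x] by simp

lemma B_sum: "B (sum f A) z = (\<Sum>i\<in>A. B (f i) z)"
  by (induction A rule: infinite_finite_induct) (auto simp: B_add)

lemma B_sum_right: "B z (sum f A) = (\<Sum>i\<in>A. B z (f i))"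
  by (induction A rule: infinite_finite_induct) (auto simp: B_add_right)

lemma B_minus: "B (- x) z = - B x z" "B z (- x) = - B z x"
  using B_scale[of "-1" x z] B_scale_right[of z "-1" x] by auto

lemma B_diff: "B (x - y) z = B x z - B y z" "B z (x - y) = B z x - B z y"
  using B_add[of x "- y" z] B_add_right[of z x "- y"] by (auto simp: B_minus)

lemma B_lin_0: "x \<in> lin E m \<Longrightarrow> (\<And>i. i < m \<Longrightarrow> B (E i) z = 0) \<Longrightarrow> B x z = 0"
  by (elim linE) (simp add: B_sum B_scale)

lemma B_Phin: "B ((\<Phi> ^^ j) x) ((\<Phi> ^^ j) y) = \<pi> powi (c * int j) * (\<sigma> ^^ j) (B x y)"
  by (induction j) (auto simp: B_Phi sig_simps power_int_add distrib_left mult_ac)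

text \<open>Applying \<open>\<Phi>^S\<close> to both arguments and comparing valuations: vectors
  pair nontrivially only if their slopes add up to \<open>c\<close>.\<close>

lemma B_eig:
  assumes "(\<Phi> ^^ S) x = \<pi> powi \<rho> *s x" "(\<Phi> ^^ S) y = \<pi> powi \<rho>' *s y" "\<rho> + \<rho>' \<noteq> c * int S"
  shows "B x y = 0"
proof (rule ccontr)
  assume nz: "B x y \<noteq> 0"
  have "\<pi> powi \<rho> * (\<pi> powi \<rho>' * B x y) = \<pi> powi (c * int S) * (\<sigma> ^^ S) (B x y)"
    using B_Phin[of S x y] by (simp add: assms(1,2) B_scale B_scale_right mult_ac)
  hence "v (\<pi> powi \<rho> * (\<pi> powi \<rho>' * B x y)) = v (\<pi> powi (c * int S) * (\<sigma> ^^ S) (B x y))" by simp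
  thus False using nz assms(3) by (simp add: v_mult)
qed

lemma X_stable: "x \<in> lin X (2 * n) \<Longrightarrow> \<Phi> x \<in> lin X (2 * n)"
  by (rule Phi_lin[OF subspace_lin X_st])

text \<open>The Gram determinant of the eigenbasis is nonzero, hence so is some term of its Leibniz
  expansion; the permutation of that term matches each slope with a complementary one.\<close>

lemma gram_permutation:
  "\<exists>\<phi>. \<phi> permutes {0..<2 * n} \<and> (\<forall>i<2 * n. r i + r (\<phi> i) = c * int S)"
proof -
  let ?N = "2 * n"
  let ?G = "mat ?N ?N (\<lambda>(i, j). B (X i) (X j))"
  have G: "?G \<in> carrier_mat ?N ?N" by simp
  have "det ?G \<noteq> 0"
  proof
    assume "det ?G = 0"
    then obtain w where w: "w \<in> carrier_vec ?N" "w \<noteq> 0\<^sub>v ?N" "?G *\<^sub>v w = 0\<^sub>v ?N"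
      using det_0_iff_vec_prod_zero_field[OF G] by blast
    define x where "x = (\<Sum>j<?N. (w $ j) *s X j)"
    have "B x (X i) = 0" if "i < ?N" for i
    proof -
      have "(?G *\<^sub>v w) $ i = 0" using w that by simp
      hence "(\<Sum>j<?N. B (X i) (X j) * w $ j) = 0"
        using that w(1) by (simp add: scalar_prod_def lessThan_atLeast0)
      hence "B (X i) x = 0" by (simp add: x_def B_sum_right B_scale_right mult.commute)
      thus ?thesis using B_anti[of x] by simp
    qed
    moreover have "x \<in> lin X ?N" unfolding x_def by (rule linI) (rule refl)
    ultimately have "x = 0" by (rule nondeg[rotated])
    hence "\<forall>j<?N. w $ j = 0" using X_indep unfolding indep_def x_def by blast
    thus False using w by auto
  qed
  then obtain \<phi> where p: "\<phi> permutes {0..<?N}" "(\<Prod>i = 0..<?N. ?G $$ (i, \<phi> i)) \<noteq> 0"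
    unfolding det_def'[OF G] by (metis (no_types, lifting) mem_Collect_eq mult_zero_right sum.neutral)
  have "r i + r (\<phi> i) = c * int S" if i: "i < ?N" for i
  proof -
    have \<phi>: "\<phi> i < ?N" using p(1) i permutes_in_image[of \<phi> "{0..<?N}" i] by simp
    have "?G $$ (i, \<phi> i) \<noteq> 0" using p(2) i by simp
    hence "B (X i) (X (\<phi> i)) \<noteq> 0" using i \<phi> by simp
    thus ?thesis using B_eig[OF X_eig[OF i] X_eig[OF \<phi>]] by blast
  qed
  thus ?thesis using p(1) by blast
qed

lemma sum_slopes: "(\<Sum>i<2 * n. r i) = int n * c * int S"
proof -
  obtain \<phi> where p: "\<phi> permutes {0..<2 * n}" "\<And>i. i < 2 * n \<Longrightarrow> r i + r (\<phi> i) = c * int S"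
    using gram_permutation by blast
  have "(\<Sum>i<2 * n. r (\<phi> i)) = (\<Sum>i<2 * n. r i)"
    using sum.permute[OF p(1), of r] by (simp add: o_def lessThan_atLeast0)
  moreover have "(\<Sum>i<2 * n. r i + r (\<phi> i)) = (\<Sum>i<2 * n. c * int S)" using p(2) by simp
  ultimately show ?thesis by (simp add: sum.distrib)
qed

text \<open>The dimension of \<open>V_+\<close>: the slope of \<open>X i\<close> is
  \<open>r i / S\<close>, and it exceeds \<open>c/2\<close> exactly for the indices below
  \<open>K\<close>.\<close>

definition K :: nat where "K = card {i. i < 2 * n \<and> c * int S < 2 * r i}"

lemma less_K: "i < K \<longleftrightarrow> i < 2 * n \<and> c * int S < 2 * r i"
proof -
  have "{i. i < 2 * n \<and> c * int S < 2 * r i} = {..<K}" unfolding K_def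
  proof (rule downward_closed_eq_lessThan[of _ "2 * n"])
    fix i j assume "i \<le> j" "j \<in> {i. i < 2 * n \<and> c * int S < 2 * r i}"
    thus "i \<in> {i. i < 2 * n \<and> c * int S < 2 * r i}" using r_sorted[of i j] by auto
  qed auto
  thus ?thesis by blast
qed

lemma K_card: "card {i. i < 2 * n \<and> 2 * r i < c * int S} = K"
proof -
  obtain \<phi> where p: "\<phi> permutes {0..<2 * n}" "\<And>i. i < 2 * n \<Longrightarrow> r i + r (\<phi> i) = c * int S"
    using gram_permutation by blast
  have lt: "\<phi> i < 2 * n \<longleftrightarrow> i < 2 * n" for i using permutes_in_image[OF p(1), of i] by simp
  have inj: "inj_on \<phi> A" for A using permutes_inj_on[OF p(1)] .
  have "card {i. i < 2 * n \<and> 2 * r i < c * int S} \<le> card {i. i < 2 * n \<and> c * int S < 2 * r i}"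
    by (rule card_inj_on_le[OF inj]) (use p(2) lt in fastforce)+
  moreover have "card {i. i < 2 * n \<and> c * int S < 2 * r i} \<le> card {i. i < 2 * n \<and> 2 * r i < c * int S}"
    by (rule card_inj_on_le[OF inj]) (use p(2) lt in fastforce)+
  ultimately show ?thesis by (simp add: K_def)
qed

lemma K_le: "2 * K \<le> 2 * n"
proof -
  have "card ({i. i < 2 * n \<and> 2 * r i < c * int S} \<union> {i. i < 2 * n \<and> c * int S < 2 * r i}) \<le> card {..<2 * n}"
    by (rule card_mono) auto
  moreover have "card ({i. i < 2 * n \<and> 2 * r i < c * int S} \<union> {i. i < 2 * n \<and> c * int S < 2 * r i}) = K + K"
    using K_card by (subst card_Un_disjoint) (auto simp: K_def)
  ultimately show ?thesis by simp
qed

lemma ge_K: "i < 2 * n \<Longrightarrow> 2 * n - K \<le> i \<longleftrightarrow> 2 * r i < c * int S"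
proof -
  assume i: "i < 2 * n"
  let ?A = "{i. i < 2 * n \<and> c * int S \<le> 2 * r i}"
  have "?A = {..<card ?A}"
  proof (rule downward_closed_eq_lessThan[of _ "2 * n"])
    fix i j assume "i \<le> j" "j \<in> ?A"
    thus "i \<in> ?A" using r_sorted[of i j] by auto
  qed auto
  moreover have "card ?A = 2 * n - K"
  proof -
    have "?A = {..<2 * n} - {i. i < 2 * n \<and> 2 * r i < c * int S}" by auto
    thus ?thesis using K_card by (simp add: card_Diff_subset subset_iff)
  qed
  ultimately have "i \<in> ?A \<longleftrightarrow> i < 2 * n - K" by (metis lessThan_iff)
  thus ?thesis using i by auto
qed

lemma mid_K: "K \<le> i \<Longrightarrow> i < 2 * n - K \<Longrightarrow> 2 * r i = c * int S"
  using less_K[of i] ge_K[of i] by auto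

lemma plus_isotropic:
  assumes "(\<Phi> ^^ S) x = \<pi> powi \<rho> *s x" "c * int S < 2 * \<rho>" "(\<Phi> ^^ S) y = \<pi> powi \<rho>' *s y" "c * int S \<le> 2 * \<rho>'"
  shows "B x y = 0" "B y x = 0"
proof -
  show "B x y = 0" by (rule B_eig[OF assms(1,3)]) (use assms in linarith)
  thus "B y x = 0" using B_anti[of y x] by simp
qed

lemma XK_stable: "x \<in> lin X K \<Longrightarrow> \<Phi> x \<in> lin X K"
proof (rule slope_filtration_stable[OF X_indep X_eig X_st])
  show "K \<le> 2 * n" using K_le by simp
  show "j < K" if "i < K" "j < 2 * n" "r j = r i" for i j using that by (simp add: less_K)
qed auto

text \<open>The solution is chosen as a function of \<open>z\<close> and \<open>e\<close> alone, so
  equal data get equal solutions; the symmetry of \<open>U\<close> below rests on this.\<close>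

lemma frobenius_equation: "\<exists>f. \<forall>z e. (\<sigma> ^^ S) (f z e) * \<pi> powi e - f z e = z"
proof -
  have "\<exists>a. (\<sigma> ^^ S) a * \<pi> powi e - a = z" for z e
  proof -
    let ?t = "\<lambda>j. if j = 0 then -1 else if j = S then \<pi> powi e else 0"
    obtain a where a: "ell ?t S a = z" using ell_surj[of 0 S ?t z] by auto
    have "{..S} = insert 0 (insert S ({..S} - {0, S}))" by auto
    hence "ell ?t S a = (\<Sum>j\<in>insert 0 (insert S ({..S} - {0, S})). ?t j * (\<sigma> ^^ j) a)"
      unfolding ell_def by (rule sum.cong) simp
    also have "\<dots> = (\<sigma> ^^ S) a * \<pi> powi e - a" using S_pos by simp
    finally show ?thesis using a by metis
  qed
  thus ?thesis
    by (intro exI[of _ "\<lambda>z e. SOME a. (\<sigma> ^^ S) a * \<pi> powi e - a = z"] allI) (rule someI_ex)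
qed

text \<open>The map \<open>y\<close> is the sum over \<open>j < S\<close> of the conjugates by \<open>\<Phi>\<^bsup>j\<^esup>\<close> of a symmetric tensor \<open>U\<close> on \<open>V\<^sub>+\<close>; the sum telescopes,
  and in the eigenbasis the equation for \<open>U\<close> decouples.\<close>

lemma unipotent_correction:
  fixes g :: "nat \<Rightarrow> 'b" and w :: "nat \<Rightarrow> 'a"
  assumes g: "\<And>i. i < K \<Longrightarrow> g i \<in> lin X K"
  shows "\<exists>y. (\<forall>x x'. y (x + x') = y x + y x') \<and> (\<forall>a x. y (a *s x) = a *s y x) \<and>
    (\<forall>x. \<Phi> (y x) = y (\<Phi> x) + (\<Sum>i<K. (w i * B (g i) (\<Phi> x)) *s g i)) \<and>
    (\<forall>x x'. B (y x) x' = B (y x') x) \<and> (\<forall>x. y x \<in> lin X K)"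
proof -
  obtain \<gamma> where \<gamma>: "\<forall>i\<in>{..<K}. g i = (\<Sum>a<K. \<gamma> a i *s X a)"
    using lin_coords[of "{..<K}" g X K] g by auto
  \<comment> \<open>The matrix of the tensor \<open>\<Sum>i<K. w i (g i \<otimes> g i)\<close> in
    the eigenbasis.\<close>
  define Z where "Z a b = (\<Sum>i<K. w i * \<gamma> a i * \<gamma> b i)" for a b
  obtain f where f: "\<And>z e. (\<sigma> ^^ S) (f z e) * \<pi> powi e - f z e = z" using frobenius_equation by blast
  define U where "U a b = f (Z a b) (r a + r b - c * int S)" for a b
  have Zsym: "Z a b = Z b a" for a b by (simp add: Z_def mult_ac)
  have Usym: "U a b = U b a" for a b by (simp add: U_def Zsym[of a b] add.commute)
  have Ueq: "(\<sigma> ^^ S) (U a b) * \<pi> powi (r a + r b - c * int S) - U a b = Z a b" for a b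
    unfolding U_def by (rule f)
  \<comment> \<open>The conjugate of \<open>U\<close> by \<open>\<Phi>^j\<close>, contracted with
    \<open>x\<close> through \<open>B\<close>; the power of \<open>\<pi>\<close> compensates the
    multiplier of \<open>B\<close>. Hence \<open>\<Phi> (Y j x) = Y (j + 1) (\<Phi> x)\<close>, and
    summation over \<open>j < S\<close> leaves \<open>Y S - Y 0\<close>.\<close>
  define Y where "Y j x = (\<Sum>a<K. \<Sum>b<K.
      ((\<sigma> ^^ j) (U a b) * \<pi> powi (- (c * int j)) * B ((\<Phi> ^^ j) (X b)) x) *s (\<Phi> ^^ j) (X a))" for j x
  define y where "y x = (\<Sum>j<S. Y j x)" for x
  have XK: "X a \<in> lin X K" if "a < K" for a using that by (rule lin_base)
  have XS: "(\<Phi> ^^ S) (X a) = \<pi> powi r a *s X a" if "a < K" for a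
    by (rule X_eig) (use that in \<open>simp add: less_K\<close>)
  have YK: "Y j x \<in> lin X K" for j x unfolding Y_def
    by (intro subspace_sum subspace_lin subspace_scale Phin_stable XK_stable XK) auto
  have "y (x + x') = y x + y x'" for x x'
    by (simp add: y_def Y_def B_add_right distrib_left scale_left_distrib sum.distrib)
  moreover have "y (a *s x) = a *s y x" for a x
    by (simp add: y_def Y_def B_scale_right scale_sum_right mult_ac)
  moreover have "\<Phi> (y x) = y (\<Phi> x) + (\<Sum>i<K. (w i * B (g i) (\<Phi> x)) *s g i)" for x
  proof -
    have step: "\<Phi> (Y j x) = Y (Suc j) (\<Phi> x)" for j
    proof -
      have "\<sigma> (B ((\<Phi> ^^ j) (X b)) x) = \<pi> powi (- c) * B ((\<Phi> ^^ Suc j) (X b)) (\<Phi> x)" for b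
        using B_Phi[of "(\<Phi> ^^ j) (X b)" x] by (simp add: mult.assoc[symmetric] pi_powi_mult)
      moreover have pp: "\<pi> powi (- (c * int (Suc j))) = \<pi> powi (- c) * \<pi> powi (- (c * int j))"
        by (simp add: pi_powi_mult algebra_simps)
      ultimately have *: "\<sigma> ((\<sigma> ^^ j) (U a b) * \<pi> powi (- (c * int j)) * B ((\<Phi> ^^ j) (X b)) x) =
          (\<sigma> ^^ Suc j) (U a b) * \<pi> powi (- (c * int (Suc j))) * B ((\<Phi> ^^ Suc j) (X b)) (\<Phi> x)" for a b
        by (simp add: sig_simps pp mult_ac del: of_nat_Suc)
      show ?thesis unfolding Y_def Phi_sum Phi_scale * by simp
    qed
    have "\<Phi> (y x) = (\<Sum>j<S. Y (Suc j) (\<Phi> x))" by (simp add: y_def Phi_sum step)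
    also have "\<dots> = y (\<Phi> x) + (Y S (\<Phi> x) - Y 0 (\<Phi> x))"
      using sum.lessThan_Suc_shift[of "\<lambda>j. Y j (\<Phi> x)" S] by (simp add: y_def algebra_simps)
    also have "Y S (\<Phi> x) - Y 0 (\<Phi> x) = (\<Sum>a<K. \<Sum>b<K. (Z a b * B (X b) (\<Phi> x)) *s X a)"
    proof -
      have "Y S u = (\<Sum>a<K. \<Sum>b<K. ((\<sigma> ^^ S) (U a b) * \<pi> powi (r a + r b - c * int S) * B (X b) u) *s X a)" for u
        unfolding Y_def
        by (intro sum.cong) (auto simp: XS B_scale power_int_diff power_int_minus pi_powi_add field_simps)
      moreover have "Y 0 u = (\<Sum>a<K. \<Sum>b<K. (U a b * B (X b) u) *s X a)" for u by (simp add: Y_def)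
      ultimately show ?thesis unfolding Ueq[symmetric]
        by (simp add: left_diff_distrib scale_left_diff_distrib sum_subtractf)
    qed
    also have "\<dots> = (\<Sum>i<K. (w i * B (g i) (\<Phi> x)) *s g i)"
    proof -
      have "(w i * B (g i) u) *s g i = (\<Sum>a<K. \<Sum>b<K. (w i * \<gamma> a i * \<gamma> b i * B (X b) u) *s X a)"
        if "i < K" for i u
      proof -
        have gi: "g i = (\<Sum>a<K. \<gamma> a i *s X a)" using \<gamma> that by blast
        have "B (g i) u = (\<Sum>b<K. \<gamma> b i * B (X b) u)" unfolding gi by (simp add: B_sum B_scale)
        hence "(w i * B (g i) u) *s g i = (\<Sum>a<K. (w i * (\<Sum>b<K. \<gamma> b i * B (X b) u) * \<gamma> a i) *s X a)"
          by (subst (2) gi) (simp add: scale_sum_right)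
        thus ?thesis by (simp add: sum_distrib_left sum_distrib_right scale_sum_left mult_ac)
      qed
      hence "(\<Sum>i<K. (w i * B (g i) (\<Phi> x)) *s g i) =
          (\<Sum>i<K. \<Sum>a<K. \<Sum>b<K. (w i * \<gamma> a i * \<gamma> b i * B (X b) (\<Phi> x)) *s X a)" by simp
      also have "\<dots> = (\<Sum>a<K. \<Sum>i<K. \<Sum>b<K. (w i * \<gamma> a i * \<gamma> b i * B (X b) (\<Phi> x)) *s X a)" by (rule sum.swap)
      also have "\<dots> = (\<Sum>a<K. \<Sum>b<K. \<Sum>i<K. (w i * \<gamma> a i * \<gamma> b i * B (X b) (\<Phi> x)) *s X a)"
        by (rule sum.cong[OF refl]) (rule sum.swap)
      finally show ?thesis by (simp add: Z_def scale_sum_left sum_distrib_right)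
    qed
    finally show ?thesis .
  qed
  moreover have "B (y x) x' = B (y x') x" for x x'
  proof -
    have "B (Y j x) x' = B (Y j x') x" for j
    proof -
      let ?T = "\<lambda>a b. (\<sigma> ^^ j) (U a b) * \<pi> powi (- (c * int j)) * B ((\<Phi> ^^ j) (X b)) x * B ((\<Phi> ^^ j) (X a)) x'"
      have "B (Y j x) x' = (\<Sum>a<K. \<Sum>b<K. ?T a b)" by (simp add: Y_def B_sum B_scale)
      also have "\<dots> = (\<Sum>b<K. \<Sum>a<K. ?T a b)" by (rule sum.swap)
      also have "\<dots> = B (Y j x') x"
        by (simp add: Y_def B_sum B_scale Usym mult_ac)
      finally show ?thesis .
    qed
    thus ?thesis by (simp add: y_def B_sum)
  qed
  moreover have "y x \<in> lin X K" for x unfolding y_def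
    by (intro subspace_sum subspace_lin YK)
  ultimately show ?thesis by (intro exI[of _ y] conjI allI)
qed

lemma K_eig: "i < K \<Longrightarrow> (\<Phi> ^^ S) (X i) = \<pi> powi r i *s X i" and K_slope: "i < K \<Longrightarrow> c * int S < 2 * r i"
  by (auto simp: less_K intro: X_eig)

lemma plus_B_0: "x \<in> lin X K \<Longrightarrow> (\<Phi> ^^ S) z = \<pi> powi \<rho> *s z \<Longrightarrow> c * int S \<le> 2 * \<rho> \<Longrightarrow> B x z = 0"
  by (rule B_lin_0) (auto intro: plus_isotropic(1)[OF K_eig K_slope])

lemma plus_plus_0: "x \<in> lin X K \<Longrightarrow> y \<in> lin X K \<Longrightarrow> B x y = 0"
proof (rule B_lin_0)
  assume x: "x \<in> lin X K" and y: "y \<in> lin X K"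
  show "B (X i) y = 0" if "i < K" for i
  proof -
    have "B y (X i) = 0"
      by (rule plus_B_0[OF y K_eig[OF that]]) (use K_slope[OF that] in simp)
    thus ?thesis using B_anti[of "X i"] by simp
  qed
qed

text \<open>The entries of \<open>\<mu>\<close> are lowered from the end, each at most to \<open>c - \<mu> i\<close>, until the total is right.\<close>

lemma lowered_cocharacter:
  fixes \<mu> :: "nat \<Rightarrow> int"
  assumes mu: "\<And>i. i < K \<Longrightarrow> c \<le> 2 * \<mu> i"
    and dom: "\<And>l. l \<le> K \<Longrightarrow> (\<Sum>i<l. r i) \<le> int S * (\<Sum>i<l. \<mu> i)"
    and D: "int S * D = (\<Sum>i<K. r i)"
  shows "\<exists>a. (\<forall>i<K. c - \<mu> i \<le> a i \<and> a i \<le> \<mu> i) \<and>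
    (\<forall>l\<le>K. (\<Sum>i<l. r i) \<le> int S * (\<Sum>i<l. a i)) \<and> int S * (\<Sum>i<K. a i) = (\<Sum>i<K. r i)"
proof -
  have S0: "0 < int S" using S_pos by simp
  \<comment> \<open>Here \<open>c - \<mu> i \<le> c/2\<close>, whereas every slope on
    \<open>V_+\<close> exceeds \<open>c/2\<close>.\<close>
  have small: "int S * (c - \<mu> i) \<le> r i" if "i < K" for i
  proof -
    have "int S * (2 * (c - \<mu> i)) \<le> int S * c" using mu[OF that] by (intro mult_left_mono) auto
    thus ?thesis using K_slope[OF that] by (simp add: algebra_simps)
  qed
  have "0 \<le> (\<Sum>i<K. \<mu> i) - D"
  proof -
    have "int S * D \<le> int S * (\<Sum>i<K. \<mu> i)" using dom[of K] D by simp
    thus ?thesis using S0 by simp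
  qed
  moreover have "(\<Sum>i<K. \<mu> i) - D \<le> (\<Sum>i<K. 2 * \<mu> i - c)"
  proof -
    have "(\<Sum>i<K. int S * (c - \<mu> i)) \<le> (\<Sum>i<K. r i)" by (rule sum_mono) (use small in auto)
    hence "int S * (\<Sum>i<K. c - \<mu> i) \<le> int S * D" unfolding D by (simp add: sum_distrib_left)
    hence "(\<Sum>i<K. c - \<mu> i) \<le> D" using S0 by simp
    moreover have "(\<Sum>i<K. 2 * \<mu> i - c) = (\<Sum>i<K. \<mu> i) - (\<Sum>i<K. c - \<mu> i)"
      by (simp add: sum_subtractf[symmetric])
    ultimately show ?thesis by linarith
  qed
  ultimately obtain \<delta> j where d: "\<forall>i<K. 0 \<le> \<delta> i \<and> \<delta> i \<le> 2 * \<mu> i - c" "(\<Sum>i<K. \<delta> i) = (\<Sum>i<K. \<mu> i) - D"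
    "\<forall>i<j. \<delta> i = 0" "\<forall>i. j < i \<longrightarrow> i < K \<longrightarrow> \<delta> i = 2 * \<mu> i - c"
    using tail_lowering[of K "\<lambda>i. 2 * \<mu> i - c" "(\<Sum>i<K. \<mu> i) - D"] mu by auto
  define a where "a i = \<mu> i - \<delta> i" for i
  have tot: "int S * (\<Sum>i<K. a i) = (\<Sum>i<K. r i)" using d(2) D by (simp add: a_def sum_subtractf)
  have "(\<Sum>i<l. r i) \<le> int S * (\<Sum>i<l. a i)" if l: "l \<le> K" for l
  proof (cases "l \<le> j")
    case True
    have "(\<Sum>i<l. a i) = (\<Sum>i<l. \<mu> i)" by (rule sum.cong) (use True d(3) in \<open>auto simp: a_def\<close>)
    thus ?thesis using dom[OF l] by simp
  next
    case False
    have split: "(\<Sum>i<K. f i) = (\<Sum>i<l. f i) + (\<Sum>i\<in>{l..<K}. f i)" for f :: "nat \<Rightarrow> int"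
      using l by (simp add: sum.atLeastLessThan_concat lessThan_atLeast0)
    \<comment> \<open>Beyond \<open>j\<close> the lowered entries equal \<open>c - \<mu> i\<close>
      and lie below the slopes; subtracting this tail from the common total bounds the partial sum
      up to \<open>l\<close>.\<close>
    have "(\<Sum>i\<in>{l..<K}. int S * a i) \<le> (\<Sum>i\<in>{l..<K}. r i)"
    proof (rule sum_mono)
      fix i assume "i \<in> {l..<K}"
      hence "i < K" "\<delta> i = 2 * \<mu> i - c" using d(4) False by auto
      thus "int S * a i \<le> r i" using small[of i] by (simp add: a_def)
    qed
    thus ?thesis using tot split[of "\<lambda>i. int S * a i"] split[of r] by (simp add: sum_distrib_left)
  qed
  moreover have "\<forall>i<K. c - \<mu> i \<le> a i \<and> a i \<le> \<mu> i" using d(1) by (auto simp: a_def)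
  ultimately show ?thesis using tot by blast
qed

text \<open>Let \<open>e\<close> be a companion basis of \<open>V_+\<close> of the lowered type
  \<open>a\<close>, \<open>f\<close> its dual basis in \<open>V_-\<close>, and
  \<open>F i = f i + y (f i)\<close>. The correction \<open>y\<close> puts the term
  \<open>\<pi>^(c - \<mu> i) g i\<close> into \<open>\<Phi> (F i)\<close>, so that subtracting
  \<open>\<pi>^(a i + \<mu> i - c) F i\<close> from \<open>e i\<close> cancels \<open>g i\<close> in
  \<open>\<Phi> (E i)\<close> and leaves a multiple of \<open>\<pi>^(\<mu> i)\<close>. The exponents
  \<open>a i + \<mu> i - c\<close> and \<open>\<mu> i - a i\<close> are non-negative by the choice
  of \<open>a\<close>.\<close>

lemma hyperbolic_part:
  fixes \<mu> :: "nat \<Rightarrow> int"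
  assumes mu: "\<forall>i<K. c \<le> 2 * \<mu> i"
    and dom: "\<forall>l\<le>K. (\<Sum>i<l. r i) \<le> int S * (\<Sum>i<l. \<mu> i)"
  shows "\<exists>E F. (\<forall>i<K. \<forall>j<K. B (E i) (E j) = 0 \<and> B (F i) (F j) = 0 \<and> B (E i) (F j) = (if i = j then 1 else 0)) \<and>
    (\<forall>i<K. \<forall>z \<rho>. (\<Phi> ^^ S) z = \<pi> powi \<rho> *s z \<longrightarrow> 2 * \<rho> = c * int S \<longrightarrow> B (E i) z = 0 \<and> B (F i) z = 0) \<and>
    (\<forall>M. olattice M \<longrightarrow> (\<forall>i<K. E i \<in> M \<and> F i \<in> M) \<longrightarrow>
      (\<forall>i<K. \<pi> powi (- \<mu> i) *s \<Phi> (E i) \<in> M \<and> \<pi> powi (\<mu> i - c) *s \<Phi> (F i) \<in> M))"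
proof -
  have K2n: "K \<le> 2 * n" using K_le by simp
  obtain x P where x: "x \<in> lin X K" and cyc: "cyclic x K P"
    and XZ: "\<forall>i<K. X i \<in> lin (\<lambda>l. (\<Phi> ^^ l) x) K"
    and Pb: "\<forall>l. P l \<noteq> 0 \<longrightarrow> (\<Sum>i<K. r i) \<le> int S * v (P l) + (\<Sum>i<l. r i)"
    and P0: "P 0 \<noteq> 0" "int S * v (P 0) = (\<Sum>i<K. r i)"
    using cyclic_vector[OF S_pos indep_mono[OF X_indep K2n] K_eig XK_stable[OF lin_base]] r_sorted K2n
    by (auto 4 0)
  obtain a where a: "\<And>i. i < K \<Longrightarrow> c - \<mu> i \<le> a i" "\<And>i. i < K \<Longrightarrow> a i \<le> \<mu> i"
    and aR: "\<And>l. l \<le> K \<Longrightarrow> (\<Sum>i<l. r i) \<le> int S * (\<Sum>i<l. a i)" "int S * (\<Sum>i<K. a i) = (\<Sum>i<K. r i)"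
    using lowered_cocharacter[of \<mu>, OF _ _ P0(2)] mu dom by auto
  obtain e where e: "indep e K" "\<And>i. i < K \<Longrightarrow> e i \<in> lin (\<lambda>l. (\<Phi> ^^ l) x) K"
    "lin (\<lambda>l. (\<Phi> ^^ l) x) K \<subseteq> lin e K"
    "\<And>i. i < K \<Longrightarrow> \<pi> powi (- a i) *s \<Phi> (e i) \<in> olin e K"
    "\<And>i. i < K \<Longrightarrow> e i \<in> olin (\<lambda>i. \<pi> powi (- a i) *s \<Phi> (e i)) K"
    using companion_basis[OF S_pos cyc, where r = r and a = a] Pb P0 aR by (auto 4 0)
  \<comment> \<open>\<open>g\<close> spans the same lattice as \<open>e\<close>. The integral matrix
    \<open>k\<close> below expresses \<open>e\<close> through \<open>g\<close>; by duality it also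
    describes \<open>\<Phi>\<close> on \<open>f\<close>.\<close>
  define g where "g i = \<pi> powi (- a i) *s \<Phi> (e i)" for i
  have Phie: "\<Phi> (e i) = \<pi> powi a i *s g i" for i by (simp add: g_def pi_powi_mult)
  have "lin (\<lambda>l. (\<Phi> ^^ l) x) K \<subseteq> lin X K"
    by (intro lin_subset subspace_lin Phin_stable XK_stable x)
  hence eX: "e i \<in> lin X K" if "i < K" for i using e(2)[OF that] by blast
  have Xe: "X i \<in> lin e K" if "i < K" for i using XZ e(3) that by blast
  have gX: "g i \<in> lin X K" if "i < K" for i
    unfolding g_def by (intro subspace_scale subspace_lin XK_stable eX that)
  have "\<forall>l. \<exists>k. l < K \<longrightarrow> e l = (\<Sum>i<K. k i *s g i) \<and> (\<forall>i<K. vge 0 (k i))"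
    using e(5) unfolding g_def[symmetric] olin_def by blast
  then obtain k where k: "\<And>l. l < K \<Longrightarrow> e l = (\<Sum>i<K. k l i *s g i)" "\<And>l i. l < K \<Longrightarrow> i < K \<Longrightarrow> vge 0 (k l i)"
    by metis
  \<comment> \<open>The last \<open>K\<close> eigenvectors, of slope below \<open>c/2\<close>, span
    \<open>V_-\<close>.\<close>
  let ?X = "\<lambda>t. X (2 * n - K + t)"
  have tN: "2 * n - K + t < 2 * n" if "t < K" for t using that K2n by simp
  have Xeig: "(\<Phi> ^^ S) (?X t) = \<pi> powi r (2 * n - K + t) *s ?X t" if "t < K" for t
    by (rule X_eig) (use tN that in simp)
  have Xsl: "2 * r (2 * n - K + t) < c * int S" if "t < K" for t using ge_K[OF tN[OF that]] by simp
  have minus_0: "B x z = 0" if "x \<in> lin ?X K" "(\<Phi> ^^ S) z = \<pi> powi \<rho> *s z" "2 * \<rho> \<le> c * int S" for x z \<rho>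
    by (rule B_lin_0[OF that(1)], rule B_eig[OF Xeig that(2)]) (use Xsl that(3) in \<open>auto dest: Xsl\<close>)
  have minus_test: "B w (X i) = 0" if "w \<in> lin ?X K" "i < 2 * n" "\<And>i. i < K \<Longrightarrow> B w (X i) = 0" for w i
  proof (cases "i < K")
    case False
    thus ?thesis using less_K[of i] that(2) by (intro minus_0[OF that(1) X_eig]) auto
  qed (rule that(3))
  have minus_lin: "w \<in> lin X (2 * n)" if "w \<in> lin ?X K" for w
    using that lin_subset[OF subspace_lin, of K ?X X "2 * n"] lin_base[OF tN] by blast
  have "\<exists>f. f \<in> lin ?X K \<and> (\<forall>j<K. B (e j) f = (if j = i then 1 else 0))" for i
  proof -
    \<comment> \<open>A vector of \<open>V_-\<close> orthogonal to all \<open>e j\<close> is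
      orthogonal to \<open>V_+\<close>, by slopes to everything else, and hence zero; so the dual
      basis exists.\<close>
    have "\<exists>C. \<forall>j\<in>{..<K}. (\<Sum>t\<in>{..<K}. C t * B (e j) (?X t)) = (if j = i then 1 else 0)"
    proof (rule square_system_solvable)
      fix C assume C: "\<And>j. j \<in> {..<K} \<Longrightarrow> (\<Sum>t<K. C t * B (e j) (?X t)) = 0"
      define w where "w = (\<Sum>t<K. C t *s ?X t)"
      have wl: "w \<in> lin ?X K" by (rule linI) (rule w_def)
      have we: "B (e j) w = 0" if "j < K" for j
        using C[of j] that by (simp add: w_def B_sum_right B_scale_right)
      have "w = 0"
      proof (rule nondeg[OF minus_lin[OF wl]])
        fix i assume "i < 2 * n"
        thus "B w (X i) = 0"
        proof (rule minus_test[OF wl])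
          fix i assume "i < K"
          have "B (X i) w = 0" by (rule B_lin_0[OF Xe[OF \<open>i < K\<close>] we])
          thus "B w (X i) = 0" using B_anti[of w] by simp
        qed
      qed
      define D where "D l = (if l < 2 * n - K then 0 else C (l - (2 * n - K)))" for l
      have "(\<Sum>l<2 * n - K + K. D l *s X l) = 0"
        unfolding sum_lessThan_add using \<open>w = 0\<close> by (simp add: w_def D_def)
      hence D0: "(\<Sum>l<2 * n. D l *s X l) = 0" using K2n by simp
      show "\<forall>t\<in>{..<K}. C t = 0"
      proof
        fix t assume "t \<in> {..<K}"
        hence "D (2 * n - K + t) = 0" by (intro indep_eq_0[OF X_indep D0] tN) simp
        thus "C t = 0" by (simp add: D_def)
      qed
    qed auto
    then obtain C where C: "\<And>j. j < K \<Longrightarrow> (\<Sum>t<K. C t * B (e j) (?X t)) = (if j = i then 1 else 0)" by auto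
    show ?thesis
      by (rule exI[of _ "\<Sum>t<K. C t *s ?X t"])
        (auto simp: B_sum_right B_scale_right C intro: linI)
  qed
  then obtain f where f: "\<And>i. f i \<in> lin ?X K" "\<And>i j. j < K \<Longrightarrow> B (e j) (f i) = (if j = i then 1 else 0)"
    by metis
  have ff: "B (f i) (f j) = 0" for i j
  proof -
    have "B (?X t) (f i) = 0" if "t < K" for t i
    proof -
      have "B (f i) (?X t) = 0" by (rule minus_0[OF f(1) Xeig[OF that]]) (use Xsl[OF that] in simp)
      thus ?thesis using B_anti[of "?X t"] by simp
    qed
    thus ?thesis by (intro B_lin_0[OF f(1)])
  qed
  have gf: "B (g m) (\<Phi> (f i)) = (if m = i then \<pi> powi (c - a i) else 0)" if "m < K" for m i
    using f(2)[OF that, of i] by (simp add: g_def B_scale B_Phi sig_simps pi_powi_mult)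
  have Phif: "\<Phi> (f i) = \<pi> powi (c - a i) *s (\<Sum>l<K. k l i *s f l)" if i: "i < K" for i
  proof -
    let ?w = "\<Sum>l<K. k l i *s f l"
    \<comment> \<open>The difference is tested against the eigenbasis: on \<open>V_+\<close> through
      the pairings with \<open>e j\<close>, elsewhere both terms vanish for slope reasons.\<close>
    let ?d = "\<Phi> (f i) - \<pi> powi (c - a i) *s ?w"
    have wl: "?w \<in> lin ?X K" by (intro subspace_sum subspace_lin subspace_scale f)
    have fl: "f i \<in> lin X (2 * n)" by (rule minus_lin[OF f(1)])
    have "?d = 0"
    proof (rule nondeg)
      show "?d \<in> lin X (2 * n)"
        by (intro subspace_diff subspace_lin subspace_scale X_stable fl minus_lin[OF wl])
      fix l assume l: "l < 2 * n"
      show "B ?d (X l) = 0"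
      proof (cases "l < K")
        case True
        have "B (e j) ?d = 0" if j: "j < K" for j
        proof -
          have "B (e j) (\<Phi> (f i)) = (\<Sum>m<K. k j m * B (g m) (\<Phi> (f i)))"
            unfolding k(1)[OF j] by (simp add: B_sum B_scale)
          also have "\<dots> = (\<Sum>m<K. if m = i then k j m * \<pi> powi (c - a i) else 0)"
            by (rule sum.cong) (auto simp: gf)
          also have "\<dots> = k j i * \<pi> powi (c - a i)" using i by simp
          finally have "B (e j) (\<Phi> (f i)) = k j i * \<pi> powi (c - a i)" .
          moreover have "B (e j) ?w = (\<Sum>l<K. if l = j then k l i else 0)"
            unfolding B_sum_right B_scale_right by (rule sum.cong) (auto simp: f(2)[OF j])
          hence "B (e j) ?w = k j i" using j by simp
          ultimately show ?thesis by (simp add: B_diff B_scale_right)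
        qed
        hence "B (X l) ?d = 0" by (rule B_lin_0[OF Xe[OF True]])
        thus ?thesis using B_anti[of ?d] by simp
      next
        case False
        hence sl: "2 * r l \<le> c * int S" using less_K[of l] l by auto
        have "B (\<Phi> (f i)) (X l) = 0"
        proof -
          obtain C where C: "f i = (\<Sum>t<K. C t *s ?X t)" using f(1) by (rule linE)
          have "B (\<Phi> (?X t)) (X l) = 0" if "t < K" for t
            by (rule B_eig[OF _ X_eig[OF l], where \<rho> = "r (2 * n - K + t)"])
              (use eigen_Phin[OF Xeig[OF that], of 1] Xsl[OF that] sl in auto)
          thus ?thesis unfolding C by (simp add: Phi_sum Phi_scale B_sum B_scale)
        qed
        moreover have "B ?w (X l) = 0" by (rule minus_0[OF wl X_eig[OF l] sl])
        ultimately show ?thesis by (simp add: B_diff B_scale)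
      qed
    qed
    thus ?thesis by simp
  qed
  \<comment> \<open>The weight \<open>\<pi>^(a i - \<mu> i)\<close> turns
    \<open>B (g i) (\<Phi> (f i)) = \<pi>^(c - a i)\<close> into the desired
    \<open>\<pi>^(c - \<mu> i)\<close>.\<close>
  obtain y where y: "\<And>u u'. y (u + u') = y u + y u'" "\<And>b u. y (b *s u) = b *s y u"
    "\<And>u. \<Phi> (y u) = y (\<Phi> u) + (\<Sum>i<K. (\<pi> powi (a i - \<mu> i) * B (g i) (\<Phi> u)) *s g i)"
    "\<And>u u'. B (y u) u' = B (y u') u" "\<And>u. y u \<in> lin X K"
    using unipotent_correction[of g "\<lambda>i. \<pi> powi (a i - \<mu> i)", OF gX] by (auto 4 0)
  have y0: "y 0 = 0" using y(2)[of 0 0] by simp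
  have ysum: "y (sum h A) = (\<Sum>i\<in>A. y (h i))" for h :: "nat \<Rightarrow> 'b" and A
    by (induction A rule: infinite_finite_induct) (auto simp: y y0)
  define F where "F i = f i + y (f i)" for i
  define E where "E i = e i - \<pi> powi (a i + \<mu> i - c) *s F i" for i
  have PhiF: "\<Phi> (F i) = \<pi> powi (c - a i) *s (\<Sum>l<K. k l i *s F l) + \<pi> powi (c - \<mu> i) *s g i" if i: "i < K" for i
  proof -
    have "(\<Sum>m<K. (\<pi> powi (a m - \<mu> m) * B (g m) (\<Phi> (f i))) *s g m) =
        (\<Sum>m<K. if m = i then \<pi> powi (c - \<mu> i) *s g i else 0)"
      by (rule sum.cong) (auto simp: gf pi_powi_mult)
    also have "\<dots> = \<pi> powi (c - \<mu> i) *s g i" using i by simp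
    finally have "\<Phi> (y (f i)) = y (\<Phi> (f i)) + \<pi> powi (c - \<mu> i) *s g i" unfolding y(3) by simp
    hence "\<Phi> (F i) = (\<Phi> (f i) + y (\<Phi> (f i))) + \<pi> powi (c - \<mu> i) *s g i" by (simp add: F_def Phi_add)
    also have "\<Phi> (f i) + y (\<Phi> (f i)) = \<pi> powi (c - a i) *s (\<Sum>l<K. k l i *s F l)"
      unfolding Phif[OF i] by (simp add: y ysum F_def scale_right_distrib sum.distrib)
    finally show ?thesis .
  qed
  have PhiE: "\<Phi> (E i) = - (\<pi> powi \<mu> i *s (\<Sum>l<K. k l i *s F l))" if i: "i < K" for i
  proof -
    have "\<Phi> (E i) = \<pi> powi a i *s g i - \<pi> powi (a i + \<mu> i - c) *s \<Phi> (F i)"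
      by (simp add: E_def Phi_diff Phi_scale Phie sig_simps)
    thus ?thesis unfolding PhiF[OF i] by (simp add: scale_right_distrib pi_powi_mult algebra_simps)
  qed
  have eF: "B (e i) (F j) = (if i = j then 1 else 0)" if "i < K" for i j
    using f(2)[OF that] plus_plus_0[OF eX[OF that] y(5)] by (simp add: F_def B_add_right)
  \<comment> \<open>The mixed terms cancel by the symmetry of \<open>B (y u) u'\<close>; this keeps
    the corrected family isotropic.\<close>
  have FF: "B (F i) (F j) = 0" for i j
  proof -
    have "B (F i) (F j) = B (f i) (y (f j)) + B (y (f i)) (f j)"
      using plus_plus_0[OF y(5) y(5)] by (simp add: F_def B_add B_add_right ff)
    also have "B (f i) (y (f j)) = - B (y (f j)) (f i)" by (rule B_anti)
    also have "B (y (f j)) (f i) = B (y (f i)) (f j)" by (rule y(4))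
    finally show ?thesis by simp
  qed
  have EF: "B (E i) (F j) = (if i = j then 1 else 0)" if "i < K" for i j
    using eF[OF that] by (simp add: E_def B_diff B_scale FF)
  have EE: "B (E i) (E j) = 0" if ij: "i < K" "j < K" for i j
  proof -
    have "B (F i) (e j) = - (if j = i then 1 else 0)" using B_anti[of "F i"] eF[OF ij(2)] by simp
    thus ?thesis using eF[OF ij(1)] plus_plus_0[OF eX[OF ij(1)] eX[OF ij(2)]]
      by (simp add: E_def B_diff B_scale B_scale_right FF)
  qed
  have mid: "B (E i) z = 0 \<and> B (F i) z = 0"
    if "i < K" "(\<Phi> ^^ S) z = \<pi> powi \<rho> *s z" "2 * \<rho> = c * int S" for i z \<rho>
  proof -
    have Fz: "B (F i) z = 0"
      using plus_B_0[OF y(5) that(2)] minus_0[OF f(1) that(2)] that(3) by (simp add: F_def B_add)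
    moreover have "B (e i) z = 0" using plus_B_0[OF eX that(2)] that by simp
    ultimately show ?thesis by (simp add: E_def B_diff B_scale)
  qed
  have lat: "\<pi> powi (- \<mu> i) *s \<Phi> (E i) \<in> M \<and> \<pi> powi (\<mu> i - c) *s \<Phi> (F i) \<in> M"
    if M: "olattice M" "\<forall>i<K. E i \<in> M \<and> F i \<in> M" and i: "i < K" for M i
  proof -
    have s: "(\<Sum>l<K. k l i *s F l) \<in> M"
      using M i by (intro olattice_sum olattice_scale k(2)) auto
    have "e l \<in> M" if l: "l < K" for l
    proof -
      have "E l + \<pi> powi (a l + \<mu> l - c) *s F l \<in> M"
        using M l a(1)[OF l] by (intro olattice_add olattice_scale) auto
      thus ?thesis by (simp add: E_def)
    qed
    hence "olin e K \<subseteq> M" by (intro olin_least M)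
    hence gM: "g i \<in> M" using e(4)[OF i] unfolding g_def by blast
    have "\<pi> powi (- \<mu> i) *s \<Phi> (E i) = - (\<Sum>l<K. k l i *s F l)"
      unfolding PhiE[OF i] by (simp add: pi_powi_mult)
    moreover have "\<pi> powi (\<mu> i - c) *s \<Phi> (F i) = \<pi> powi (\<mu> i - a i) *s (\<Sum>l<K. k l i *s F l) + g i"
      unfolding PhiF[OF i] by (simp add: scale_right_distrib pi_powi_mult)
    moreover have "\<pi> powi (\<mu> i - a i) *s (\<Sum>l<K. k l i *s F l) + g i \<in> M"
      using a(2)[OF i] by (intro olattice_add olattice_scale M s gM) simp
    ultimately show ?thesis using olattice_neg[OF M(1) s] by simp
  qed
  show ?thesis using EE FF EF mid lat by (intro exI[of _ E] exI[of _ F]) blast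
qed

end

section \<open>The part of slope half the similitude\<close>

context unram
begin

text \<open>Lang's theorem for a cyclic permutation matrix replaces the independence of characters.\<close>

lemma trace_coefficients:
  assumes "m \<ge> 1" "s \<ge> 1"
  shows "\<exists>a c. (\<forall>k<m. (\<sigma> ^^ (s * m)) (a k) = a k) \<and>
    (\<forall>j<m. (\<Sum>k<m. c k * (\<sigma> ^^ (s * j)) (a k)) = (if j = 0 then 1 else 0))"
proof -
  \<comment> \<open>Cyclic predecessor. A fixed vector of the permuted \<open>\<sigma>^s\<close> has
    the form \<open>(a, \<sigma>^s a, \<sigma>^(2s) a, ...)\<close> with
    \<open>\<sigma>^(s m) a = a\<close>, and independence of \<open>m\<close> of them makes the
    matrix \<open>\<sigma>^(s j) (a k)\<close> invertible.\<close>
  define pd where "pd i = (if i = 0 then m - 1 else i - 1)" for i :: nat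
  define U :: "nat \<Rightarrow> nat \<Rightarrow> 'a" where "U i j = (if j = pd i then 1 else 0)" for i j
  have pd: "pd i < m" if "i < m" for i using that by (auto simp: pd_def)
  have lop: "lop {..<m} U s x i = (\<sigma> ^^ s) (x (pd i))" if "i < m" for x i
    using pd[OF that] that
    by (simp add: lop_def U_def if_distrib[of "\<lambda>c. c * _"] cong: if_cong)
  have "\<exists>w. (\<forall>k\<in>{..<m}. \<forall>i\<in>{..<m}. lop {..<m} U s (w k) i = w k i) \<and>
    (\<forall>a. (\<forall>i\<in>{..<m}. (\<Sum>k\<in>{..<m}. a k * w k i) = 0) \<longrightarrow> (\<forall>k\<in>{..<m}. a k = 0))"
  proof (rule lang)
    show "vge 0 (U i j)" for i j by (simp add: U_def)
    fix x assume x: "\<And>i. i \<in> {..<m} \<Longrightarrow> vge 1 (lop {..<m} U s x i)"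
    show "\<forall>i\<in>{..<m}. vge 1 (x i)"
    proof
      fix i assume i: "i \<in> {..<m}"
      define i' where "i' = (if Suc i = m then 0 else Suc i)"
      have "i' < m" "pd i' = i" using i by (auto simp: i'_def pd_def)
      thus "vge 1 (x i)" using x[of i'] lop[of i' x] by simp
    qed
  qed (use assms in auto)
  then obtain w where w1: "\<forall>k\<in>{..<m}. \<forall>i\<in>{..<m}. lop {..<m} U s (w k) i = w k i"
    and w2: "\<forall>a. (\<forall>i\<in>{..<m}. (\<Sum>k\<in>{..<m}. a k * w k i) = 0) \<longrightarrow> (\<forall>k\<in>{..<m}. a k = 0)"
    by (elim exE conjE) (rule that)
  have w: "w k i = (\<sigma> ^^ s) (w k (pd i))" if "k < m" "i < m" for k i
    using w1 lop[of i "w k"] that by simp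
  have wi: "w k i = (\<sigma> ^^ (s * i)) (w k 0)" if "k < m" "i < m" for k i
    using that(2)
  proof (induction i)
    case (Suc i)
    have "w k (Suc i) = (\<sigma> ^^ s) (w k i)" using w[OF that(1) Suc.prems] by (simp add: pd_def)
    thus ?case using Suc by (simp add: funpow_add)
  qed simp
  have "(\<sigma> ^^ (s * m)) (w k 0) = w k 0" if "k < m" for k
  proof -
    have "w k 0 = (\<sigma> ^^ s) (w k (m - 1))" using w[OF that, of 0] that by (simp add: pd_def)
    also have "\<dots> = (\<sigma> ^^ (s + s * (m - 1))) (w k 0)" using wi[OF that, of "m - 1"] that by (simp add: funpow_add)
    also have "s + s * (m - 1) = s * m" using assms by (cases m) auto
    finally show ?thesis by simp
  qed
  moreover have "\<exists>c. \<forall>j\<in>{..<m}. (\<Sum>k\<in>{..<m}. c k * w k j) = (if j = 0 then 1 else 0)"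
  proof (rule square_system_solvable)
    fix c assume "\<And>i. i \<in> {..<m} \<Longrightarrow> (\<Sum>j<m. c j * w j i) = 0"
    hence "\<forall>i\<in>{..<m}. (\<Sum>j<m. c j * w j i) = 0" by (rule ballI)
    thus "\<forall>k\<in>{..<m}. c k = 0" by (rule mp[OF spec[OF w2, of c]])
  qed auto
  then obtain c where "\<And>j. j < m \<Longrightarrow> (\<Sum>k<m. c k * w k j) = (if j = 0 then 1 else 0)" by auto
  moreover have "(\<Sum>k<m. c k * (\<sigma> ^^ (s * j)) (w k 0)) = (\<Sum>k<m. c k * w k j)" if "j < m" for j
    by (rule sum.cong) (simp_all add: wi[OF _ that, symmetric])
  ultimately show ?thesis by (intro exI[of _ "\<lambda>k. w k 0"] exI[of _ c]) auto
qed

text \<open>A kernel element of \<open>1 + \<sigma>\<close>; it separates the two terms when the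
  skew-hermitian form is polarised.\<close>

lemma anti_invariant: "\<exists>\<theta>. \<theta> \<noteq> 0 \<and> \<sigma> \<theta> = - \<theta>"
proof -
  obtain a where "a \<noteq> 0" "ell (\<lambda>_. 1) 1 a = 0"
    using ell_kernel[of 1 "\<lambda>_. 1" 0 1] by auto
  thus ?thesis by (intro exI[of _ a]) (auto simp: ell_def add_eq_0_iff)
qed

end

context polarized
begin

text \<open>A vector space over the fixed field of \<open>\<sigma>^2\<close>, not over
  \<open>L\<close>: the descent of the part of slope \<open>c/2\<close> along
  \<open>\<pi>^(-c) \<Phi>^2\<close>.\<close>

definition mid :: "'b set" where
  "mid = {z \<in> lin X (2 * n). \<Phi> (\<Phi> z) = \<pi> powi c *s z}"

lemma mid_add: "x \<in> mid \<Longrightarrow> y \<in> mid \<Longrightarrow> x + y \<in> mid"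
  by (auto simp: mid_def Phi_add scale_right_distrib intro: subspace_add[OF subspace_lin])

lemma mid_scale: "\<sigma> (\<sigma> a) = a \<Longrightarrow> x \<in> mid \<Longrightarrow> a *s x \<in> mid"
  by (auto simp: mid_def Phi_scale mult.commute intro: subspace_scale[OF subspace_lin])

lemma mid_Phi: "x \<in> mid \<Longrightarrow> \<Phi> x \<in> mid"
  by (auto simp: mid_def Phi_scale sig_simps intro: X_stable)

lemma mid_B_fixed: "x \<in> mid \<Longrightarrow> y \<in> mid \<Longrightarrow> \<sigma> (\<sigma> (B x y)) = B x y"
proof -
  assume "x \<in> mid" "y \<in> mid"
  hence "\<pi> powi c * (\<pi> powi c * B x y) = B (\<Phi> (\<Phi> x)) (\<Phi> (\<Phi> y))"
    by (simp add: mid_def B_scale B_scale_right)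
  also have "\<dots> = \<pi> powi c * (\<pi> powi c * \<sigma> (\<sigma> (B x y)))" by (simp add: B_Phi sig_simps)
  finally show ?thesis by simp
qed

lemma mid_sum: "(\<And>i. i \<in> A \<Longrightarrow> f i \<in> mid) \<Longrightarrow> sum f A \<in> mid"
proof (induction A rule: infinite_finite_induct)
  case empty
  show ?case using subspace_0[OF subspace_lin] by (simp add: mid_def)
next
  case (infinite A)
  show ?case using infinite subspace_0[OF subspace_lin] by (simp add: mid_def)
qed (auto intro: mid_add)

lemma mid_eig:
  assumes "even S" "z \<in> mid"
  shows "(\<Phi> ^^ S) z = \<pi> powi (c * int (S div 2)) *s z" "2 * (c * int (S div 2)) = c * int S"
proof -
  have "(\<Phi> ^^ (2 * (S div 2))) z = \<pi> powi (c * int (S div 2)) *s z"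
    by (rule eigen_power) (use assms in \<open>simp add: mid_def numeral_2_eq_2\<close>)
  thus "(\<Phi> ^^ S) z = \<pi> powi (c * int (S div 2)) *s z" using assms by simp
  have "2 * int (S div 2) = int S" using assms by auto
  thus "2 * (c * int (S div 2)) = c * int S" by (metis mult.left_commute)
qed

text \<open>Galois descent: for \<open>\<sigma>^S a = a\<close> the sum over \<open>j < S/2\<close>
  of \<open>\<sigma>^(2j) (a) \<pi>^(-c j) \<Phi>^(2j) (X i)\<close> is invariant under
  \<open>\<pi>^(-c) \<Phi>^2\<close>, and \<open>trace_coefficients\<close> recovers
  \<open>X i\<close> from finitely many such sums.\<close>

lemma mid_span:
  assumes ev: "even S" and i: "K \<le> i" "i < 2 * n - K" and W: "subspace W" "mid \<subseteq> W"
  shows "X i \<in> W"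
proof -
  define m where "m = S div 2"
  have m: "S = 2 * m" "m \<ge> 1" using ev S_pos by (auto simp: m_def)
  have iN: "i < 2 * n" using i by simp
  have ri: "r i = c * int m" using mid_K[OF i] m by simp
  let ?x = "X i"
  obtain a d where a: "\<And>k. k < m \<Longrightarrow> (\<sigma> ^^ (2 * m)) (a k) = a k"
    and d: "\<And>j. j < m \<Longrightarrow> (\<Sum>k<m. d k * (\<sigma> ^^ (2 * j)) (a k)) = (if j = 0 then 1 else 0)"
    using trace_coefficients[OF m(2), of 2] by auto
  define T where "T k j = ((\<sigma> ^^ (2 * j)) (a k) * \<pi> powi (- (c * int j))) *s (\<Phi> ^^ (2 * j)) ?x" for k j
  define z where "z k = (\<Sum>j<m. T k j)" for k
  have "z k \<in> mid" if k: "k < m" for k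
  proof -
    have "\<Phi> (\<Phi> (T k j)) = \<pi> powi c *s T k (Suc j)" for j
    proof -
      have "\<pi> powi (- (c * int j)) = \<pi> powi c * \<pi> powi (- (c * int (Suc j)))"
        by (simp add: pi_powi_mult algebra_simps)
      thus ?thesis by (simp add: T_def Phi_scale sig_simps mult_ac del: of_nat_Suc)
    qed
    hence "\<Phi> (\<Phi> (z k)) = \<pi> powi c *s (\<Sum>j<m. T k (Suc j))"
      by (simp add: z_def Phi_sum scale_sum_right)
    also have "(\<Sum>j<m. T k (Suc j)) = z k + (T k m - T k 0)"
      using sum.lessThan_Suc_shift[of "T k" m] by (simp add: z_def algebra_simps)
    also have "T k m = T k 0"
      using X_eig[OF iN] a[OF k] m by (simp add: T_def ri pi_powi_mult mult.assoc)
    finally have "\<Phi> (\<Phi> (z k)) = \<pi> powi c *s z k" by simp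
    moreover have "z k \<in> lin X (2 * n)" unfolding z_def T_def
      by (intro subspace_sum subspace_lin subspace_scale Phin_stable X_stable lin_base iN)
    ultimately show ?thesis by (simp add: mid_def)
  qed
  hence "(\<Sum>k<m. d k *s z k) \<in> W" using W by (intro subspace_sum subspace_scale) auto
  also have "(\<Sum>k<m. d k *s z k) = (\<Sum>k<m. \<Sum>j<m. d k *s T k j)" by (simp add: z_def scale_sum_right)
  also have "\<dots> = (\<Sum>j<m. \<Sum>k<m. d k *s T k j)" by (rule sum.swap)
  also have "\<dots> = (\<Sum>j<m. ((\<Sum>k<m. d k * (\<sigma> ^^ (2 * j)) (a k)) * \<pi> powi (- (c * int j))) *s (\<Phi> ^^ (2 * j)) ?x)"
    by (simp add: T_def sum_distrib_right scale_sum_left mult.assoc)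
  also have "\<dots> = (\<Sum>j<m. if j = 0 then ?x else 0)" by (rule sum.cong) (auto simp: d)
  also have "\<dots> = ?x" using m by simp
  finally show ?thesis .
qed

text \<open>Elements of \<open>mid\<close> are orthogonal to all slopes other than
  \<open>c/2\<close>, and \<open>mid\<close> itself spans the part of slope
  \<open>c/2\<close>.\<close>

lemma mid_nondeg:
  assumes ev: "even S" and x: "x \<in> mid" and y: "\<And>y. y \<in> mid \<Longrightarrow> B x y = 0"
  shows "x = 0"
proof (rule nondeg)
  show "x \<in> lin X (2 * n)" using x by (simp add: mid_def)
  fix i assume i: "i < 2 * n"
  show "B x (X i) = 0"
  proof (cases "K \<le> i \<and> i < 2 * n - K")
    case True
    have "subspace {y. B x y = 0}" by (rule subspaceI) (auto simp: B_add_right B_scale_right)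
    moreover have "mid \<subseteq> {y. B x y = 0}" using y by auto
    ultimately show ?thesis using mid_span[OF ev] True by blast
  next
    case False
    hence "c * int S \<noteq> 2 * r i" using less_K[of i] ge_K[OF i] i by auto
    hence "c * int (S div 2) + r i \<noteq> c * int S" using mid_eig(2)[OF ev x] by linarith
    thus ?thesis by (rule B_eig[OF mid_eig(1)[OF ev x] X_eig[OF i]])
  qed
qed

text \<open>A plane can be rescaled to a prescribed entry of \<open>\<mu>\<close> only if the
  valuation of \<open>B u (\<Phi> u)\<close> has the parity of that entry. For odd \<open>c\<close>,
  replacing \<open>u\<close> by \<open>\<Phi> u\<close> adds \<open>c\<close>. For even
  \<open>c\<close>, passing to \<open>\<alpha> u + \<beta> \<Phi> u\<close> multiplies the value by
  \<open>\<alpha>^2 - \<beta>^2 \<pi>^c\<close>, which is made equal to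
  \<open>\<pi>\<close>.\<close>

lemma parity_change:
  assumes C: "\<And>x y. x \<in> C \<Longrightarrow> y \<in> C \<Longrightarrow> x + y \<in> C" "\<And>a x. \<sigma> (\<sigma> a) = a \<Longrightarrow> x \<in> C \<Longrightarrow> a *s x \<in> C"
      "\<And>x. x \<in> C \<Longrightarrow> \<Phi> x \<in> C" "C \<subseteq> mid"
    and u: "u \<in> C" "B u (\<Phi> u) \<noteq> 0"
  shows "\<exists>u'\<in>C. B u' (\<Phi> u') \<noteq> 0 \<and> even (v (B u' (\<Phi> u')) + \<epsilon>)"
proof (cases "even (v (B u (\<Phi> u)) + \<epsilon>)")
  case True
  thus ?thesis using u by blast
next
  case odd: False
  let ?h = "B u (\<Phi> u)"
  have uu: "\<Phi> (\<Phi> u) = \<pi> powi c *s u" using u C(4) by (auto simp: mid_def)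
  have anti: "B (\<Phi> u) u = - ?h" by (rule B_anti)
  show ?thesis
  proof (cases "even c")
    case False
    have h: "B (\<Phi> u) (\<Phi> (\<Phi> u)) = - (\<pi> powi c * ?h)" by (simp add: uu B_scale_right anti)
    have "v (B (\<Phi> u) (\<Phi> (\<Phi> u))) = c + v ?h" unfolding h using u(2) by (simp add: v_mult)
    thus ?thesis using False odd u C(3) h by (intro bexI[of _ "\<Phi> u"]) auto
  next
    case True
    then obtain c' where c': "c = c' + c'" by (auto elim!: evenE)
    have s2: "\<sigma> 2 = 2" using sig_add[of 1 1] by (simp add: sig_1)
    \<comment> \<open>From \<open>((\<pi> + 1)/2)^2 - ((\<pi> - 1)/2)^2 = \<pi>\<close>; the factor
      \<open>\<pi>^(-c')\<close> absorbs \<open>\<pi>^c\<close>.\<close>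
    define \<alpha> \<beta> where "\<alpha> = (\<pi> + 1) / 2" and "\<beta> = \<pi> powi (- c') * ((\<pi> - 1) / 2)"
    have fx: "\<sigma> \<alpha> = \<alpha>" "\<sigma> \<beta> = \<beta>" by (auto simp: \<alpha>_def \<beta>_def sig_simps s2)
    let ?u = "\<alpha> *s u + \<beta> *s \<Phi> u"
    have "\<Phi> ?u = \<alpha> *s \<Phi> u + (\<beta> * \<pi> powi c) *s u" by (simp add: Phi_add Phi_scale fx uu)
    hence "B ?u (\<Phi> ?u) = (\<alpha> * \<alpha> - \<beta> * \<beta> * \<pi> powi c) * ?h"
      by (simp add: B_add B_add_right B_scale B_scale_right anti algebra_simps)
    also have "\<beta> * \<beta> * \<pi> powi c = ((\<pi> - 1) / 2) * ((\<pi> - 1) / 2)"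
    proof -
      have "\<beta> * \<beta> * \<pi> powi c = (\<pi> powi (- c') * \<pi> powi (- c') * \<pi> powi c) * (((\<pi> - 1) / 2) * ((\<pi> - 1) / 2))"
        unfolding \<beta>_def by (simp only: mult_ac)
      also have "\<pi> powi (- c') * \<pi> powi (- c') * \<pi> powi c = 1" unfolding pi_powi_mult c' by simp
      finally show ?thesis by (simp only: mult_1)
    qed
    also have "\<alpha> * \<alpha> - ((\<pi> - 1) / 2) * ((\<pi> - 1) / 2) = \<pi>"
      unfolding \<alpha>_def by (simp add: field_simps)
    finally have h: "B ?u (\<Phi> ?u) = \<pi> * ?h" .
    have "v (B ?u (\<Phi> ?u)) = 1 + v ?h" unfolding h using u(2) by (simp add: v_mult)
    moreover have "?u \<in> C" using u fx by (intro C) auto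
    ultimately show ?thesis using odd u(2) h by (intro bexI[of _ ?u]) auto
  qed
qed

text \<open>Orthogonalisation for the form \<open>B x (\<Phi> y)\<close>: the complement
  \<open>C\<close> of the planes found so far is nonzero by dimension, so it contains some
  \<open>x\<close> and \<open>y\<close> with \<open>B x (\<Phi> y) \<noteq> 0\<close>; polarisation
  then yields \<open>u\<close> in \<open>C\<close> with \<open>B u (\<Phi> u) \<noteq> 0\<close>,
  and its parity is adjusted.\<close>

lemma middle_part:
  assumes ev: "even S"
  shows "m \<le> n - K \<Longrightarrow> \<exists>z. (\<forall>i<m. z i \<in> mid \<and> B (z i) (\<Phi> (z i)) \<noteq> 0 \<and> even (v (B (z i) (\<Phi> (z i))) + \<epsilon> i)) \<and>
    (\<forall>i<m. \<forall>j<m. i \<noteq> j \<longrightarrow> B (z i) (z j) = 0 \<and> B (z i) (\<Phi> (z j)) = 0)"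
proof (induction m)
  case 0
  thus ?case by simp
next
  case (Suc m)
  then obtain z where z: "\<And>i. i < m \<Longrightarrow> z i \<in> mid" "\<And>i. i < m \<Longrightarrow> B (z i) (\<Phi> (z i)) \<noteq> 0"
      "\<And>i. i < m \<Longrightarrow> even (v (B (z i) (\<Phi> (z i))) + \<epsilon> i)"
    and orth: "\<And>i j. i < m \<Longrightarrow> j < m \<Longrightarrow> i \<noteq> j \<Longrightarrow> B (z i) (z j) = 0"
      "\<And>i j. i < m \<Longrightarrow> j < m \<Longrightarrow> i \<noteq> j \<Longrightarrow> B (z i) (\<Phi> (z j)) = 0"
    by (auto 4 0)
  define h where "h i = B (z i) (\<Phi> (z i))" for i
  have hn: "h i \<noteq> 0" if "i < m" for i using z(2)[OF that] by (simp add: h_def)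
  have zz: "B (z i) (z j) = 0" if "i < m" "j < m" for i j using orth(1)[OF that] by (cases "i = j") auto
  have zP: "B (z i) (\<Phi> (z j)) = (if i = j then h j else 0)" if "i < m" "j < m" for i j
    using orth(2)[OF that] by (auto simp: h_def)
  have Pz: "B (\<Phi> (z i)) (z j) = (if i = j then - h j else 0)" if "i < m" "j < m" for i j
    using zP[OF that(2,1)] B_anti[of "\<Phi> (z i)"] by auto
  have PP: "B (\<Phi> (z i)) (\<Phi> (z j)) = 0" if "i < m" "j < m" for i j
    using zz[OF that] by (simp add: B_Phi sig_simps)
  have zPP: "\<Phi> (\<Phi> (z i)) = \<pi> powi c *s z i" if "i < m" for i using z(1)[OF that] by (simp add: mid_def)
  define C where "C = {u \<in> mid. \<forall>j<m. B u (z j) = 0 \<and> B u (\<Phi> (z j)) = 0}"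
  have C_add: "x + y \<in> C" if "x \<in> C" "y \<in> C" for x y
    using that by (auto simp: C_def B_add intro: mid_add)
  have C_scale: "a *s x \<in> C" if "\<sigma> (\<sigma> a) = a" "x \<in> C" for a x
    using that by (auto simp: C_def B_scale intro: mid_scale)
  have C_Phi: "\<Phi> x \<in> C" if x: "x \<in> C" for x
  proof -
    have "B (\<Phi> x) (z j) = 0" if j: "j < m" for j
    proof -
      have "B (\<Phi> x) (\<Phi> (\<Phi> (z j))) = 0" using x j by (simp add: C_def B_Phi sig_simps)
      thus ?thesis by (simp add: zPP[OF j] B_scale_right)
    qed
    thus ?thesis using x by (auto simp: C_def B_Phi sig_simps intro: mid_Phi)
  qed
  have C_mid: "C \<subseteq> mid" by (auto simp: C_def)
  \<comment> \<open>Orthogonal projection of \<open>mid\<close> to \<open>C\<close>; the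
    coefficients come from \<open>B (z i) (\<Phi> (z i)) = h i\<close> and
    \<open>B (\<Phi> (z i)) (z i) = - h i\<close>.\<close>
  define pr where "pr x = x + (\<Sum>i<m. (- (B x (\<Phi> (z i)) / h i)) *s z i + (B x (z i) / h i) *s \<Phi> (z i))" for x
  have prC: "pr x \<in> C" if x: "x \<in> mid" for x
  proof -
    have hf: "\<sigma> (\<sigma> (h i)) = h i" if "i < m" for i
      unfolding h_def by (intro mid_B_fixed mid_Phi z that)
    have "pr x \<in> mid" unfolding pr_def
      using mid_B_fixed[OF x mid_Phi[OF z(1)]] mid_B_fixed[OF x z(1)] hf
      by (intro mid_add mid_sum mid_scale x z mid_Phi) (auto simp: sig_simps)
    moreover have "B (pr x) (z j) = 0" if j: "j < m" for j
    proof -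
      have "B (pr x) (z j) = B x (z j) + (\<Sum>i<m. if i = j then - B x (z j) else 0)"
        unfolding pr_def B_add B_sum B_scale
        by (intro arg_cong2[of _ _ _ _ "(+)"] sum.cong refl) (use j hn in \<open>auto simp: zz Pz\<close>)
      thus ?thesis using j by simp
    qed
    moreover have "B (pr x) (\<Phi> (z j)) = 0" if j: "j < m" for j
    proof -
      have "B (pr x) (\<Phi> (z j)) = B x (\<Phi> (z j)) + (\<Sum>i<m. if i = j then - B x (\<Phi> (z j)) else 0)"
        unfolding pr_def B_add B_sum B_scale
        by (intro arg_cong2[of _ _ _ _ "(+)"] sum.cong refl) (use j hn in \<open>auto simp: zP PP\<close>)
      thus ?thesis using j by simp
    qed
    ultimately show ?thesis by (simp add: C_def)
  qed
  have "\<exists>x\<in>mid. pr x \<noteq> 0"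
  proof (rule ccontr)
    assume neg: "\<not> ?thesis"
    \<comment> \<open>If the projection vanished, the \<open>2 m\<close> vectors \<open>z i\<close>
      and \<open>\<Phi> (z i)\<close>, interleaved here, would span a space containing the
      \<open>2 (n - K)\<close> eigenvectors of slope \<open>c/2\<close>.\<close>
    define Uf where "Uf l = (if even l then z (l div 2) else \<Phi> (z (l div 2)))" for l :: nat
    have U1: "z i \<in> lin Uf (2 * m)" "\<Phi> (z i) \<in> lin Uf (2 * m)" if "i < m" for i
      using lin_base[of "2 * i" "2 * m" Uf] lin_base[of "2 * i + 1" "2 * m" Uf] that by (auto simp: Uf_def)
    have "mid \<subseteq> lin Uf (2 * m)"
    proof
      fix x assume "x \<in> mid"
      hence "pr x = 0" using neg by blast
      hence "x = - (\<Sum>i<m. (- (B x (\<Phi> (z i)) / h i)) *s z i + (B x (z i) / h i) *s \<Phi> (z i))"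
        unfolding pr_def by (simp only: eq_neg_iff_add_eq_0)
      also have "\<dots> \<in> lin Uf (2 * m)"
        by (intro subspace_neg subspace_sum subspace_add subspace_scale subspace_lin U1) auto
      finally show "x \<in> lin Uf (2 * m)" .
    qed
    hence XU: "X i \<in> lin Uf (2 * m)" if "K \<le> i" "i < 2 * n - K" for i
      by (intro mid_span[OF ev that subspace_lin])
    have "2 * n - K - K \<le> 2 * m"
    proof (rule indep_card_le)
      show "indep (\<lambda>t. X (K + t)) (2 * n - K - K)" unfolding indep_def
      proof (intro allI impI)
        fix d t assume d: "(\<Sum>t<2 * n - K - K. d t *s X (K + t)) = 0" and t: "t < 2 * n - K - K"
        define D where "D l = (if l < K then 0 else d (l - K))" for l
        have "(\<Sum>l<K + (2 * n - K - K). D l *s X l) = 0"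
          unfolding sum_lessThan_add using d by (simp add: D_def)
        hence "D (K + t) = 0"
          using indep_eq_0[OF indep_mono[OF X_indep, of "K + (2 * n - K - K)"], of D "K + t"] t K_le
          by auto
        thus "d t = 0" by (simp add: D_def)
      qed
      show "X (K + t) \<in> lin Uf (2 * m)" if "t < 2 * n - K - K" for t using XU[of "K + t"] that by simp
    qed
    thus False using Suc.prems K_le by simp
  qed
  then obtain x0 where x0: "x0 \<in> mid" "pr x0 \<noteq> 0" by blast
  define x where "x = pr x0"
  have x: "x \<in> C" "x \<noteq> 0" using x0 prC by (auto simp: x_def)
  obtain y0 where y0: "y0 \<in> mid" "B x y0 \<noteq> 0" using mid_nondeg[OF ev, of x] x C_mid by blast
  \<comment> \<open>On \<open>mid\<close> the map \<open>\<pi>^(-c) \<Phi>\<close> inverts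
    \<open>\<Phi>\<close>, so \<open>\<Phi> y\<close> is the projection of
    \<open>y0\<close>.\<close>
  define y where "y = \<pi> powi (- c) *s \<Phi> (pr y0)"
  have yC: "y \<in> C" unfolding y_def by (intro C_scale C_Phi prC y0) (simp add: sig_simps)
  have Phiy: "\<Phi> y = pr y0"
    using prC[OF y0(1)] C_mid by (auto simp: y_def Phi_scale sig_simps mid_def pi_powi_mult)
  have xy: "B x (\<Phi> y) \<noteq> 0"
  proof -
    have "B x (pr y0) = B x y0" using x by (simp add: pr_def B_add_right B_diff B_sum_right B_scale_right C_def)
    thus ?thesis using y0 by (simp add: Phiy)
  qed
  \<comment> \<open>Otherwise \<open>x + y\<close> and \<open>x + \<theta> y\<close> would give
    \<open>B y (\<Phi> x) = - B x (\<Phi> y)\<close> and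
    \<open>B y (\<Phi> x) = B x (\<Phi> y)\<close>, forcing
    \<open>B x (\<Phi> y) = 0\<close>.\<close>
  have "\<exists>u\<in>C. B u (\<Phi> u) \<noteq> 0"
  proof (rule ccontr)
    assume neg: "\<not> ?thesis"
    obtain \<theta> where th: "\<theta> \<noteq> 0" "\<sigma> \<theta> = - \<theta>" using anti_invariant by blast
    have exp: "B (x + a *s y) (\<Phi> (x + a *s y)) = \<sigma> a * B x (\<Phi> y) + a * B y (\<Phi> x)" for a
      using neg x(1) yC by (simp add: Phi_add Phi_scale B_add B_add_right B_scale B_scale_right)
    have "x + 1 *s y \<in> C" by (intro C_add C_scale x yC) (simp add: sig_simps)
    hence "B x (\<Phi> y) + B y (\<Phi> x) = 0" using neg exp[of 1] by (simp add: sig_simps)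
    hence yx: "B y (\<Phi> x) = - B x (\<Phi> y)" by (simp add: add_eq_0_iff)
    have "x + \<theta> *s y \<in> C" by (intro C_add C_scale x yC) (simp add: th sig_simps)
    hence "\<sigma> \<theta> * B x (\<Phi> y) + \<theta> * B y (\<Phi> x) = 0" using neg exp[of \<theta>] by simp
    thus False using th xy unfolding yx by simp
  qed
  then obtain u0 where u0: "u0 \<in> C" "B u0 (\<Phi> u0) \<noteq> 0" by blast
  obtain u where u: "u \<in> C" "B u (\<Phi> u) \<noteq> 0" "even (v (B u (\<Phi> u)) + \<epsilon> m)"
    using parity_change[of C u0 "\<epsilon> m", OF C_add C_scale C_Phi C_mid u0] by blast
  define z' where "z' = z(m := u)"
  have uz: "B u (z j) = 0" "B u (\<Phi> (z j)) = 0" if "j < m" for j using u(1) that by (auto simp: C_def)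
  have zu: "B (z j) u = 0" "B (z j) (\<Phi> u) = 0" if "j < m" for j
  proof -
    show "B (z j) u = 0" using uz(1)[OF that] B_anti[of "z j"] by simp
    have "B (\<Phi> u) (z j) = 0" using C_Phi[OF u(1)] that by (simp add: C_def)
    thus "B (z j) (\<Phi> u) = 0" using B_anti[of "z j"] by simp
  qed
  have "z' i \<in> mid \<and> B (z' i) (\<Phi> (z' i)) \<noteq> 0 \<and> even (v (B (z' i) (\<Phi> (z' i))) + \<epsilon> i)" if "i < Suc m" for i
    using that z u C_mid by (cases "i = m") (auto simp: z'_def)
  moreover have "B (z' i) (z' j) = 0 \<and> B (z' i) (\<Phi> (z' j)) = 0" if "i < Suc m" "j < Suc m" "i \<noteq> j" for i j
    using that uz zu orth by (cases "i = m"; cases "j = m") (auto simp: z'_def)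
  ultimately show ?case by blast
qed


text \<open>The hyperbolic pairs realise the first \<open>K\<close> entries of \<open>\<mu>\<close>
  with their duals, the planes of slope \<open>c/2\<close> the entries \<open>K, ..., n - 1\<close>
  with theirs. That \<open>d = c\<close> follows by comparing the total of \<open>\<mu>\<close>,
  which is \<open>n d\<close>, with the total slope \<open>n c\<close>.\<close>

lemma symplectic_lattice:
  fixes \<mu> :: "nat \<Rightarrow> int"
  assumes ev: "even S" and n: "n \<ge> 1"
    and sym: "\<And>i. i < 2 * n \<Longrightarrow> \<mu> i + \<mu> (2 * n - 1 - i) = d"
    and srt: "\<And>i j. i \<le> j \<Longrightarrow> j < 2 * n \<Longrightarrow> \<mu> j \<le> \<mu> i"
    and dom: "\<And>l. l \<le> 2 * n \<Longrightarrow> (\<Sum>i<l. r i) \<le> int S * (\<Sum>i<l. \<mu> i)"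
    and tot: "(\<Sum>i<2 * n. r i) = int S * (\<Sum>i<2 * n. \<mu> i)"
  shows "d = c" "\<exists>G. (\<forall>i<2 * n. \<forall>j<2 * n. B (G i) (G j) =
      (if j = 2 * n - 1 - i then (if i < n then 1 else - 1) else 0)) \<and>
    (\<forall>i<2 * n. \<pi> powi (- \<mu> i) *s \<Phi> (G i) \<in> olin G (2 * n))"
proof -
  show dc: "d = c"
  proof -
    have "(\<Sum>i<2 * n. \<mu> (2 * n - 1 - i)) = (\<Sum>i<2 * n. \<mu> i)"
      using sum.nat_diff_reindex[of \<mu> "2 * n"] by simp
    moreover have "(\<Sum>i<2 * n. \<mu> i + \<mu> (2 * n - 1 - i)) = (\<Sum>i<2 * n. d)" using sym by simp
    ultimately have "(\<Sum>i<2 * n. \<mu> i) = int n * d" by (simp add: sum.distrib)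
    hence "int S * (int n * d) = int S * (int n * c)" using tot sum_slopes by (simp add: mult_ac)
    thus ?thesis using S_pos n by simp
  qed
  have half: "c \<le> 2 * \<mu> i" if "i < n" for i
  proof -
    have "\<mu> (2 * n - 1 - i) \<le> \<mu> i" by (rule srt) (use that in auto)
    moreover have "\<mu> i + \<mu> (2 * n - 1 - i) = c" using sym[of i] that dc by simp
    ultimately show ?thesis by linarith
  qed
  have Kn: "K \<le> n" using K_le by simp
  obtain E0 F0 where hyp: "\<And>i j. i < K \<Longrightarrow> j < K \<Longrightarrow> B (E0 i) (E0 j) = 0"
      "\<And>i j. i < K \<Longrightarrow> j < K \<Longrightarrow> B (F0 i) (F0 j) = 0"
      "\<And>i j. i < K \<Longrightarrow> j < K \<Longrightarrow> B (E0 i) (F0 j) = (if i = j then 1 else 0)"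
    and mid0: "\<And>i z \<rho>. i < K \<Longrightarrow> (\<Phi> ^^ S) z = \<pi> powi \<rho> *s z \<Longrightarrow> 2 * \<rho> = c * int S \<Longrightarrow> B (E0 i) z = 0"
      "\<And>i z \<rho>. i < K \<Longrightarrow> (\<Phi> ^^ S) z = \<pi> powi \<rho> *s z \<Longrightarrow> 2 * \<rho> = c * int S \<Longrightarrow> B (F0 i) z = 0"
    and lat: "\<And>M i. olattice M \<Longrightarrow> (\<And>i. i < K \<Longrightarrow> E0 i \<in> M) \<Longrightarrow> (\<And>i. i < K \<Longrightarrow> F0 i \<in> M) \<Longrightarrow> i < K \<Longrightarrow>
        \<pi> powi (- \<mu> i) *s \<Phi> (E0 i) \<in> M"
      "\<And>M i. olattice M \<Longrightarrow> (\<And>i. i < K \<Longrightarrow> E0 i \<in> M) \<Longrightarrow> (\<And>i. i < K \<Longrightarrow> F0 i \<in> M) \<Longrightarrow> i < K \<Longrightarrow>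
        \<pi> powi (\<mu> i - c) *s \<Phi> (F0 i) \<in> M"
  proof -
    have A1: "\<forall>i<K. c \<le> 2 * \<mu> i" using half Kn by simp
    have A2: "\<forall>l\<le>K. (\<Sum>i<l. r i) \<le> int S * (\<Sum>i<l. \<mu> i)" using dom Kn by simp
    obtain E F where H: "\<forall>i<K. \<forall>j<K. B (E i) (E j) = 0 \<and> B (F i) (F j) = 0 \<and> B (E i) (F j) = (if i = j then 1 else 0)"
      "\<forall>i<K. \<forall>z \<rho>. (\<Phi> ^^ S) z = \<pi> powi \<rho> *s z \<longrightarrow> 2 * \<rho> = c * int S \<longrightarrow> B (E i) z = 0 \<and> B (F i) z = 0"
      "\<forall>M. olattice M \<longrightarrow> (\<forall>i<K. E i \<in> M \<and> F i \<in> M) \<longrightarrow>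
        (\<forall>i<K. \<pi> powi (- \<mu> i) *s \<Phi> (E i) \<in> M \<and> \<pi> powi (\<mu> i - c) *s \<Phi> (F i) \<in> M)"
      using hyperbolic_part[OF A1 A2] by (elim exE conjE) (rule that)
    show ?thesis by (rule that[of E F]) (use H in blast)+
  qed
  obtain z where z: "\<And>i. i < n - K \<Longrightarrow> z i \<in> mid" "\<And>i. i < n - K \<Longrightarrow> B (z i) (\<Phi> (z i)) \<noteq> 0"
      "\<And>i. i < n - K \<Longrightarrow> even (v (B (z i) (\<Phi> (z i))) + \<mu> (K + i))"
    and orth: "\<And>i j. i < n - K \<Longrightarrow> j < n - K \<Longrightarrow> i \<noteq> j \<Longrightarrow> B (z i) (z j) = 0"
      "\<And>i j. i < n - K \<Longrightarrow> j < n - K \<Longrightarrow> i \<noteq> j \<Longrightarrow> B (z i) (\<Phi> (z j)) = 0"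
    using middle_part[OF ev order_refl, of "\<lambda>i. \<mu> (K + i)"] by (auto 4 0)
  define h where "h t = B (z t) (\<Phi> (z t))" for t
  \<comment> \<open>By the parity condition \<open>2 l + \<mu> + v h = 0\<close>, so
    \<open>w\<close> is a unit. Then \<open>E = \<pi>^(l + \<mu>) z\<close> and
    \<open>F = \<pi>^l w^(-1) \<Phi> z\<close> pair to 1, and
    \<open>\<Phi> E = \<pi>^\<mu> w F\<close>.\<close>
  define l where "l t = - ((v (h t) + \<mu> (K + t)) div 2)" for t
  define w where "w t = \<pi> powi (2 * l t + \<mu> (K + t)) * h t" for t
  have w: "w t \<noteq> 0" "v (w t) = 0" if "t < n - K" for t
  proof -
    have "2 * ((v (h t) + \<mu> (K + t)) div 2) = v (h t) + \<mu> (K + t)"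
      using z(3)[OF that] by (simp add: h_def)
    thus "w t \<noteq> 0" "v (w t) = 0" using z(2)[OF that] by (auto simp: w_def l_def h_def v_mult)
  qed
  define E where "E i = (if i < K then E0 i else \<pi> powi (l (i - K) + \<mu> i) *s z (i - K))" for i
  define F where "F i = (if i < K then F0 i else (\<pi> powi l (i - K) / w (i - K)) *s \<Phi> (z (i - K)))" for i
  have m0: "B (E0 i) (z t) = 0" "B (F0 i) (z t) = 0" "B (E0 i) (\<Phi> (z t)) = 0" "B (F0 i) (\<Phi> (z t)) = 0"
    "B (z t) (E0 i) = 0" "B (z t) (F0 i) = 0" "B (\<Phi> (z t)) (E0 i) = 0" "B (\<Phi> (z t)) (F0 i) = 0"
    if "i < K" "t < n - K" for i t
  proof -
    note zt = mid_eig[OF ev z(1)[OF that(2)]] mid_eig[OF ev mid_Phi[OF z(1)[OF that(2)]]]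
    show a: "B (E0 i) (z t) = 0" "B (F0 i) (z t) = 0" "B (E0 i) (\<Phi> (z t)) = 0" "B (F0 i) (\<Phi> (z t)) = 0"
      using mid0(1)[OF that(1) zt(1,2)] mid0(2)[OF that(1) zt(1,2)] mid0(1)[OF that(1) zt(3,4)]
        mid0(2)[OF that(1) zt(3,4)] by auto
    show "B (z t) (E0 i) = 0" "B (z t) (F0 i) = 0" "B (\<Phi> (z t)) (E0 i) = 0" "B (\<Phi> (z t)) (F0 i) = 0"
      using a B_anti[of "z t"] B_anti[of "\<Phi> (z t)"] by auto
  qed
  have zz: "B (z s) (z t) = 0" if "s < n - K" "t < n - K" for s t using orth(1)[OF that] by (cases "s = t") auto
  have EE: "B (E i) (E j) = 0" if "i < n" "j < n" for i j
    using that hyp(1) zz m0 by (auto simp: E_def B_scale B_scale_right)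
  have FF: "B (F i) (F j) = 0" if "i < n" "j < n" for i j
    using that hyp(2) zz m0 by (auto simp: F_def B_scale B_scale_right B_Phi sig_simps)
  have EF: "B (E i) (F j) = (if i = j then 1 else 0)" if ij: "i < n" "j < n" for i j
  proof (cases "i < K \<or> j < K")
    case True
    thus ?thesis using ij hyp(3) m0 by (auto simp: E_def F_def B_scale B_scale_right)
  next
    case False
    define s t where "s = i - K" and "t = j - K"
    have st: "s < n - K" "t < n - K" "i = K + s" "j = K + t" using False ij by (auto simp: s_def t_def)
    show ?thesis
    proof (cases "s = t")
      case True
      have "B (E i) (F j) = (\<pi> powi (l t + \<mu> (K + t)) * \<pi> powi l t) * h t / w t"
        using st True by (simp add: E_def F_def B_scale B_scale_right h_def)
      also have "\<pi> powi (l t + \<mu> (K + t)) * \<pi> powi l t = \<pi> powi (2 * l t + \<mu> (K + t))"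
        unfolding pi_powi_mult by (simp add: algebra_simps)
      finally show ?thesis using w(1)[OF st(2)] True st by (simp add: w_def[symmetric])
    next
      case False
      thus ?thesis using st orth(2)[OF st(1,2)] by (simp add: E_def F_def B_scale B_scale_right)
    qed
  qed
  \<comment> \<open>The reversed order of the dual vectors matches the antidiagonal form and gives
    \<open>F i\<close> the entry \<open>\<mu> (2n - 1 - i) = c - \<mu> i\<close>.\<close>
  define G where "G i = (if i < n then E i else F (2 * n - 1 - i))" for i
  have FE: "B (F j) (E i) = - (if i = j then 1 else 0)" if "i < n" "j < n" for i j
    using EF[OF that] B_anti[of "F j"] by simp
  have BG: "B (G i) (G j) = (if j = 2 * n - 1 - i then (if i < n then 1 else - 1) else 0)"
    if "i < 2 * n" "j < 2 * n" for i j
  proof -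
    consider "i < n" "j < n" | "i < n" "\<not> j < n" | "\<not> i < n" "j < n" | "\<not> i < n" "\<not> j < n" by blast
    thus ?thesis
    proof cases
      case 1
      thus ?thesis using EE by (auto simp: G_def)
    next
      case 2
      hence "2 * n - 1 - j < n" "i = 2 * n - 1 - j \<longleftrightarrow> j = 2 * n - 1 - i" using that by auto
      thus ?thesis using 2 EF[of i "2 * n - 1 - j"] by (simp add: G_def)
    next
      case 3
      hence "2 * n - 1 - i < n" using that by auto
      thus ?thesis using 3 FE[of j "2 * n - 1 - i"] by (simp add: G_def)
    next
      case 4
      hence "2 * n - 1 - i < n" "2 * n - 1 - j < n" "j \<noteq> 2 * n - 1 - i" using that by auto
      thus ?thesis using 4 FF by (simp add: G_def)
    qed
  qed
  let ?M = "olin G (2 * n)"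
  have M: "olattice ?M" by (rule olattice_olin)
  have EM: "E i \<in> ?M" if "i < n" for i using olin_base[of i "2 * n" G] that by (simp add: G_def)
  have FM: "F i \<in> ?M" if i: "i < n" for i
  proof -
    have a: "2 * n - 1 - i < 2 * n" "\<not> 2 * n - 1 - i < n" "2 * n - 1 - (2 * n - 1 - i) = i" using i by auto
    show ?thesis using olin_base[OF a(1), of G] unfolding G_def[of "2 * n - 1 - i"] a(3) using a(2) by simp
  qed
  have E0M: "E0 i \<in> ?M" "F0 i \<in> ?M" if "i < K" for i
    using EM[of i] FM[of i] that Kn by (auto simp: E_def F_def)
  have PE: "\<pi> powi (- \<mu> i) *s \<Phi> (E i) \<in> ?M" if i: "i < n" for i
  proof (cases "i < K")
    case True
    thus ?thesis using lat(1)[OF M E0M True] by (simp add: E_def)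
  next
    case False
    define t where "t = i - K"
    have t: "t < n - K" "i = K + t" using False i by (auto simp: t_def)
    have "\<pi> powi (- \<mu> i) *s \<Phi> (E i) = w t *s F i"
      using w[OF t(1)] t by (simp add: E_def F_def Phi_scale sig_simps pi_powi_mult)
    thus ?thesis using w[OF t(1)] FM[OF i] by (simp add: olattice_scale[OF M] vge_def)
  qed
  have PF: "\<pi> powi (\<mu> i - c) *s \<Phi> (F i) \<in> ?M" if i: "i < n" for i
  proof (cases "i < K")
    case True
    thus ?thesis using lat(2)[OF M E0M True] by (simp add: F_def)
  next
    case False
    define t where "t = i - K"
    have t: "t < n - K" "i = K + t" using False i by (auto simp: t_def)
    have "\<Phi> (\<Phi> (z t)) = \<pi> powi c *s z t" using z(1)[OF t(1)] by (simp add: mid_def)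
    hence "\<pi> powi (\<mu> i - c) *s \<Phi> (F i) = (\<pi> powi (\<mu> i - c) * (\<pi> powi l t * \<pi> powi c) / \<sigma> (w t)) *s z t"
      using t by (simp add: F_def Phi_scale sig_simps mult_ac)
    also have "\<pi> powi (\<mu> i - c) * (\<pi> powi l t * \<pi> powi c) = \<pi> powi (l t + \<mu> i)"
      unfolding pi_powi_mult by (simp add: algebra_simps)
    also have "(\<pi> powi (l t + \<mu> i) / \<sigma> (w t)) *s z t = inverse (\<sigma> (w t)) *s E i"
      using t by (simp add: E_def divide_inverse mult.commute)
    finally show ?thesis using w[OF t(1)] EM[OF i]
      by (simp add: olattice_scale[OF M] vge_def sig_simps v_inverse)
  qed
  have "\<pi> powi (- \<mu> i) *s \<Phi> (G i) \<in> ?M" if i: "i < 2 * n" for i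
  proof (cases "i < n")
    case True
    thus ?thesis using PE by (simp add: G_def)
  next
    case False
    hence "2 * n - 1 - i < n" using i by auto
    moreover have "\<mu> (2 * n - 1 - i) - c = - \<mu> i" using sym[OF i] dc by simp
    ultimately show ?thesis using PF[of "2 * n - 1 - i"] False by (simp add: G_def)
  qed
  thus "\<exists>G. (\<forall>i<2 * n. \<forall>j<2 * n. B (G i) (G j) =
      (if j = 2 * n - 1 - i then (if i < n then 1 else - 1) else 0)) \<and>
    (\<forall>i<2 * n. \<pi> powi (- \<mu> i) *s \<Phi> (G i) \<in> olin G (2 * n))" using BG by blast
qed

end

section \<open>Slope eigenbases from Newton points\<close>

text \<open>Coordinate vectors are functions on all of \<open>nat\<close>, supported below the
  dimension. One type then serves every dimension, as the locales use a whole type of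
  vectors.\<close>

definition fscale :: "'a::field \<Rightarrow> (nat \<Rightarrow> 'a) \<Rightarrow> nat \<Rightarrow> 'a" where
  "fscale c f = (\<lambda>i. c * f i)"

definition gmul :: "nat \<Rightarrow> 'a::field mat \<Rightarrow> (nat \<Rightarrow> 'a) \<Rightarrow> nat \<Rightarrow> 'a" where
  "gmul N A x = (\<lambda>i. if i < N then \<Sum>j<N. A $$ (i, j) * x j else 0)"

lemma gmul_mult:
  assumes "A \<in> carrier_mat N N" "C \<in> carrier_mat N N"
  shows "gmul N (A * C) x = gmul N A (gmul N C x)"
proof
  fix i
  show "gmul N (A * C) x i = gmul N A (gmul N C x) i"
  proof (cases "i < N")
    case True
    have "gmul N (A * C) x i = (\<Sum>j<N. \<Sum>k<N. A $$ (i, k) * C $$ (k, j) * x j)"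
      using True assms by (simp add: gmul_def scalar_prod_def sum_distrib_right lessThan_atLeast0)
    also have "\<dots> = (\<Sum>k<N. \<Sum>j<N. A $$ (i, k) * C $$ (k, j) * x j)" by (rule sum.swap)
    also have "\<dots> = gmul N A (gmul N C x) i"
      using True by (simp add: gmul_def sum_distrib_left mult.assoc)
    finally show ?thesis .
  qed (simp add: gmul_def)
qed

lemma gmul_eq_0:
  assumes A: "A \<in> carrier_mat N N" "det A \<noteq> 0" and x: "\<And>i. i < N \<Longrightarrow> gmul N A x i = 0" and j: "j < N"
  shows "x j = 0"
proof -
  have "A *\<^sub>v vec N x = 0\<^sub>v N"
    using A x by (intro eq_vecI) (auto simp: scalar_prod_def gmul_def lessThan_atLeast0)
  hence "vec N x = 0\<^sub>v N" using det_0_iff_vec_prod_zero_field[OF A(1)] A(2) by (metis vec_carrier)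
  thus ?thesis using j by (metis index_vec index_zero_vec(1))
qed

section \<open>Semilinear maps of matrices and their isoclinic blocks\<close>

context unram
begin

definition Phim :: "nat \<Rightarrow> 'a mat \<Rightarrow> (nat \<Rightarrow> 'a) \<Rightarrow> nat \<Rightarrow> 'a" where
  "Phim N b x = gmul N b (\<lambda>j. \<sigma> (x j))"

lemma semilinear_Phim: "semilinear v \<sigma> \<pi> p q fscale (Phim N b)"
proof unfold_locales
  show "Phim N b (x + y) = Phim N b x + Phim N b y" for x y
    by (rule ext) (simp add: Phim_def gmul_def sig_add distrib_left sum.distrib)
  show "Phim N b (fscale c x) = fscale (\<sigma> c) (Phim N b x)" for c x
    by (rule ext) (simp add: Phim_def gmul_def fscale_def sig_mult sum_distrib_left mult_ac)
qed (auto simp: fscale_def algebra_simps fun_eq_iff)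

lemma sig_gmul: "(\<lambda>i. \<sigma> (gmul N g y i)) = gmul N (map_mat \<sigma> g) (\<lambda>i. \<sigma> (y i))" if "g \<in> carrier_mat N N"
  using that by (intro ext) (simp add: gmul_def sig_simps)

lemma Phim_gmul:
  assumes "g \<in> carrier_mat N N" "b \<in> carrier_mat N N" "b' \<in> carrier_mat N N" "g * b' = b * map_mat \<sigma> g"
  shows "Phim N b (gmul N g y) = gmul N g (Phim N b' y)"
proof -
  have "Phim N b (gmul N g y) = gmul N (b * map_mat \<sigma> g) (\<lambda>i. \<sigma> (y i))"
    unfolding Phim_def sig_gmul[OF assms(1)] using assms(1) by (intro gmul_mult[OF assms(2), symmetric]) simp
  also have "\<dots> = gmul N g (Phim N b' y)"
    unfolding assms(4)[symmetric] Phim_def by (rule gmul_mult[OF assms(1,3)])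
  finally show ?thesis .
qed

lemma Phim_funpow_gmul:
  assumes "g \<in> carrier_mat N N" "b \<in> carrier_mat N N" "b' \<in> carrier_mat N N" "g * b' = b * map_mat \<sigma> g"
  shows "(Phim N b ^^ k) (gmul N g y) = gmul N g ((Phim N b' ^^ k) y)"
  by (induction k) (simp_all add: Phim_gmul[OF assms])

definition emb :: "nat \<Rightarrow> nat \<Rightarrow> (nat \<Rightarrow> 'a) \<Rightarrow> nat \<Rightarrow> 'a" where
  "emb o' d y = (\<lambda>i. if o' \<le> i \<and> i < o' + d then y (i - o') else 0)"

lemma sum_emb:
  assumes "o' + d \<le> N"
  shows "(\<Sum>j<N. f j * emb o' d y j) = (\<Sum>a<d. f (o' + a) * y a)"
proof -
  have "(\<Sum>j<N. f j * emb o' d y j) = (\<Sum>j\<in>{o'..<o' + d}. f j * emb o' d y j)"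
    by (rule sum.mono_neutral_right) (use assms in \<open>auto simp: emb_def\<close>)
  also have "\<dots> = (\<Sum>a<d. f (o' + a) * y a)"
    by (rule sum.reindex_bij_witness[of _ "\<lambda>a. o' + a" "\<lambda>j. j - o'"]) (auto simp: emb_def)
  finally show ?thesis .
qed

lemma Phim_emb:
  assumes "o' + d \<le> N"
    and bl: "\<And>i j. i < N \<Longrightarrow> o' \<le> j \<Longrightarrow> j < o' + d \<Longrightarrow> b' $$ (i, j) \<noteq> 0 \<Longrightarrow> o' \<le> i \<and> i < o' + d"
  shows "Phim N b' (emb o' d y) = emb o' d (Phim d (mat d d (\<lambda>(a, c). b' $$ (o' + a, o' + c))) y)"
proof
  fix i
  have s: "(\<lambda>j. \<sigma> (emb o' d y j)) = emb o' d (\<lambda>j. \<sigma> (y j))"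
    by (auto simp: emb_def fun_eq_iff sig_simps)
  have *: "Phim N b' (emb o' d y) i = (if i < N then \<Sum>a<d. b' $$ (i, o' + a) * \<sigma> (y a) else 0)"
    unfolding Phim_def gmul_def s by (simp add: sum_emb[OF assms(1)])
  show "Phim N b' (emb o' d y) i = emb o' d (Phim d (mat d d (\<lambda>(a, c). b' $$ (o' + a, o' + c))) y) i"
  proof (cases "o' \<le> i \<and> i < o' + d")
    case True
    hence "i < N" using assms(1) by simp
    show ?thesis unfolding * using True \<open>i < N\<close> by (auto simp: emb_def Phim_def gmul_def intro!: sum.cong)
  next
    case False
    have "b' $$ (i, o' + a) = 0" if "i < N" "a < d" for a using bl[of i "o' + a"] that False by auto
    thus ?thesis unfolding * using False by (auto simp: emb_def)
  qed
qed

lemma Phim_funpow_emb: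
  assumes "o' + d \<le> N"
    and bl: "\<And>i j. i < N \<Longrightarrow> o' \<le> j \<Longrightarrow> j < o' + d \<Longrightarrow> b' $$ (i, j) \<noteq> 0 \<Longrightarrow> o' \<le> i \<and> i < o' + d"
  shows "(Phim N b' ^^ k) (emb o' d y) = emb o' d ((Phim d (mat d d (\<lambda>(a, c). b' $$ (o' + a, o' + c))) ^^ k) y)"
  by (induction k) (simp_all add: Phim_emb[OF assms])

lemma twp_carrier: "B \<in> carrier_mat d d \<Longrightarrow> twp \<sigma> d B k \<in> carrier_mat d d"
  by (induction k) auto

text \<open>The support condition matters at \<open>k = 0\<close>, where the left side is
  \<open>x\<close> itself and the right side is cut off at \<open>d\<close>.\<close>

lemma Phim_twp:
  assumes B: "B \<in> carrier_mat d d" and x: "\<And>i. d \<le> i \<Longrightarrow> x i = 0"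
  shows "(Phim d B ^^ k) x = gmul d (twp \<sigma> d B k) (\<lambda>i. (\<sigma> ^^ k) (x i))"
  using x
proof (induction k arbitrary: x)
  case 0
  show ?case
  proof
    fix i
    show "(Phim d B ^^ 0) x i = gmul d (twp \<sigma> d B 0) (\<lambda>i. (\<sigma> ^^ 0) (x i)) i"
    proof (cases "i < d")
      case True
      have "gmul d (twp \<sigma> d B 0) (\<lambda>i. (\<sigma> ^^ 0) (x i)) i = (\<Sum>j<d. 1\<^sub>m d $$ (i, j) * x j)"
        using True by (simp add: gmul_def)
      also have "\<dots> = (\<Sum>j<d. if j = i then x j else 0)" by (rule sum.cong) (use True in auto)
      finally have "gmul d (twp \<sigma> d B 0) (\<lambda>i. (\<sigma> ^^ 0) (x i)) i = (\<Sum>j<d. if j = i then x j else 0)" .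
      thus ?thesis using True by simp
    qed (use 0 in \<open>simp add: gmul_def\<close>)
  qed
next
  case (Suc k)
  have "(Phim d B ^^ Suc k) x = (Phim d B ^^ k) (Phim d B x)" by (simp add: funpow_swap1)
  also have "\<dots> = gmul d (twp \<sigma> d B k) (\<lambda>i. (\<sigma> ^^ k) (Phim d B x i))"
    by (rule Suc.IH) (simp add: Phim_def gmul_def)
  also have "(\<lambda>i. (\<sigma> ^^ k) (Phim d B x i)) = gmul d (map_mat (\<sigma> ^^ k) B) (\<lambda>i. (\<sigma> ^^ Suc k) (x i))"
    using B by (intro ext) (simp add: Phim_def gmul_def sn_sum sn_mult funpow_swap1)
  also have "gmul d (twp \<sigma> d B k) \<dots> = gmul d (twp \<sigma> d B (Suc k)) (\<lambda>i. (\<sigma> ^^ Suc k) (x i))"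
    using B twp_carrier[OF B, of k] by (simp add: gmul_mult del: funpow.simps)
  finally show ?case .
qed

lemma vge_det:
  assumes "A \<in> carrier_mat d d" "\<And>i j. i < d \<Longrightarrow> j < d \<Longrightarrow> vge 0 (A $$ (i, j))"
  shows "vge 0 (det A)"
  unfolding det_def'[OF assms(1)]
proof (rule vge_sum)
  fix \<phi> assume "\<phi> \<in> {\<phi>. \<phi> permutes {0..<d}}"
  hence \<phi>: "\<phi> i < d" if "i < d" for i using that permutes_in_image[of \<phi> "{0..<d}" i] by simp
  have "vge 0 (signof \<phi> :: 'a)" by (cases "evenperm \<phi>") (auto simp: sign_def vge_def)
  moreover have "vge 0 (\<Prod>i = 0..<d. A $$ (i, \<phi> i))" using assms(2) \<phi> by (intro vge_prod) auto
  ultimately show "vge 0 (signof \<phi> * (\<Prod>i = 0..<d. A $$ (i, \<phi> i)))" by (rule vge_mult0)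
qed

text \<open>The adjugate has integral entries and turns \<open>U \<sigma>^s x\<close> into
  \<open>det U\<close> times \<open>\<sigma>^s x\<close>, where \<open>det U\<close> is a
  unit.\<close>

lemma GLO_primitive:
  assumes U: "GLO v d U" and x: "\<And>i. i \<in> {..<d} \<Longrightarrow> vge 1 (lop {..<d} (\<lambda>i j. U $$ (i, j)) s x i)"
  shows "\<forall>i\<in>{..<d}. vge 1 (x i)"
proof
  fix j assume "j \<in> {..<d}"
  hence j: "j < d" by simp
  have C: "U \<in> carrier_mat d d" "det U \<noteq> 0" "v (det U) = 0" using U by (auto simp: GLO_def GLm_def)
  have int: "vge 0 (U $$ (i, j))" if "i < d" "j < d" for i j
    using U C that by (auto simp: GLO_def mat_intg_def intg_vge)
  let ?A = "adj_mat U"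
  have A: "?A \<in> carrier_mat d d" by (rule adj_mat(1)[OF C(1)])
  have Aint: "vge 0 (?A $$ (i, j))" if "i < d" "j < d" for i j
  proof -
    have "vge 0 (det (mat_delete U j i))"
    proof (rule vge_det)
      show "mat_delete U j i \<in> carrier_mat (d - 1) (d - 1)" using mat_delete_carrier[OF C(1)] .
      show "vge 0 (mat_delete U j i $$ (a, b))" if "a < d - 1" "b < d - 1" for a b
        using that C(1) by (auto simp: mat_delete_def intro!: int)
    qed
    moreover have "vge 0 ((- 1 :: 'a) ^ (j + i))" by (intro vge_power) simp
    ultimately show ?thesis using that C(1) by (simp add: adj_mat_def cofactor_def vge_mult0)
  qed
  let ?y = "\<lambda>i. (\<sigma> ^^ s) (x i)"
  have lopg: "lop {..<d} (\<lambda>i j. U $$ (i, j)) s x = gmul d U ?y" by (auto simp: lop_def gmul_def)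
  have "gmul d ?A (gmul d U ?y) j = gmul d (det U \<cdot>\<^sub>m 1\<^sub>m d) ?y j"
    using gmul_mult[OF A C(1)] adj_mat(3)[OF C(1)] by metis
  also have "\<dots> = (\<Sum>i<d. (det U \<cdot>\<^sub>m 1\<^sub>m d) $$ (j, i) * ?y i)" using j by (simp only: gmul_def if_True)
  also have "\<dots> = (\<Sum>i<d. if i = j then det U * ?y i else 0)" by (rule sum.cong) (use j in auto)
  also have "\<dots> = det U * ?y j" using j by simp
  finally have eq: "gmul d ?A (gmul d U ?y) j = det U * ?y j" .
  have "vge 1 (gmul d ?A (gmul d U ?y) j)"
    unfolding gmul_def[of d ?A] using x j unfolding lopg by (auto intro!: vge_sum vge_mult0 Aint)
  hence "vge 1 (det U * ?y j / det U)" unfolding eq using C by (intro vge_unit_div)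
  thus "vge 1 (x j)" using C by simp
qed

text \<open>As \<open>(B \<sigma>)^s = \<pi>^r U \<sigma>^s\<close>, the fixed vectors of
  \<open>U \<sigma>^s\<close> given by Lang's theorem are the eigenvectors sought.\<close>

lemma isoclinic_basis:
  assumes B: "B \<in> carrier_mat d d" and s: "s \<ge> 1" and U: "GLO v d U" and tw: "twp \<sigma> d B s = (\<pi> powi r) \<cdot>\<^sub>m U"
  shows "\<exists>w. (\<forall>k<d. \<forall>i\<ge>d. w k i = 0) \<and> (\<forall>k<d. (Phim d B ^^ s) (w k) = fscale (\<pi> powi r) (w k)) \<and>
    (\<forall>a. (\<forall>i<d. (\<Sum>k<d. a k * w k i) = 0) \<longrightarrow> (\<forall>k<d. a k = 0))"
proof -
  have Uc: "U \<in> carrier_mat d d" using U by (auto simp: GLO_def GLm_def)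
  have "\<exists>w. (\<forall>k\<in>{..<d}. \<forall>i\<in>{..<d}. lop {..<d} (\<lambda>i j. U $$ (i, j)) s (w k) i = w k i) \<and>
    (\<forall>a. (\<forall>i\<in>{..<d}. (\<Sum>k\<in>{..<d}. a k * w k i) = 0) \<longrightarrow> (\<forall>k\<in>{..<d}. a k = 0))"
  proof (rule lang[OF _ s])
    show "vge 0 (U $$ (i, j))" if "i \<in> {..<d}" "j \<in> {..<d}" for i j
      using U Uc that by (auto simp: GLO_def mat_intg_def intg_vge)
  qed (auto intro: GLO_primitive[OF U, rule_format])
  then obtain w where w1: "\<forall>k\<in>{..<d}. \<forall>i\<in>{..<d}. lop {..<d} (\<lambda>i j. U $$ (i, j)) s (w k) i = w k i"
    and w2: "\<forall>a. (\<forall>i\<in>{..<d}. (\<Sum>k\<in>{..<d}. a k * w k i) = 0) \<longrightarrow> (\<forall>k\<in>{..<d}. a k = 0)"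
    by (elim exE conjE) (rule that)
  define w' where "w' k i = (if i < d then w k i else 0)" for k i
  have "(Phim d B ^^ s) (w' k) = fscale (\<pi> powi r) (w' k)" if k: "k < d" for k
  proof
    fix i
    have "(Phim d B ^^ s) (w' k) = gmul d (twp \<sigma> d B s) (\<lambda>i. (\<sigma> ^^ s) (w' k i))"
      by (rule Phim_twp[OF B]) (simp add: w'_def)
    moreover have "gmul d ((\<pi> powi r) \<cdot>\<^sub>m U) (\<lambda>i. (\<sigma> ^^ s) (w' k i)) i =
        (if i < d then \<pi> powi r * lop {..<d} (\<lambda>i j. U $$ (i, j)) s (w k) i else 0)"
      using Uc by (auto simp: gmul_def lop_def w'_def sum_distrib_left mult_ac intro!: sum.cong)
    ultimately show "(Phim d B ^^ s) (w' k) i = fscale (\<pi> powi r) (w' k) i"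
      using w1 k unfolding tw by (simp add: fscale_def w'_def)
  qed
  moreover have "\<forall>k<d. a k = 0" if "\<forall>i<d. (\<Sum>k<d. a k * w' k i) = 0" for a
  proof -
    have "\<forall>i\<in>{..<d}. (\<Sum>k\<in>{..<d}. a k * w k i) = 0" using that by (simp add: w'_def)
    hence "\<forall>k\<in>{..<d}. a k = 0" by (rule mp[OF spec[OF w2, of a]])
    thus ?thesis by blast
  qed
  ultimately show ?thesis by (intro exI[of _ w']) (auto simp: w'_def)
qed

end

lemma block_exists:
  fixes e :: "nat \<Rightarrow> nat"
  assumes "e 0 = 0"
  shows "i < e k \<Longrightarrow> \<exists>t<k. e t \<le> i \<and> i < e (Suc t)"
proof (induction k)
  case (Suc k)
  show ?case
  proof (cases "i < e k")
    case True
    thus ?thesis using Suc.IH less_Suc_eq by blast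
  next
    case False
    thus ?thesis using Suc.prems by (intro exI[of _ k]) simp
  qed
qed (simp add: assms)

lemma block_mono:
  fixes e :: "nat \<Rightarrow> nat"
  assumes "\<And>t. t < k \<Longrightarrow> e t < e (Suc t)"
  shows "s \<le> t \<Longrightarrow> t \<le> k \<Longrightarrow> e s \<le> e t"
proof (induction t rule: dec_induct)
  case (step t)
  thus ?case using assms[of t] by simp
qed simp

context unram
begin

text \<open>Eigenvectors of the blocks are extended by zero, moved by \<open>g\<close>, and brought
  to a common exponent \<open>S\<close>. Independence is checked block by block, as vectors of
  different blocks have disjoint supports before \<open>g\<close> is applied.\<close>

lemma slope_eigenbasis:
  assumes b: "b \<in> carrier_mat N N" and nw: "newton_point v \<sigma> \<pi> N b \<nu>"
  shows "\<exists>S X R. S \<ge> 1 \<and> even S \<and> (\<forall>k<N. \<forall>i\<ge>N. X k i = 0) \<and>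
    (\<forall>a. (\<forall>i<N. (\<Sum>k<N. a k * X k i) = 0) \<longrightarrow> (\<forall>k<N. a k = 0)) \<and>
    (\<forall>k<N. (Phim N b ^^ S) (X k) = fscale (\<pi> powi R k) (X k)) \<and>
    (\<forall>k<N. rat_of_int (R k) = rat_of_nat S * \<nu> k)"
proof -
  obtain g b' K e r s where g: "GLm N g" and b': "b' \<in> carrier_mat N N" and eq: "g * b' = b * map_mat \<sigma> g"
    and e0: "e 0 = 0" and eK: "e K = N" and es: "\<forall>t<K. e t < e (Suc t) \<and> 0 < s t"
    and bl: "\<forall>i<N. \<forall>j<N. b' $$ (i, j) \<noteq> 0 \<longrightarrow>
            (\<exists>t<K. e t \<le> i \<and> i < e (Suc t) \<and> e t \<le> j \<and> j < e (Suc t))"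
    and iso: "\<forall>t<K. let d = e (Suc t) - e t;
                   B = mat d d (\<lambda>(a, c). b' $$ (e t + a, e t + c))
               in \<exists>U. GLO v d U \<and> twp \<sigma> d B (s t) = (\<pi> powi r t) \<cdot>\<^sub>m U"
    and nu: "\<forall>t<K. \<forall>i. e t \<le> i \<and> i < e (Suc t) \<longrightarrow> \<nu> i = of_int (r t) / of_nat (s t)"
    using nw unfolding newton_point_def by (elim exE conjE) (rule that)
  have gc: "g \<in> carrier_mat N N" "det g \<noteq> 0" using g by (auto simp: GLm_def)
  have es1: "e t < e (Suc t)" and s1: "s t \<ge> 1" if "t < K" for t using es that by (auto simp: Suc_le_eq)
  have mono: "e t \<le> e t'" if "t \<le> t'" "t' \<le> K" for t t' using block_mono[of K e t t'] es1 that by blast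
  define d where "d t = e (Suc t) - e t" for t
  have ed: "e t + d t = e (Suc t)" if "t < K" for t using es1[OF that] by (simp add: d_def)
  have edN: "e t + d t \<le> N" if "t < K" for t using mono[of "Suc t" K] that ed eK by simp
  have uniq: "t = t'" if "t < K" "t' < K" "e t \<le> i" "i < e (Suc t)" "e t' \<le> i" "i < e (Suc t')" for t t' i
  proof (rule ccontr)
    assume "t \<noteq> t'"
    hence "Suc t \<le> t' \<or> Suc t' \<le> t" by auto
    thus False using mono[of "Suc t" t'] mono[of "Suc t'" t] that by auto
  qed
  have blk: "o1 \<le> i \<and> i < o1 + d t"
    if t: "t < K" "o1 = e t" and i: "i < N" and j: "o1 \<le> j" "j < o1 + d t" and nz: "b' $$ (i, j) \<noteq> 0" for t o1 i j
  proof -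
    have "j < N" using j edN[OF t(1)] t by simp
    then obtain t' where t': "t' < K" "e t' \<le> i" "i < e (Suc t')" "e t' \<le> j" "j < e (Suc t')"
      using bl i nz by blast
    have "t = t'" by (rule uniq[OF t(1) t'(1) _ _ t'(4,5)]) (use j t ed in auto)
    thus ?thesis using t' t ed by simp
  qed
  define Bm where "Bm t = mat (d t) (d t) (\<lambda>(a, c). b' $$ (e t + a, e t + c))" for t
  have "\<forall>t. \<exists>w. t < K \<longrightarrow> (\<forall>k<d t. \<forall>i\<ge>d t. w k i = 0) \<and>
      (\<forall>k<d t. (Phim (d t) (Bm t) ^^ s t) (w k) = fscale (\<pi> powi r t) (w k)) \<and>
      (\<forall>a. (\<forall>i<d t. (\<Sum>k<d t. a k * w k i) = 0) \<longrightarrow> (\<forall>k<d t. a k = 0))"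
  proof
    fix t
    show "\<exists>w. t < K \<longrightarrow> (\<forall>k<d t. \<forall>i\<ge>d t. w k i = 0) \<and>
      (\<forall>k<d t. (Phim (d t) (Bm t) ^^ s t) (w k) = fscale (\<pi> powi r t) (w k)) \<and>
      (\<forall>a. (\<forall>i<d t. (\<Sum>k<d t. a k * w k i) = 0) \<longrightarrow> (\<forall>k<d t. a k = 0))"
    proof (cases "t < K")
      case True
      obtain U where U: "GLO v (d t) U" "twp \<sigma> (d t) (Bm t) (s t) = (\<pi> powi r t) \<cdot>\<^sub>m U"
        using iso True by (auto simp: Let_def d_def Bm_def)
      have "Bm t \<in> carrier_mat (d t) (d t)" by (simp add: Bm_def)
      from isoclinic_basis[OF this s1[OF True] U] show ?thesis by (elim exE) (rule exI, rule impI)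
    qed simp
  qed
  from choice[OF this] obtain w where w: "\<And>t. t < K \<Longrightarrow> (\<forall>k<d t. \<forall>i\<ge>d t. w t k i = 0) \<and>
      (\<forall>k<d t. (Phim (d t) (Bm t) ^^ s t) (w t k) = fscale (\<pi> powi r t) (w t k)) \<and>
      (\<forall>a. (\<forall>i<d t. (\<Sum>k<d t. a k * w t k i) = 0) \<longrightarrow> (\<forall>k<d t. a k = 0))" by blast
  define bk where "bk i = (SOME t. t < K \<and> e t \<le> i \<and> i < e (Suc t))" for i
  have bk: "bk i < K" "e (bk i) \<le> i" "i < e (Suc (bk i))" if "i < N" for i
    using someI_ex[of "\<lambda>t. t < K \<and> e t \<le> i \<and> i < e (Suc t)"] block_exists[of e i K, OF e0] that eK
    unfolding bk_def by auto
  define Y where "Y i = emb (e (bk i)) (d (bk i)) (w (bk i) (i - e (bk i)))" for i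
  define X where "X i = gmul N g (Y i)" for i
  \<comment> \<open>A common multiple of the block exponents \<open>s t\<close>; the factor 2
    provides the evenness used at slope \<open>c/2\<close>.\<close>
  define S where "S = 2 * (\<Prod>t<K. s t)"
  define R where "R i = r (bk i) * int (S div s (bk i))" for i
  have S1: "S \<ge> 1" using s1 by (auto simp: S_def Suc_le_eq prod_pos)
  have sd: "s t * (S div s t) = S" if "t < K" for t
  proof -
    have "s t dvd (\<Prod>t<K. s t)" using that by (intro dvd_prodI) auto
    hence "s t dvd S" by (simp add: S_def)
    thus ?thesis by simp
  qed
  interpret V: semilinear v \<sigma> \<pi> p q fscale "Phim N b" by (rule semilinear_Phim)
  have eig: "(Phim N b ^^ S) (X i) = fscale (\<pi> powi R i) (X i)" if i: "i < N" for i
  proof -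
    let ?t = "bk i"
    have t: "?t < K" using bk[OF i] by simp
    have k: "i - e ?t < d ?t" using bk[OF i] by (simp add: d_def)
    have "(Phim N b' ^^ s ?t) (Y i) = emb (e ?t) (d ?t) ((Phim (d ?t) (Bm ?t) ^^ s ?t) (w ?t (i - e ?t)))"
      unfolding Y_def Bm_def
      by (rule Phim_funpow_emb[OF edN[OF t]]) (rule blk[OF t refl])
    also have "(Phim (d ?t) (Bm ?t) ^^ s ?t) (w ?t (i - e ?t)) = fscale (\<pi> powi r ?t) (w ?t (i - e ?t))"
      using w[OF t] k by blast
    also have "emb (e ?t) (d ?t) \<dots> = fscale (\<pi> powi r ?t) (Y i)"
      by (auto simp: Y_def emb_def fscale_def fun_eq_iff)
    finally have "(Phim N b' ^^ s ?t) (Y i) = fscale (\<pi> powi r ?t) (Y i)" .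
    hence "(Phim N b ^^ s ?t) (X i) = gmul N g (fscale (\<pi> powi r ?t) (Y i))"
      unfolding X_def Phim_funpow_gmul[OF gc(1) b b' eq] by simp
    also have "\<dots> = fscale (\<pi> powi r ?t) (X i)"
      by (auto simp: X_def gmul_def fscale_def fun_eq_iff sum_distrib_left mult_ac)
    finally have "(Phim N b ^^ (s ?t * (S div s ?t))) (X i) = fscale (\<pi> powi (r ?t * int (S div s ?t))) (X i)"
      by (rule V.eigen_power)
    thus ?thesis unfolding sd[OF t] R_def .
  qed
  have RS: "rat_of_int (R i) = rat_of_nat S * \<nu> i" if i: "i < N" for i
  proof -
    let ?t = "bk i"
    have t: "?t < K" using bk[OF i] by simp
    have "\<nu> i = of_int (r ?t) / of_nat (s ?t)" using nu t bk[OF i] by blast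
    moreover have "rat_of_nat S = rat_of_nat (s ?t) * rat_of_nat (S div s ?t)"
      by (metis sd[OF t] of_nat_mult)
    ultimately show ?thesis using s1[OF t] by (simp add: R_def)
  qed
  have ind: "\<forall>k<N. a k = 0" if a: "\<forall>i<N. (\<Sum>k<N. a k * X k i) = 0" for a
  proof (intro allI impI)
    fix k assume k: "k < N"
    have Y0: "(\<Sum>k<N. a k * Y k j) = 0" if "j < N" for j
    proof (rule gmul_eq_0[OF gc _ that])
      fix i assume i: "i < N"
      have "gmul N g (\<lambda>j. \<Sum>k<N. a k * Y k j) i = (\<Sum>j<N. \<Sum>k<N. g $$ (i, j) * (a k * Y k j))"
        using i by (simp add: gmul_def sum_distrib_left)
      also have "\<dots> = (\<Sum>k<N. \<Sum>j<N. g $$ (i, j) * (a k * Y k j))" by (rule sum.swap)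
      also have "\<dots> = (\<Sum>k<N. a k * X k i)" using i by (simp add: X_def gmul_def sum_distrib_left mult_ac)
      finally show "gmul N g (\<lambda>j. \<Sum>k<N. a k * Y k j) i = 0" using a i by simp
    qed
    let ?t = "bk k"
    have t: "?t < K" using bk[OF k] by simp
    have bkt: "bk (e ?t + c) = ?t" if "c < d ?t" for c
    proof -
      have *: "e ?t + c < e (Suc ?t)" "e ?t + c < N" using that ed[OF t] edN[OF t] by auto
      show ?thesis by (rule uniq[OF bk(1)[OF *(2)] t bk(2,3)[OF *(2)] _ *(1)]) simp
    qed
    have "(\<Sum>c<d ?t. a (e ?t + c) * w ?t c i) = 0" if i: "i < d ?t" for i
    proof -
      have "e ?t + i < N" using i edN[OF t] by simp
      hence "0 = (\<Sum>k<N. a k * Y k (e ?t + i))" using Y0 by simp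
      also have "\<dots> = (\<Sum>k\<in>{e ?t..<e ?t + d ?t}. a k * Y k (e ?t + i))"
      proof (rule sum.mono_neutral_right)
        show "\<forall>l\<in>{..<N} - {e ?t..<e ?t + d ?t}. a l * Y l (e ?t + i) = 0"
        proof
          fix l assume l: "l \<in> {..<N} - {e ?t..<e ?t + d ?t}"
          hence lN: "l < N" by simp
          have "Y l (e ?t + i) = 0"
          proof (rule ccontr)
            assume "Y l (e ?t + i) \<noteq> 0"
            hence "e (bk l) \<le> e ?t + i" "e ?t + i < e (Suc (bk l))"
              using ed[OF bk(1)[OF lN]] by (auto simp: Y_def emb_def split: if_splits)
            hence "bk l = ?t" by (rule uniq[OF bk(1)[OF lN] t]) (use i ed[OF t] in auto)
            thus False using l bk[OF lN] ed[OF t] by auto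
          qed
          thus "a l * Y l (e ?t + i) = 0" by simp
        qed
      qed (use edN[OF t] in auto)
      also have "\<dots> = (\<Sum>c<d ?t. a (e ?t + c) * Y (e ?t + c) (e ?t + i))"
        by (rule sum.reindex_bij_witness[of _ "\<lambda>c. e ?t + c" "\<lambda>j. j - e ?t"]) auto
      also have "\<dots> = (\<Sum>c<d ?t. a (e ?t + c) * w ?t c i)"
        by (rule sum.cong) (use i in \<open>auto simp: Y_def bkt emb_def\<close>)
      finally show ?thesis by simp
    qed
    hence "\<forall>c<d ?t. a (e ?t + c) = 0"
      using w[OF t] by (elim conjE) (drule spec[of _ "\<lambda>c. a (e ?t + c)"], blast)
    moreover have "k - e ?t < d ?t" "e ?t + (k - e ?t) = k" using bk[OF k] by (auto simp: d_def)
    ultimately show "a k = 0" by metis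
  qed
  show ?thesis using S1 eig RS ind
    by (intro exI[of _ S] exI[of _ X] exI[of _ R]) (auto simp: S_def X_def gmul_def)
qed

end

section \<open>Nonemptiness\<close>

context unram
begin

lemma fscale_sum: "(\<Sum>i\<in>A. fscale (c i) (E i)) j = (\<Sum>i\<in>A. c i * E i j)"
  by (induction A rule: infinite_finite_induct) (auto simp: fscale_def zero_fun_def)

lemma det_column_basis:
  assumes "\<And>c. (\<And>i. i < N \<Longrightarrow> (\<Sum>k<N. c k * E k i) = 0) \<Longrightarrow> (\<forall>k<N. c k = 0)"
  shows "det (mat N N (\<lambda>(i, j). E j i)) \<noteq> (0 :: 'a)"
proof
  let ?g = "mat N N (\<lambda>(i, j). E j i)"
  assume "det ?g = 0"
  then obtain w where w: "w \<in> carrier_vec N" "w \<noteq> 0\<^sub>v N" "?g *\<^sub>v w = 0\<^sub>v N"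
    using det_0_iff_vec_prod_zero_field[of ?g N] by auto
  have "(\<Sum>k<N. w $ k * E k i) = 0" if "i < N" for i
  proof -
    have "(?g *\<^sub>v w) $ i = 0" using w that by simp
    thus ?thesis using that w(1) by (simp add: scalar_prod_def lessThan_atLeast0 mult.commute)
  qed
  hence "\<forall>k<N. w $ k = 0" by (rule assms)
  thus False using w by auto
qed

text \<open>Column \<open>j\<close> of \<open>b \<sigma>(g)\<close> is \<open>\<Phi> (E j)\<close>,
  so the coordinates of \<open>\<pi>^(- \<mu> j) \<Phi> (E j)\<close> form the matrix
  \<open>k1\<close> of the theorem.\<close>

lemma frobenius_matrix:
  assumes b: "b \<in> carrier_mat N N"
    and E: "\<And>i j. i < N \<Longrightarrow> j < N \<Longrightarrow> Phim N b (E j) i = \<pi> powi \<mu> j * (\<Sum>l<N. k l j * E l i)"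
  shows "b * map_mat \<sigma> (mat N N (\<lambda>(i, j). E j i)) =
    mat N N (\<lambda>(i, j). E j i) * (mat N N (\<lambda>(l, j). k l j) * pi_pow \<pi> N \<mu> * 1\<^sub>m N)"
proof -
  let ?g = "mat N N (\<lambda>(i, j). E j i)" and ?k = "mat N N (\<lambda>(l, j). k l j)"
  have kp: "(?k * pi_pow \<pi> N \<mu>) $$ (l, j) = k l j * \<pi> powi \<mu> j" if "l < N" "j < N" for l j
  proof -
    have "(?k * pi_pow \<pi> N \<mu>) $$ (l, j) = (\<Sum>m<N. k l m * (if m = j then \<pi> powi \<mu> m else 0))"
      using that by (simp add: pi_pow_def scalar_prod_def lessThan_atLeast0)
    also have "\<dots> = (\<Sum>m<N. if m = j then k l m * \<pi> powi \<mu> m else 0)" by (rule sum.cong) auto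
    finally show ?thesis using that by simp
  qed
  have c: "?k * pi_pow \<pi> N \<mu> \<in> carrier_mat N N"
    by (rule mult_carrier_mat[of _ N N]) (simp_all add: pi_pow_def)
  have entry: "(?g * Q) $$ (i, j) = (\<Sum>l<N. E l i * Q $$ (l, j))" if "Q \<in> carrier_mat N N" "i < N" "j < N" for Q i j
    using that by (simp add: scalar_prod_def lessThan_atLeast0)
  have "b * map_mat \<sigma> ?g = ?g * (?k * pi_pow \<pi> N \<mu>)"
  proof (rule eq_matI)
    fix i j assume "i < dim_row (?g * (?k * pi_pow \<pi> N \<mu>))" "j < dim_col (?g * (?k * pi_pow \<pi> N \<mu>))"
    hence ij: "i < N" "j < N" by (auto simp: pi_pow_def)
    have "(b * map_mat \<sigma> ?g) $$ (i, j) = Phim N b (E j) i"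
      using ij b by (simp add: scalar_prod_def Phim_def gmul_def lessThan_atLeast0)
    also have "\<dots> = (\<Sum>l<N. E l i * (k l j * \<pi> powi \<mu> j))"
      unfolding E[OF ij] by (simp add: sum_distrib_left mult_ac)
    also have "\<dots> = (\<Sum>l<N. E l i * (?k * pi_pow \<pi> N \<mu>) $$ (l, j))" using kp ij by simp
    also have "\<dots> = (?g * (?k * pi_pow \<pi> N \<mu>)) $$ (i, j)"
      by (rule entry[OF c ij, symmetric])
    finally show "(b * map_mat \<sigma> ?g) $$ (i, j) = (?g * (?k * pi_pow \<pi> N \<mu>)) $$ (i, j)" .
  qed (use b c in auto)
  thus ?thesis unfolding right_mult_one_mat[OF c] .
qed

lemma one_in_K: "in_K v G (1\<^sub>m (rk G))"
proof (cases G)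
  case (GLgrp n)
  thus ?thesis by (simp add: in_K_def GLm_def mat_intg_def intg_vge)
next
  case (GSpgrp n)
  have J: "(Jform n :: 'a mat) \<in> carrier_mat (2 * n) (2 * n)" by (simp add: Jform_def)
  have "\<exists>c. c \<noteq> 0 \<and> transpose_mat (1\<^sub>m (2 * n)) * Jform n * 1\<^sub>m (2 * n) = c \<cdot>\<^sub>m (Jform n :: 'a mat)"
    using J by (intro exI[of _ 1]) (auto intro!: eq_matI)
  thus ?thesis using GSpgrp by (simp add: in_K_def GLm_def GSpm_def mat_intg_def intg_vge)
qed

lemma slope_dominance:
  fixes R :: "nat \<Rightarrow> int"
  assumes R: "\<And>k. k < N \<Longrightarrow> rat_of_int (R k) = rat_of_nat S * \<nu> k" and dom: "dom_le N \<nu> \<mu>" and l: "l \<le> N"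
  shows "(\<Sum>i<l. R i) \<le> int S * (\<Sum>i<l. \<mu> i)"
    and "(\<Sum>i<N. R i) = int S * (\<Sum>i<N. \<mu> i)"
proof -
  have sum: "rat_of_int (\<Sum>i<l. R i) = rat_of_nat S * (\<Sum>i<l. \<nu> i)" if "l \<le> N" for l
    using that R by (simp add: sum_distrib_left)
  have "rat_of_int (\<Sum>i<l. R i) \<le> rat_of_nat S * (\<Sum>i<l. of_int (\<mu> i))"
    unfolding sum[OF l] using dom l by (intro mult_left_mono) (auto simp: dom_le_def)
  also have "\<dots> = rat_of_int (int S * (\<Sum>i<l. \<mu> i))" by simp
  finally show "(\<Sum>i<l. R i) \<le> int S * (\<Sum>i<l. \<mu> i)" by (simp only: of_int_le_iff)
  have "rat_of_int (\<Sum>i<N. R i) = rat_of_int (int S * (\<Sum>i<N. \<mu> i))"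
    unfolding sum[OF order_refl] using dom by (simp add: dom_le_def)
  thus "(\<Sum>i<N. R i) = int S * (\<Sum>i<N. \<mu> i)" by (simp only: of_int_eq_iff)
qed

lemma slope_sorted:
  fixes R :: "nat \<Rightarrow> int"
  assumes R: "\<And>k. k < N \<Longrightarrow> rat_of_int (R k) = rat_of_nat S * \<nu> k" and dom: "dominant N \<nu>"
    and ij: "i \<le> j" "j < N"
  shows "R j \<le> R i"
proof -
  have "rat_of_int (R j) \<le> rat_of_int (R i)"
    using R[of i] R[of j] ij dom by (simp add: mult_left_mono dominant_def)
  thus ?thesis by simp
qed

text \<open>Membership in the span becomes a mere support condition, from which stability under
  \<open>Phim\<close> is immediate.\<close>

lemma function_basis:
  fixes X :: "nat \<Rightarrow> nat \<Rightarrow> 'a"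
  assumes Xs: "\<forall>k<N. \<forall>i\<ge>N. X k i = 0"
    and ind: "\<forall>a. (\<forall>i<N. (\<Sum>k<N. a k * X k i) = 0) \<longrightarrow> (\<forall>k<N. a k = 0)"
  shows "semilinear.indep fscale X N" "f \<in> semilinear.lin fscale X N \<longleftrightarrow> (\<forall>i\<ge>N. f i = 0)"
proof -
  interpret V: semilinear v \<sigma> \<pi> p q fscale "Phim N b" for b by (rule semilinear_Phim)
  show "V.indep X N" unfolding V.indep_def
  proof (intro allI impI)
    fix c k assume c: "(\<Sum>i<N. fscale (c i) (X i)) = 0" and k: "k < N"
    have "(\<Sum>k<N. c k * X k i) = 0" for i using fun_cong[OF c, of i] by (simp add: fscale_sum)
    thus "c k = 0" using ind k by blast
  qed
  show "f \<in> V.lin X N \<longleftrightarrow> (\<forall>i\<ge>N. f i = 0)"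
  proof
    assume "f \<in> V.lin X N"
    then obtain c where "f = (\<Sum>i<N. fscale (c i) (X i))" by (rule V.linE)
    thus "\<forall>i\<ge>N. f i = 0" using Xs by (auto simp: fscale_sum)
  next
    assume f: "\<forall>i\<ge>N. f i = 0"
    have "\<exists>c. \<forall>i\<in>{..<N}. (\<Sum>k\<in>{..<N}. c k * X k i) = f i"
    proof (rule square_system_solvable)
      fix c assume "\<And>i. i \<in> {..<N} \<Longrightarrow> (\<Sum>k<N. c k * X k i) = 0"
      hence "\<forall>i<N. (\<Sum>k<N. c k * X k i) = 0" by simp
      thus "\<forall>k\<in>{..<N}. c k = 0" using ind by blast
    qed auto
    then obtain c where c: "\<And>i. i < N \<Longrightarrow> (\<Sum>k<N. c k * X k i) = f i" by auto
    have "f = (\<Sum>i<N. fscale (c i) (X i))"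
    proof
      fix i
      show "f i = (\<Sum>i<N. fscale (c i) (X i)) i"
        using c[of i] f Xs by (cases "i < N") (auto simp: fscale_sum)
    qed
    thus "f \<in> V.lin X N" by (rule V.linI)
  qed
qed

text \<open>The two containments of \<open>companion_basis\<close> give integral matrices
  \<open>?k\<close> and \<open>?k'\<close> inverse to each other, so \<open>det ?k\<close> is a
  unit.\<close>

lemma GL_case:
  assumes b: "GLm N b" and nw: "newton_point v \<sigma> \<pi> N b \<nu>" and dom: "dom_le N \<nu> \<mu>"
  shows "\<exists>g k. GLm N g \<and> GLO v N k \<and> b * map_mat \<sigma> g = g * (k * pi_pow \<pi> N \<mu> * 1\<^sub>m N)"
proof -
  have bc: "b \<in> carrier_mat N N" using b by (simp add: GLm_def)
  obtain S X R where S: "S \<ge> 1" and Xs: "\<forall>k<N. \<forall>i\<ge>N. X k i = 0"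
    and ind: "\<forall>a. (\<forall>i<N. (\<Sum>k<N. a k * X k i) = 0) \<longrightarrow> (\<forall>k<N. a k = 0)"
    and eig: "\<forall>k<N. (Phim N b ^^ S) (X k) = fscale (\<pi> powi R k) (X k)"
    and R: "\<forall>k<N. rat_of_int (R k) = rat_of_nat S * \<nu> k"
    using slope_eigenbasis[OF bc nw] by (elim exE conjE) (rule that)
  have R': "rat_of_int (R k) = rat_of_nat S * \<nu> k" if "k < N" for k using R that by blast
  interpret V: semilinear v \<sigma> \<pi> p q fscale "Phim N b" by (rule semilinear_Phim)
  note Xind = function_basis(1)[OF Xs ind] and Xlin = function_basis(2)[OF Xs ind]
  have Xst: "Phim N b (X i) \<in> V.lin X N" for i unfolding Xlin by (simp add: Phim_def gmul_def)
  have nd: "dominant N \<nu>" using nw by (simp add: newton_point_def)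
  have eig': "(Phim N b ^^ S) (X k) = fscale (\<pi> powi R k) (X k)" if "k < N" for k using eig that by blast
  have Rs: "R j \<le> R i" if "i \<le> j" "j < N" for i j by (rule slope_sorted[OF R' nd that])
  obtain x P where x: "x \<in> V.lin X N" and cyc: "V.cyclic x N P"
    and Pb: "\<forall>l. P l \<noteq> 0 \<longrightarrow> (\<Sum>i<N. R i) \<le> int S * v (P l) + (\<Sum>i<l. R i)"
    and P0: "P 0 \<noteq> 0" "int S * v (P 0) = (\<Sum>i<N. R i)"
    using V.cyclic_vector[where r = R, OF S Xind eig' Xst Rs] by (auto 4 0)
  have dm: "(\<Sum>i<l. R i) \<le> int S * (\<Sum>i<l. \<mu> i)" if "l \<le> N" for l
    by (rule slope_dominance(1)[OF R' dom that])
  have "\<exists>e. V.indep e N \<and> (\<forall>i<N. e i \<in> V.lin (\<lambda>l. (Phim N b ^^ l) x) N) \<and>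
    V.lin (\<lambda>l. (Phim N b ^^ l) x) N \<subseteq> V.lin e N \<and>
    (\<forall>i<N. fscale (\<pi> powi (- \<mu> i)) (Phim N b (e i)) \<in> V.olin e N) \<and>
    (\<forall>i<N. e i \<in> V.olin (\<lambda>i. fscale (\<pi> powi (- \<mu> i)) (Phim N b (e i))) N)"
  proof (rule V.companion_basis[OF S cyc, where r = R])
    show "(\<Sum>i<N. R i) \<le> int S * v (P l) + (\<Sum>i<l. R i)" if "P l \<noteq> 0" for l using Pb that by blast
    show "(\<Sum>i<l. R i) \<le> int S * (\<Sum>i<l. \<mu> i)" if "l \<le> N" for l by (rule dm[OF that])
    show "int S * (\<Sum>i<N. \<mu> i) = (\<Sum>i<N. R i)"
      by (rule slope_dominance(2)[OF R' dom order_refl, symmetric])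
  qed (rule P0)+
  then obtain e where e: "V.indep e N" "\<forall>i<N. fscale (\<pi> powi (- \<mu> i)) (Phim N b (e i)) \<in> V.olin e N"
    "\<forall>i<N. e i \<in> V.olin (\<lambda>i. fscale (\<pi> powi (- \<mu> i)) (Phim N b (e i))) N"
    "\<forall>i<N. e i \<in> V.lin (\<lambda>l. (Phim N b ^^ l) x) N"
    by blast
  have "V.lin (\<lambda>l. (Phim N b ^^ l) x) N \<subseteq> V.lin X N"
  proof (intro V.lin_subset V.subspace_lin V.Phin_stable x)
    show "Phim N b y \<in> V.lin X N" for y unfolding Xlin by (simp add: Phim_def gmul_def)
  qed
  hence es: "e i j = 0" if "i < N" "j \<ge> N" for i j using e(4) that Xlin[of "e i"] by blast
  define H where "H i = fscale (\<pi> powi (- \<mu> i)) (Phim N b (e i))" for i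
  have "\<forall>i. \<exists>c. i < N \<longrightarrow> H i = (\<Sum>l<N. fscale (c l) (e l)) \<and> (\<forall>l<N. vge 0 (c l))"
    using e(2) unfolding H_def[symmetric] V.olin_def by blast
  then obtain k where k: "\<And>i. i < N \<Longrightarrow> H i = (\<Sum>l<N. fscale (k i l) (e l))" "\<And>i l. i < N \<Longrightarrow> l < N \<Longrightarrow> vge 0 (k i l)"
    by metis
  have "\<forall>i. \<exists>c. i < N \<longrightarrow> e i = (\<Sum>l<N. fscale (c l) (H l)) \<and> (\<forall>l<N. vge 0 (c l))"
    using e(3) unfolding H_def[symmetric] V.olin_def by blast
  then obtain k' where k': "\<And>i. i < N \<Longrightarrow> e i = (\<Sum>l<N. fscale (k' i l) (H l))" "\<And>i l. i < N \<Longrightarrow> l < N \<Longrightarrow> vge 0 (k' i l)"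
    by metis
  let ?g = "mat N N (\<lambda>(i, j). e j i)" and ?k = "mat N N (\<lambda>(l, j). k j l)" and ?k' = "mat N N (\<lambda>(l, j). k' j l)"
  have "GLm N ?g" unfolding GLm_def
  proof
    show "det ?g \<noteq> 0"
    proof (rule det_column_basis)
      fix c assume c: "\<And>i. i < N \<Longrightarrow> (\<Sum>k<N. c k * e k i) = 0"
      have "(\<Sum>i<N. fscale (c i) (e i)) = 0"
      proof
        fix i
        show "(\<Sum>i<N. fscale (c i) (e i)) i = 0 i"
          using c[of i] es by (cases "i < N") (auto simp: fscale_sum)
      qed
      thus "\<forall>k<N. c k = 0" using e(1) unfolding V.indep_def by blast
    qed
  qed simp
  moreover have "b * map_mat \<sigma> ?g = ?g * (?k * pi_pow \<pi> N \<mu> * 1\<^sub>m N)"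
  proof (rule frobenius_matrix[OF bc])
    fix i j assume ij: "i < N" "j < N"
    have "Phim N b (e j) i = \<pi> powi \<mu> j * H j i"
      by (simp add: H_def fscale_def mult.assoc[symmetric] pi_powi_mult)
    thus "Phim N b (e j) i = \<pi> powi \<mu> j * (\<Sum>l<N. k j l * e l i)" unfolding k(1)[OF ij(2)] fscale_sum .
  qed
  moreover have "GLO v N ?k"
  proof -
    have kk: "(\<Sum>i<N. k' l i * k i m) = (if m = l then 1 else 0)" if l: "l < N" and m: "m < N" for l m
    proof -
      have el: "e l j = (\<Sum>m<N. (\<Sum>i<N. k' l i * k i m) * e m j)" for j
      proof -
        have "e l j = (\<Sum>i<N. k' l i * H i j)" by (subst k'(1)[OF l]) (rule fscale_sum)
        also have "\<dots> = (\<Sum>i<N. k' l i * (\<Sum>m<N. k i m * e m j))"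
          by (rule sum.cong) (auto simp: k(1) fscale_sum)
        also have "\<dots> = (\<Sum>i<N. \<Sum>m<N. k' l i * k i m * e m j)"
          by (simp only: sum_distrib_left mult.assoc)
        also have "\<dots> = (\<Sum>m<N. \<Sum>i<N. k' l i * k i m * e m j)" by (rule sum.swap)
        finally show ?thesis by (simp only: sum_distrib_right)
      qed
      have el': "(\<Sum>m<N. (if m = l then 1 else 0) * e m j) = e l j" for j
        using l by (simp add: if_distrib[of "\<lambda>c. c * _"] cong: if_cong)
      have "(\<Sum>m<N. fscale ((\<Sum>i<N. k' l i * k i m) - (if m = l then 1 else 0)) (e m)) j = 0 j" for j
        unfolding fscale_sum left_diff_distrib sum_subtractf el[symmetric] el' by simp
      hence "(\<Sum>m<N. fscale ((\<Sum>i<N. k' l i * k i m) - (if m = l then 1 else 0)) (e m)) = 0" by (rule ext)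
      from V.indep_eq_0[OF e(1) this m] show ?thesis by simp
    qed
    have "?k * ?k' = 1\<^sub>m N"
    proof (rule eq_matI)
      fix a b assume "a < dim_row (1\<^sub>m N)" "b < dim_col (1\<^sub>m N)"
      hence ab: "a < N" "b < N" by auto
      have "(?k * ?k') $$ (a, b) = (\<Sum>i<N. k' b i * k i a)"
        using ab by (simp add: scalar_prod_def lessThan_atLeast0 mult.commute)
      thus "(?k * ?k') $$ (a, b) = 1\<^sub>m N $$ (a, b)" unfolding kk[OF ab(2,1)] using ab by simp
    qed auto
    hence "det ?k * det ?k' = 1" using det_mult[of ?k N ?k'] by simp
    moreover have "vge 0 (det ?k)" "vge 0 (det ?k')"
      using k(2) k'(2) by (auto intro!: vge_det)
    moreover from calculation have "det ?k \<noteq> 0" "det ?k' \<noteq> 0" by auto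
    ultimately have "det ?k \<noteq> 0" "v (det ?k) = 0"
      using v_mult[of "det ?k" "det ?k'"] vge_v[of 0 "det ?k"] vge_v[of 0 "det ?k'"] by auto
    thus ?thesis using k(2) by (auto simp: GLO_def GLm_def mat_intg_def intg_vge)
  qed
  ultimately show ?thesis by blast
qed

section \<open>The similitude group in coordinates\<close>

lemma Jform_index: "i < 2 * n \<Longrightarrow> j < 2 * n \<Longrightarrow>
    (Jform n :: 'a mat) $$ (i, j) = (if j = 2 * n - 1 - i then (if i < n then 1 else - 1) else 0)"
  by (simp add: Jform_def)

lemma Jform_congruence:
  fixes M :: "'a mat"
  assumes "M \<in> carrier_mat (2 * n) (2 * n)" "i < 2 * n" "j < 2 * n"
  shows "(transpose_mat M * Jform n * M) $$ (i, j) =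
    (\<Sum>l<2 * n. (if l < n then 1 else - 1) * M $$ (l, i) * M $$ (2 * n - 1 - l, j))"
proof -
  let ?J = "Jform n :: 'a mat"
  have J: "?J \<in> carrier_mat (2 * n) (2 * n)" by (simp add: Jform_def)
  have JM: "(?J * M) $$ (l, j) = (if l < n then 1 else - 1) * M $$ (2 * n - 1 - l, j)" if l: "l < 2 * n" for l
  proof -
    have "(?J * M) $$ (l, j) = (\<Sum>m<2 * n. ?J $$ (l, m) * M $$ (m, j))"
      using assms J l by (simp add: scalar_prod_def lessThan_atLeast0)
    also have "\<dots> = (\<Sum>m<2 * n. if m = 2 * n - 1 - l then (if l < n then 1 else - 1) * M $$ (m, j) else 0)"
      by (rule sum.cong) (auto simp: Jform_index l)
    finally show ?thesis using l by simp
  qed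
  have "transpose_mat M * ?J * M = transpose_mat M * (?J * M)"
    using assms J by (intro assoc_mult_mat) auto
  hence "(transpose_mat M * ?J * M) $$ (i, j) = (\<Sum>l<2 * n. M $$ (l, i) * (?J * M) $$ (l, j))"
    using assms J by (simp add: scalar_prod_def lessThan_atLeast0)
  also have "\<dots> = (\<Sum>l<2 * n. (if l < n then 1 else - 1) * M $$ (l, i) * M $$ (2 * n - 1 - l, j))"
    by (rule sum.cong) (auto simp: JM)
  finally show ?thesis .
qed

lemma det_Jform: "det (Jform n :: 'a mat) \<noteq> 0"
proof
  let ?J = "Jform n :: 'a mat"
  have J: "?J \<in> carrier_mat (2 * n) (2 * n)" by (simp add: Jform_def)
  assume "det ?J = 0"
  then obtain w where w: "w \<in> carrier_vec (2 * n)" "w \<noteq> 0\<^sub>v (2 * n)" "?J *\<^sub>v w = 0\<^sub>v (2 * n)"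
    using det_0_iff_vec_prod_zero_field[OF J] by blast
  have "w $ i = 0" if i: "i < 2 * n" for i
  proof -
    let ?l = "2 * n - 1 - i"
    have l: "?l < 2 * n" "2 * n - 1 - ?l = i" using i by auto
    have "(?J *\<^sub>v w) $ ?l = 0" using w l by simp
    hence "(\<Sum>m<2 * n. ?J $$ (?l, m) * w $ m) = 0"
      using w(1) J l(1) by (simp add: scalar_prod_def lessThan_atLeast0)
    moreover have "(\<Sum>m<2 * n. ?J $$ (?l, m) * w $ m) = (\<Sum>m<2 * n. if m = i then (if ?l < n then 1 else - 1) * w $ m else 0)"
      by (rule sum.cong) (use l in \<open>auto simp: Jform_index\<close>)
    ultimately show ?thesis using i by (simp split: if_splits)
  qed
  thus False using w by auto
qed

text \<open>Applies \<open>symplectic_lattice\<close> to the rescaled form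
  \<open>B = \<omega> B0\<close>. The basis matrix \<open>?g\<close> has multiplier
  \<open>\<omega>^(-1)\<close>. The matrix \<open>?k\<close> has multiplier 1, because
  \<open>\<mu> i + \<mu> (2n - 1 - i) = c\<close> balances the multiplier \<open>\<pi>^c\<close> of
  \<open>\<Phi>\<close>.\<close>

lemma GSp_case:
  assumes n: "n \<ge> 1" and b: "GSpm n b" and nw: "newton_point v \<sigma> \<pi> (2 * n) b \<nu>" and dom: "dom_le (2 * n) \<nu> \<mu>"
    and sym: "\<forall>i<2 * n. \<mu> i + \<mu> (2 * n - 1 - i) = \<mu> 0 + \<mu> (2 * n - 1)" and srt: "dominant (2 * n) \<mu>"
  shows "\<exists>g k. GSpm n g \<and> in_K v (GSpgrp n) k \<and> b * map_mat \<sigma> g = g * (k * pi_pow \<pi> (2 * n) \<mu> * 1\<^sub>m (2 * n))"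
proof -
  let ?N = "2 * n"
  let ?s = "\<lambda>l. if l < n then 1 else (- 1 :: 'a)"
  let ?J = "Jform n :: 'a mat"
  have J: "?J \<in> carrier_mat ?N ?N" by (simp add: Jform_def)
  have bc: "b \<in> carrier_mat ?N ?N" using b by (simp add: GSpm_def GLm_def)
  obtain c0 where c0: "c0 \<noteq> 0" "transpose_mat b * ?J * b = c0 \<cdot>\<^sub>m ?J" using b by (auto simp: GSpm_def)
  obtain S X R where S: "S \<ge> 1" "even S" and Xs: "\<forall>k<?N. \<forall>i\<ge>?N. X k i = 0"
    and ind: "\<forall>a. (\<forall>i<?N. (\<Sum>k<?N. a k * X k i) = 0) \<longrightarrow> (\<forall>k<?N. a k = 0)"
    and eig: "\<forall>k<?N. (Phim ?N b ^^ S) (X k) = fscale (\<pi> powi R k) (X k)"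
    and R: "\<forall>k<?N. rat_of_int (R k) = rat_of_nat S * \<nu> k"
    using slope_eigenbasis[OF bc nw] by (elim exE conjE) (rule that)
  have R': "rat_of_int (R k) = rat_of_nat S * \<nu> k" if "k < ?N" for k using R that by blast
  interpret V: semilinear v \<sigma> \<pi> p q fscale "Phim ?N b" by (rule semilinear_Phim)
  note Xind = function_basis(1)[OF Xs ind] and Xlin = function_basis(2)[OF Xs ind]
  have nd: "dominant ?N \<nu>" using nw by (simp add: newton_point_def)
  define c where "c = v c0"
  define u where "u = c0 * \<pi> powi (- c)"
  have u: "u \<noteq> 0" "v u = 0" using c0(1) by (auto simp: u_def v_mult c_def)
  \<comment> \<open>Lang's theorem in rank one: the kernel of \<open>\<sigma> - u\<close>, whose two
    coefficients are units.\<close>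
  obtain \<omega> where om: "\<omega> \<noteq> 0" "\<sigma> \<omega> = u * \<omega>"
  proof -
    have "\<exists>a. a \<noteq> 0 \<and> v a = 0 \<and> ell (\<lambda>j. if j = 0 then - u else 1) 1 a = 0"
      by (rule ell_kernel[of _ _ 0 1]) (use u in \<open>auto simp: vge_def\<close>)
    then obtain a where "a \<noteq> 0" "ell (\<lambda>j. if j = 0 then - u else 1) 1 a = 0" by blast
    thus ?thesis by (intro that[of a]) (auto simp: ell_def)
  qed
  define B0 where "B0 x y = (\<Sum>l<?N. ?s l * x l * y (?N - 1 - l))" for x y :: "nat \<Rightarrow> 'a"
  define B where "B x y = \<omega> * B0 x y" for x y
  have B0_Phi: "B0 (Phim ?N b x) (Phim ?N b y) = c0 * \<sigma> (B0 x y)" for x y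
  proof -
    have "B0 (Phim ?N b x) (Phim ?N b y) =
        (\<Sum>l<?N. \<Sum>i<?N. \<Sum>j<?N. (?s l * b $$ (l, i) * b $$ (?N - 1 - l, j)) * (\<sigma> (x i) * \<sigma> (y j)))"
      unfolding B0_def
    proof (rule sum.cong)
      fix l assume "l \<in> {..<?N}"
      hence l: "l < ?N" "?N - 1 - l < ?N" by auto
      have "?s l * Phim ?N b x l * Phim ?N b y (?N - 1 - l) =
          ?s l * ((\<Sum>i<?N. b $$ (l, i) * \<sigma> (x i)) * (\<Sum>j<?N. b $$ (?N - 1 - l, j) * \<sigma> (y j)))"
        unfolding Phim_def gmul_def using l by (simp only: if_True mult.assoc)
      also have "\<dots> = (\<Sum>i<?N. \<Sum>j<?N. (?s l * b $$ (l, i) * b $$ (?N - 1 - l, j)) * (\<sigma> (x i) * \<sigma> (y j)))"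
        unfolding sum_product unfolding sum_distrib_left by (simp only: mult_ac)
      finally show "?s l * Phim ?N b x l * Phim ?N b y (?N - 1 - l) =
          (\<Sum>i<?N. \<Sum>j<?N. (?s l * b $$ (l, i) * b $$ (?N - 1 - l, j)) * (\<sigma> (x i) * \<sigma> (y j)))" .
    qed simp
    also have "\<dots> = (\<Sum>i<?N. \<Sum>l<?N. \<Sum>j<?N. (?s l * b $$ (l, i) * b $$ (?N - 1 - l, j)) * (\<sigma> (x i) * \<sigma> (y j)))"
      by (rule sum.swap)
    also have "\<dots> = (\<Sum>i<?N. \<Sum>j<?N. \<Sum>l<?N. (?s l * b $$ (l, i) * b $$ (?N - 1 - l, j)) * (\<sigma> (x i) * \<sigma> (y j)))"
      by (rule sum.cong[OF refl]) (rule sum.swap)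
    also have "\<dots> = (\<Sum>i<?N. \<Sum>j<?N. (c0 * ?J $$ (i, j)) * (\<sigma> (x i) * \<sigma> (y j)))"
    proof (intro sum.cong refl)
      fix i j assume "i \<in> {..<?N}" "j \<in> {..<?N}"
      hence ij: "i < ?N" "j < ?N" by auto
      have "(\<Sum>l<?N. ?s l * b $$ (l, i) * b $$ (?N - 1 - l, j)) = c0 * ?J $$ (i, j)"
        unfolding Jform_congruence[OF bc ij, symmetric] c0(2) using ij J by simp
      thus "(\<Sum>l<?N. (?s l * b $$ (l, i) * b $$ (?N - 1 - l, j)) * (\<sigma> (x i) * \<sigma> (y j))) =
          (c0 * ?J $$ (i, j)) * (\<sigma> (x i) * \<sigma> (y j))" unfolding sum_distrib_right[symmetric] by simp
    qed
    also have "\<dots> = (\<Sum>i<?N. \<Sum>j<?N. if j = ?N - 1 - i then c0 * (?s i * \<sigma> (x i) * \<sigma> (y j)) else 0)"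
      by (intro sum.cong refl) (auto simp: Jform_index)
    also have "\<dots> = (\<Sum>i<?N. c0 * (?s i * \<sigma> (x i) * \<sigma> (y (?N - 1 - i))))"
      by (rule sum.cong[OF refl]) (subst sum.delta, auto)
    also have "\<dots> = c0 * \<sigma> (B0 x y)"
      unfolding B0_def by (simp add: sig_simps sum_distrib_left[symmetric] if_distrib[of \<sigma>] cong: if_cong)
    finally show ?thesis .
  qed
  have B0_anti: "B0 x y = - B0 y x" for x y
  proof -
    have "B0 x y = (\<Sum>l<?N. ?s (?N - 1 - l) * x (?N - 1 - l) * y l)"
      unfolding B0_def
      by (rule sum.reindex_bij_witness[of _ "\<lambda>l. ?N - 1 - l" "\<lambda>l. ?N - 1 - l"]) auto
    also have "\<dots> = (\<Sum>l<?N. - (?s l * y l * x (?N - 1 - l)))"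
      by (rule sum.cong) (auto simp: mult_ac)
    finally show ?thesis by (simp add: B0_def sum_negf)
  qed
  have B0_unit: "B0 x (\<lambda>j. if j = ?N - 1 - i then 1 else 0) = ?s i * x i" if i: "i < ?N" for x i
  proof -
    have "B0 x (\<lambda>j. if j = ?N - 1 - i then 1 else 0) = (\<Sum>l<?N. if l = i then ?s l * x l else 0)"
      unfolding B0_def by (rule sum.cong) (use i in auto)
    thus ?thesis using i by simp
  qed
  interpret W: polarized v \<sigma> \<pi> p q fscale "Phim ?N b" B c X n S R
  proof unfold_locales
    show "B (x + y) z = B x z + B y z" for x y z
      by (simp add: B_def B0_def sum.distrib[symmetric] distrib_left[symmetric] algebra_simps)
    show "B (fscale a x) z = a * B x z" for a x z
      by (simp add: B_def B0_def fscale_def sum_distrib_left mult_ac)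
    show "B x y = - B y x" for x y using B0_anti[of x y] by (simp add: B_def)
    show "B (Phim ?N b x) (Phim ?N b y) = \<pi> powi c * \<sigma> (B x y)" for x y
    proof -
      have "\<pi> powi c * u = c0" unfolding u_def by (simp add: pi_powi_mult mult.left_commute)
      thus ?thesis unfolding B_def B0_Phi by (simp add: sig_simps om(2) mult_ac)
    qed
    show "S \<ge> 1" by (rule S(1))
    show "V.indep X ?N" by (rule Xind)
    show "(Phim ?N b ^^ S) (X i) = fscale (\<pi> powi R i) (X i)" if "i < ?N" for i using eig that by blast
    show "Phim ?N b (X i) \<in> V.lin X ?N" for i unfolding Xlin by (simp add: Phim_def gmul_def)
    show "R j \<le> R i" if "i \<le> j" "j < ?N" for i j by (rule slope_sorted[OF R' nd that])
    \<comment> \<open>Orthogonality to the eigenbasis extends to all coordinate vectors, and pairing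
      with the one in position \<open>2n - 1 - i\<close> reads off \<open>x i\<close> up to a
      nonzero factor.\<close>
    fix x assume x: "x \<in> V.lin X ?N" and z: "\<And>i. i < ?N \<Longrightarrow> B x (X i) = 0"
    have all0: "B x f = 0" if f: "f \<in> V.lin X ?N" for f
    proof -
      obtain a where a: "f = (\<Sum>i<?N. fscale (a i) (X i))" using f by (rule V.linE)
      have "B x f = (\<Sum>i<?N. a i * B x (X i))"
        unfolding a B_def B0_def fscale_sum
        by (simp add: sum_distrib_left mult_ac) (subst sum.swap, simp add: mult_ac)
      thus ?thesis using z by simp
    qed
    show "x = 0"
    proof
      fix i
      show "x i = 0 i"
      proof (cases "i < ?N")
        case True
        have "B x (\<lambda>j. if j = ?N - 1 - i then 1 else 0) = 0" by (rule all0) (use True in \<open>auto simp: Xlin\<close>)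
        thus ?thesis using om(1) B0_unit[OF True] by (simp add: B_def split: if_splits)
      qed (use x Xlin in auto)
    qed
  qed
  have sym': "\<mu> i + \<mu> (?N - 1 - i) = \<mu> 0 + \<mu> (?N - 1)" if "i < ?N" for i using sym that by blast
  have srt': "\<mu> j \<le> \<mu> i" if "i \<le> j" "j < ?N" for i j using srt that by (simp add: dominant_def)
  have dm: "(\<Sum>i<l. R i) \<le> int S * (\<Sum>i<l. \<mu> i)" if "l \<le> ?N" for l
    by (rule slope_dominance(1)[OF R' dom that])
  note SL = W.symplectic_lattice[OF S(2) n sym' srt' dm slope_dominance(2)[OF R' dom order_refl]]
  have dc: "\<mu> 0 + \<mu> (?N - 1) = c" using SL(1) by blast
  obtain G where G: "\<And>i j. i < ?N \<Longrightarrow> j < ?N \<Longrightarrow> B (G i) (G j) = (if j = ?N - 1 - i then ?s i else 0)"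
    "\<forall>i<?N. fscale (\<pi> powi (- \<mu> i)) (Phim ?N b (G i)) \<in> V.olin G ?N"
    using SL(2) by auto
  define H where "H i = fscale (\<pi> powi (- \<mu> i)) (Phim ?N b (G i))" for i
  have "\<forall>i. \<exists>a. i < ?N \<longrightarrow> H i = (\<Sum>l<?N. fscale (a l) (G l)) \<and> (\<forall>l<?N. vge 0 (a l))"
    using G(2) unfolding H_def[symmetric] V.olin_def by blast
  then obtain k where k: "\<And>i. i < ?N \<Longrightarrow> H i = (\<Sum>l<?N. fscale (k i l) (G l))"
      "\<And>i l. i < ?N \<Longrightarrow> l < ?N \<Longrightarrow> vge 0 (k i l)"
    by metis
  let ?g = "mat ?N ?N (\<lambda>(i, j). G j i)" and ?k = "mat ?N ?N (\<lambda>(l, j). k j l)"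
  have "b * map_mat \<sigma> ?g = ?g * (?k * pi_pow \<pi> ?N \<mu> * 1\<^sub>m ?N)"
  proof (rule frobenius_matrix[OF bc])
    fix i j assume ij: "i < ?N" "j < ?N"
    have "Phim ?N b (G j) i = \<pi> powi \<mu> j * H j i"
      by (simp add: H_def fscale_def mult.assoc[symmetric] pi_powi_mult)
    thus "Phim ?N b (G j) i = \<pi> powi \<mu> j * (\<Sum>l<?N. k j l * G l i)" unfolding k(1)[OF ij(2)] fscale_sum .
  qed
  moreover have "GSpm n ?g"
  proof -
    have "transpose_mat ?g * ?J * ?g = inverse \<omega> \<cdot>\<^sub>m ?J"
    proof (rule eq_matI)
      fix i j assume "i < dim_row (inverse \<omega> \<cdot>\<^sub>m ?J)" "j < dim_col (inverse \<omega> \<cdot>\<^sub>m ?J)"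
      hence ij: "i < ?N" "j < ?N" using J by auto
      have "(transpose_mat ?g * ?J * ?g) $$ (i, j) = (\<Sum>l<?N. ?s l * ?g $$ (l, i) * ?g $$ (?N - 1 - l, j))"
        by (rule Jform_congruence) (use ij in auto)
      also have "\<dots> = B0 (G i) (G j)" unfolding B0_def by (rule sum.cong) (use ij in auto)
      also have "\<dots> = inverse \<omega> * B (G i) (G j)" using om(1) by (simp add: B_def)
      finally show "(transpose_mat ?g * ?J * ?g) $$ (i, j) = (inverse \<omega> \<cdot>\<^sub>m ?J) $$ (i, j)"
        using ij J by (simp add: G(1) Jform_index)
    qed (use J in auto)
    moreover have "det ?g \<noteq> 0"
    proof (rule det_column_basis)
      fix a assume a: "\<And>i. i < ?N \<Longrightarrow> (\<Sum>m<?N. a m * G m i) = 0"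
      show "\<forall>m<?N. a m = 0"
      proof (intro allI impI)
        fix m assume m: "m < ?N"
        have "(\<Sum>i<?N. a i * B (G i) (G (?N - 1 - m))) = \<omega> * B0 (\<lambda>l. \<Sum>i<?N. a i * G i l) (G (?N - 1 - m))"
          unfolding B_def B0_def
          by (simp add: sum_distrib_left sum_distrib_right mult_ac) (subst sum.swap, simp add: mult_ac)
        also have "\<dots> = 0" unfolding B0_def using a by simp
        finally have "(\<Sum>i<?N. a i * B (G i) (G (?N - 1 - m))) = 0" .
        moreover have "(\<Sum>i<?N. a i * B (G i) (G (?N - 1 - m))) = (\<Sum>i<?N. if i = m then a i * ?s i else 0)"
          by (rule sum.cong) (use m in \<open>auto simp: G(1)\<close>)
        ultimately show "a m = 0" using m by (simp split: if_splits)
      qed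
    qed
    ultimately show ?thesis unfolding GSpm_def GLm_def using om(1)
      by (intro conjI exI[of _ "inverse \<omega>"]) auto
  qed
  moreover have "in_K v (GSpgrp n) ?k"
  proof -
    have kJ: "transpose_mat ?k * ?J * ?k = 1 \<cdot>\<^sub>m ?J"
    proof (rule eq_matI)
      fix i j assume "i < dim_row (1 \<cdot>\<^sub>m ?J)" "j < dim_col (1 \<cdot>\<^sub>m ?J)"
      hence ij: "i < ?N" "j < ?N" using J by auto
      have "(transpose_mat ?k * ?J * ?k) $$ (i, j) = (\<Sum>l<?N. ?s l * ?k $$ (l, i) * ?k $$ (?N - 1 - l, j))"
        by (rule Jform_congruence) (use ij in auto)
      also have "\<dots> = (\<Sum>l<?N. ?s l * k i l * k j (?N - 1 - l))" by (rule sum.cong) (use ij in auto)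
      also have "\<dots> = (\<Sum>l<?N. \<Sum>m<?N. if m = ?N - 1 - l then k i l * k j m * ?s l else 0)"
        by (rule sum.cong[OF refl]) (subst sum.delta, auto simp: mult_ac)
      also have "\<dots> = (\<Sum>l<?N. \<Sum>m<?N. k i l * (k j m * B (G l) (G m)))"
        by (intro sum.cong refl) (auto simp: G(1))
      \<comment> \<open>The columns of \<open>?k\<close> are the coordinates of the
        \<open>H i\<close> in the basis \<open>G\<close>, so the congruence computes the Gram matrix
        of \<open>H\<close>.\<close>
      also have "\<dots> = B (H i) (H j)"
        unfolding k(1)[OF ij(1)] W.B_sum W.B_scale
        unfolding k(1)[OF ij(2)] W.B_sum_right W.B_scale_right sum_distrib_left ..
      also have "\<dots> = \<pi> powi (- \<mu> i) * (\<pi> powi (- \<mu> j) * (\<pi> powi c * \<sigma> (B (G i) (G j))))"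
        by (simp add: H_def W.B_scale W.B_scale_right W.B_Phi)
      also have "\<dots> = (if j = ?N - 1 - i then ?s i else 0)"
      proof (cases "j = ?N - 1 - i")
        case True
        hence "\<mu> i + \<mu> j = c" using sym'[OF ij(1)] dc by simp
        hence "\<pi> powi (- \<mu> i) * (\<pi> powi (- \<mu> j) * \<pi> powi c) = 1" unfolding pi_powi_mult by (simp add: algebra_simps)
        hence cl: "\<pi> powi (- \<mu> i) * (\<pi> powi (- \<mu> j) * (\<pi> powi c * z)) = z" for z
          by (metis mult.assoc mult_1)
        show ?thesis unfolding cl using True ij by (simp add: G(1) sig_simps)
      next
        case False
        thus ?thesis using ij by (simp add: G(1) sig_simps)
      qed
      finally show "(transpose_mat ?k * ?J * ?k) $$ (i, j) = (1 \<cdot>\<^sub>m ?J) $$ (i, j)"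
        using ij J by (simp add: Jform_index)
    qed (use J in auto)
    have kc: "?k \<in> carrier_mat ?N ?N" by simp
    have "det (transpose_mat ?k * ?J * ?k) = det ?k * det ?J * det ?k"
      using J kc det_mult[of "transpose_mat ?k * ?J" ?N ?k] det_mult[of "transpose_mat ?k" ?N ?J] det_transpose[OF kc]
      by simp
    hence "(det ?k * det ?k) * det ?J = 1 * det ?J" unfolding kJ by (simp add: mult_ac)
    hence dk: "det ?k * det ?k = 1" using det_Jform[of n] by simp
    hence "det ?k \<noteq> 0" by auto
    moreover have "v (det ?k) = 0" using dk v_mult[of "det ?k" "det ?k"] calculation by simp
    ultimately show ?thesis using kJ k(2)
      by (auto simp: in_K_def GSpm_def GLm_def mat_intg_def intg_vge intro!: exI[of _ 1])
  qed
  ultimately show ?thesis by blast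
qed

end

theorem theorem4p11:
  fixes v :: "'a::field_char_0 \<Rightarrow> int" and \<sigma> :: "'a \<Rightarrow> 'a" and \<pi> :: 'a
    and p q :: nat and G :: grp and b :: "'a mat"
    and \<nu> :: "nat \<Rightarrow> rat" and \<mu> :: "nat \<Rightarrow> int"
  assumes "unram_setting v \<sigma> \<pi> p q"
    and "1 \<le> grp_n G"
    and "in_G G b"
    and "newton_point v \<sigma> \<pi> (rk G) b \<nu>"
    and "cochar G \<mu>" and "dominant (rk G) \<mu>"
    and "dom_le (rk G) \<nu> \<mu>"
  shows "\<exists>g k1 k2. in_G G g \<and> in_K v G k1 \<and> in_K v G k2 \<and>
           b * map_mat \<sigma> g = g * (k1 * pi_pow \<pi> (rk G) \<mu> * k2)"
proof -
  interpret unram v \<sigma> \<pi> p q by unfold_locales (rule assms(1))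
  have "\<exists>g k. in_G G g \<and> in_K v G k \<and> b * map_mat \<sigma> g = g * (k * pi_pow \<pi> (rk G) \<mu> * 1\<^sub>m (rk G))"
  proof (cases G)
    case (GLgrp n)
    note A = assms(2-7)[unfolded GLgrp grp_n.simps rk.simps in_G.simps cochar.simps]
    obtain g k where "GLm n g" "GLO v n k" "b * map_mat \<sigma> g = g * (k * pi_pow \<pi> n \<mu> * 1\<^sub>m n)"
      using GL_case[OF A(2,3,6)] by blast
    thus ?thesis using GLgrp by (intro exI[of _ g] exI[of _ k]) (simp add: in_K_def GLO_def)
  next
    case (GSpgrp n)
    note A = assms(2-7)[unfolded GSpgrp grp_n.simps rk.simps in_G.simps cochar.simps]
    obtain g k where "GSpm n g" "in_K v (GSpgrp n) k"
      "b * map_mat \<sigma> g = g * (k * pi_pow \<pi> (2 * n) \<mu> * 1\<^sub>m (2 * n))"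
      using GSp_case[OF A(1-3,6,4,5)] by blast
    thus ?thesis using GSpgrp by (intro exI[of _ g] exI[of _ k]) simp
  qed
  thus ?thesis using one_in_K[of G] by blast
qed

end
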